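(* Let $d\ge3$. There is a constant $C_d$, depending only on $d$, such that for all $n$ and all $2\le p<\infty$, $$\sup\ \|\Phi_{t_1,t_2,k}\|_{L^p([0,1]^d)}\ \le\ C_d\,p^{\,d-1/2}\,n^{\,d-3/2},$$ where the supremum is over all $1\le k\le d$ and $1\le t_1,t_2\le q$, and $$\Phi_{t_1,t_2,k}=\sum_{\substack{\vec r\in\mathbb A_{t_1},\ \vec s\in\mathbb A_{t_2}\\ \vec r\ne\vec s,\ r_k=s_k}}f_{\vec r}\cdot f_{\vec s}.$$
   Context: For a dyadic interval $I$ let $h_I=-\mathbf 1_{I_{\rm left}}+\mathbf 1_{I_{\rm right}}$, and for a dyadic rectangle $R=R_1\times\cdots\times R_d\subset[0,1]^d$ let $h_R(x)=\prod_{j=1}^dh_{R_j}(x_j)$. $\mathbb H_n$ is the set of vectors $\vec r=(r_1,\dots,r_d)$ of nonnegative integers with $\sum_jr_j=n$. $\mathcal R_{\vec r}$ is the set of dyadic rectangles $R\subset[0,1]^d$ with $|R_j|=2^{-r_j}$ for all $j$. Given real coefficients $\alpha(R)$, put $f_{\vec r}=\sum_{R\in\mathcal R_{\vec r}}\operatorname{sgn}(\alpha(R))\,h_R$, where $\operatorname{sgn}$ takes values in $\{\pm1\}$ (with $\operatorname{sgn}(0)=1$); the coefficients are arbitrary and the estimate is uniform over them. Let $q=\lfloor a n^{\varepsilon}\rfloor\geq 1$, where $0<\varepsilon<1$ is a fixed small number and $a>0$ a fixed small constant. $\{1,\dots,n\}$ is divided into $q$ disjoint consecutive intervals $I_1,\dots,I_q$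 of equal length (up to rounding), ordered from smallest to largest, and $\mathbb A_t=\{\vec r\in\mathbb H_n: r_1\in I_t\}$. *)

theory Defs
  imports "HOL-Analysis.Analysis"
begin

definition dyadic_interval :: "real set \<Rightarrow> bool" where
  "dyadic_interval I \<longleftrightarrow>
     (\<exists>(j::int) (k::int). I = {of_int j * 2 powi k ..< (of_int j + 1) * 2 powi k})"

definition left_half :: "real set \<Rightarrow> real set" where
  "left_half I = {x \<in> I. x < (Inf I + Sup I) / 2}"

definition right_half :: "real set \<Rightarrow> real set" where
  "right_half I = {x \<in> I. (Inf I + Sup I) / 2 \<le> x}"

definition haar :: "real set \<Rightarrow> real \<Rightarrow> real" where
  "haar I x = - indicator (left_half I) x + indicator (right_half I) x"

text \<open>Points, vectors of exponents and rectangles have coordinates indexed by \<open>{1..d}\<close>; they are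
  represented by functions on \<open>nat\<close> that are \<open>undefined\<close> off \<open>{1..d}\<close>, so that equality of functions
  is equality of coordinates. A rectangle is given by the family of its sides.\<close>

definition haar_rect :: "nat \<Rightarrow> (nat \<Rightarrow> real set) \<Rightarrow> (nat \<Rightarrow> real) \<Rightarrow> real" where
  "haar_rect d R x = (\<Prod>j=1..d. haar (R j) (x j))"

definition hyperbolic_vectors :: "nat \<Rightarrow> nat \<Rightarrow> (nat \<Rightarrow> nat) set" where
  "hyperbolic_vectors d n = {r \<in> {1..d} \<rightarrow>\<^sub>E UNIV. (\<Sum>j=1..d. r j) = n}"

definition dyadic_rects :: "nat \<Rightarrow> (nat \<Rightarrow> nat) \<Rightarrow> (nat \<Rightarrow> real set) set" where
  "dyadic_rects d r =
     (\<Pi>\<^sub>E j\<in>{1..d}. {I. dyadic_interval I \<and> I \<subseteq> {0..1} \<and> measure lborel I = 1 / 2 ^ r j})"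

text \<open>Unlike \<open>sgn\<close>, this has the value 1 at 0.\<close>

definition sgn_pm :: "real \<Rightarrow> real" where
  "sgn_pm x = (if x < 0 then -1 else 1)"

definition r_function ::
  "nat \<Rightarrow> ((nat \<Rightarrow> real set) \<Rightarrow> real) \<Rightarrow> (nat \<Rightarrow> nat) \<Rightarrow> (nat \<Rightarrow> real) \<Rightarrow> real" where
  "r_function d \<alpha> r x = (\<Sum>R\<in>dyadic_rects d r. sgn_pm (\<alpha> R) * haar_rect d R x)"

definition num_blocks :: "real \<Rightarrow> real \<Rightarrow> nat \<Rightarrow> nat" where
  "num_blocks a \<epsilon> n = nat \<lfloor>a * real n powr \<epsilon>\<rfloor>"

text \<open>The division of \<open>{1..n}\<close> into \<open>q\<close> consecutive intervals is given by its break points \<open>b\<close>;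
  equal length up to rounding means that no two lengths differ by more than 1.\<close>

definition equal_division :: "nat \<Rightarrow> nat \<Rightarrow> (nat \<Rightarrow> nat set) \<Rightarrow> bool" where
  "equal_division n q I \<longleftrightarrow>
     (\<exists>b. b 0 = 0 \<and> b q = n \<and> (\<forall>t\<in>{1..q}. b (t - 1) \<le> b t \<and> I t = {b (t - 1) <.. b t})) \<and>
     (\<forall>s\<in>{1..q}. \<forall>t\<in>{1..q}. card (I s) \<le> card (I t) + 1)"

definition block_vectors :: "nat \<Rightarrow> nat \<Rightarrow> (nat \<Rightarrow> nat set) \<Rightarrow> nat \<Rightarrow> (nat \<Rightarrow> nat) set" where
  "block_vectors d n I t = {r \<in> hyperbolic_vectors d n. r 1 \<in> I t}"

definition coincidence_sum ::
  "nat \<Rightarrow> nat \<Rightarrow> ((nat \<Rightarrow> real set) \<Rightarrow> real) \<Rightarrow> (nat \<Rightarrow> nat set) \<Rightarrow> nat \<Rightarrow> nat \<Rightarrow> nat \<Rightarrow>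
   (nat \<Rightarrow> real) \<Rightarrow> real" where
  "coincidence_sum d n \<alpha> I t\<^sub>1 t\<^sub>2 k x =
     (\<Sum>(r, s) \<in> {(r, s). r \<in> block_vectors d n I t\<^sub>1 \<and> s \<in> block_vectors d n I t\<^sub>2 \<and>
                          r \<noteq> s \<and> r k = s k}.
        r_function d \<alpha> r x * r_function d \<alpha> s x)"

text \<open>The Bochner integral is 0 for a nonintegrable integrand. The norm is applied below only to
  finite linear combinations of indicators of boxes.\<close>

definition Lp_norm_cube :: "nat \<Rightarrow> real \<Rightarrow> ((nat \<Rightarrow> real) \<Rightarrow> real) \<Rightarrow> real" where
  "Lp_norm_cube d p F =
     (LINT x : ({1..d} \<rightarrow>\<^sub>E {0..1}) | Pi\<^sub>M {1..d} (\<lambda>_. lborel). \<bar>F x\<bar> powr p) powr (1 / p)"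

lemma finite_hyperbolic_vectors: "finite (hyperbolic_vectors d n)"
proof (rule finite_subset)
  show "hyperbolic_vectors d n \<subseteq> {1..d} \<rightarrow>\<^sub>E {..n}"
  proof
    fix r assume r: "r \<in> hyperbolic_vectors d n"
    have "r j \<le> n" if "j \<in> {1..d}" for j
      using r member_le_sum[OF that, of r] by (auto simp: hyperbolic_vectors_def)
    then show "r \<in> {1..d} \<rightarrow>\<^sub>E {..n}"
      using r by (auto simp: hyperbolic_vectors_def PiE_def)
  qed
qed (auto intro!: finite_PiE)

lemma finite_dyadic_rects: "finite (dyadic_rects d r)"
  unfolding dyadic_rects_def
proof (rule finite_PiE)
  fix i
  let ?f = "\<lambda>j::int. {of_int j / 2 ^ r i ..< (of_int j + 1) / 2 ^ r i :: real}"
  have "I \<in> ?f ` {0..2 ^ r i}"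
    if I: "dyadic_interval I" "I \<subseteq> {0..1}" "measure lborel I = 1 / 2 ^ r i" for I
  proof -
    obtain j k :: int where jk: "I = {of_int j * 2 powi k ..< (of_int j + 1) * 2 powi k}"
      using I(1) by (auto simp: dyadic_interval_def)
    have pos: "(0::real) < 2 powi k" by simp
    have "measure lborel I = 2 powi k"
      unfolding jk using pos by (simp add: measure_def algebra_simps)
    with I(3) have k: "2 powi k = (1 / 2 ^ r i :: real)" by simp
    have "I = ?f j" by (simp add: jk k)
    moreover have "of_int j * 2 powi k \<in> I" unfolding jk using pos by (simp add: algebra_simps)
    then have "0 \<le> of_int j * (2 powi k :: real)" "of_int j * (2 powi k :: real) \<le> 1"
      using I(2) by auto
    then have "0 \<le> j" "real_of_int j \<le> real_of_int (2 ^ r i)"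
      unfolding k by (simp_all add: zero_le_mult_iff field_simps)
    then have "j \<in> {0..2 ^ r i}" by (simp only: of_int_le_iff) simp
    ultimately show ?thesis by blast
  qed
  then have "{I. dyadic_interval I \<and> I \<subseteq> {0..1} \<and> measure lborel I = 1 / 2 ^ r i} \<subseteq> ?f ` {0..2 ^ r i}"
    by blast
  then show "finite {I. dyadic_interval I \<and> I \<subseteq> {0..1} \<and> measure lborel I = 1 / 2 ^ r i}"
    by (rule finite_subset) simp
qed simp

end

theory Submission
  imports Defs
begin

text \<open>The function \<open>f\<^sub>r\<close> is odd in one binary digit of \<open>x\<^sub>j\<close>, determined by \<open>r\<^sub>j\<close>, and does not depend on
  later digits. Hence, where \<open>r\<^sub>j \<noteq> s\<^sub>j\<close>, the product \<open>f\<^sub>r f\<^sub>s\<close> is a Haar function of level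
  \<open>max r\<^sub>j s\<^sub>j\<close> in \<open>x\<^sub>j\<close>. Coordinates \<open>j \<noteq> k\<close> with \<open>r\<^sub>j = s\<^sub>j\<close> are fixed by the triangle inequality. Let
  \<open>r\<^sub>j > s\<^sub>j\<close> on \<open>A\<close> and \<open>r\<^sub>j < s\<^sub>j\<close> on \<open>B\<close>. The Littlewood-Paley inequality in all coordinates of
  \<open>A \<union> B\<close>, each at the cost of a factor \<open>sqrt p\<close>, leads to the sum over the maximal levels \<open>m\<close> of
  \<open>|\<Sum>\<^sub>c H\<^sub>c\<^sub>,\<^sub>m G\<^sub>c\<^sub>,\<^sub>m|\<^sup>2\<close>, where \<open>c = r\<^sub>k = s\<^sub>k\<close>. Its terms with \<open>c = c'\<close> are estimated by the size of \<open>H\<close>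
  and \<open>G\<close>. For \<open>c \<noteq> c'\<close> choose \<open>i \<in> A\<close>, \<open>j \<in> B\<close>: summing over \<open>m\<^sub>i\<close> and \<open>m\<^sub>j\<close> one would obtain the
  product of a sum of \<open>f\<^sub>r f\<^sub>r\<^sub>'\<close> over \<open>r\<^sub>i = r'\<^sub>i\<close> and a sum of \<open>f\<^sub>s f\<^sub>s\<^sub>'\<close> over \<open>s\<^sub>j = s'\<^sub>j\<close>, which are sums of the
  original kind with fewer free coordinates, were it not for the constraints \<open>r\<^sub>j, r'\<^sub>j < s\<^sub>j\<close> and
  \<open>s\<^sub>i, s'\<^sub>i < r\<^sub>i\<close>. Where a constraint fails, the summand is again a Haar function in that coordinate, so
  that the Littlewood-Paley inequality applies; a chaining argument prevents the loss of a logarithm.\<close>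

section \<open>The Littlewood-Paley inequality\<close>

text \<open>The target is square-root cancellation: when all entries of a vector but one are fixed,
  the condition on its sum fixes the last one, and the square of the norm should be of the order of
  the number of pairs \<open>(r, s)\<close>. All steps are balanced so as not to exceed this number.
  Freezing a coordinate with \<open>r j = s j\<close> costs \<open>M ^ 2\<close> in the square by
  the triangle inequality, but it also takes one free coordinate from each of \<open>r\<close> and
  \<open>s\<close>. The induction must not raise the order of the norm. The off-diagonal part Q is a
  sum of products of a sum over pairs \<open>(r, r')\<close> and one over pairs
  \<open>(s, s')\<close>. By Cauchy-Schwarz, Q^2 in order \<open>2 * \<mu>\<close> is controlled by
  two square functions in order \<open>4 * \<mu>\<close>, and this bounds Q itself in order
  \<open>4 * \<mu>\<close>, as required.\<close>

lemma choose_double_le: "(2 * k choose (2 * j)) \<le> (k choose j) * (2 * k - 1) ^ j"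
proof (induction j)
  case 0
  then show ?case by simp
next
  case (Suc j)
  have step: "Suc i * (m choose Suc i) = (m - i) * (m choose i)" for m i :: nat
    using times_binomial_minus1_eq[of "Suc i" m] binomial_absorb_comp[of m i] by simp
  have s1: "(2 * j + 2) * (2 * k choose (2 * j + 2)) = (2 * k - (2 * j + 1)) * (2 * k choose (2 * j + 1))"
    using step[of "2 * j + 1" "2 * k"] by simp
  have s2: "(2 * j + 1) * (2 * k choose (2 * j + 1)) = (2 * k - 2 * j) * (2 * k choose (2 * j))"
    using step[of "2 * j" "2 * k"] by simp
  \<comment> \<open>The ratio of consecutive binomials on the left is
    \<open>(2 * k - 2 * j - 1) / (2 * j + 1)\<close> times the ratio on the right, and this quotient
    is at most \<open>2 * k - 1\<close>.\<close>
  have "(2 * j + 2) * ((2 * j + 1) * (2 * k choose (2 * j + 2)))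
      = (2 * j + 1) * ((2 * k - (2 * j + 1)) * (2 * k choose (2 * j + 1)))"
    using s1 by (metis mult.left_commute)
  also have "\<dots> = (2 * k - (2 * j + 1)) * ((2 * k - 2 * j) * (2 * k choose (2 * j)))"
    using s2 by (metis mult.left_commute)
  also have "\<dots> \<le> (2 * k - 1) * ((2 * k - 2 * j) * ((k choose j) * (2 * k - 1) ^ j))"
    using Suc.IH by (intro mult_mono) auto
  also have "\<dots> = 2 * (2 * k - 1) ^ Suc j * ((k - j) * (k choose j))"
    by (simp add: algebra_simps diff_mult_distrib2)
  also have "\<dots> = 2 * (2 * k - 1) ^ Suc j * (Suc j * (k choose Suc j))"
    using step[of j k] by simp
  finally have "(2 * j + 2) * ((2 * j + 1) * (2 * k choose (2 * j + 2)))
      \<le> (2 * j + 2) * ((k choose Suc j) * (2 * k - 1) ^ Suc j)"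
    by (simp add: algebra_simps)
  then have "(2 * j + 1) * (2 * k choose (2 * j + 2)) \<le> (k choose Suc j) * (2 * k - 1) ^ Suc j"
    by (simp only: mult_le_cancel1)
  moreover have "(2 * k choose (2 * j + 2)) \<le> (2 * j + 1) * (2 * k choose (2 * j + 2))" by simp
  ultimately have "(2 * k choose (2 * j + 2)) \<le> (k choose Suc j) * (2 * k - 1) ^ Suc j"
    by linarith
  then show ?case by simp
qed

text \<open>The two-point hypercontractive inequality for the even exponent \<open>2 * k\<close>.
  Averaging over the sign of \<open>z\<close> cancels the odd powers; the even ones are compared
  coefficient by coefficient by \<open>choose_double_le\<close>.\<close>

lemma two_point_inequality:
  fixes A z :: real
  assumes "1 \<le> k"
  shows "((A + z) ^ (2 * k) + (A - z) ^ (2 * k)) / 2 \<le> (A\<^sup>2 + real (2 * k - 1) * z\<^sup>2) ^ k"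
proof -
  let ?t = "\<lambda>i. real (2 * k choose i) * A ^ (2 * k - i) * ((z ^ i + (- z) ^ i) / 2)"
  have "((A + z) ^ (2 * k) + (A - z) ^ (2 * k)) / 2 = (\<Sum>i\<le>2 * k. ?t i)"
    using binomial_ring[of z A "2 * k"] binomial_ring[of "- z" A "2 * k"]
    by (simp add: sum.distrib sum_divide_distrib algebra_simps add_divide_distrib)
  also have "\<dots> = (\<Sum>i\<in>(\<lambda>j. 2 * j) ` {..k}. ?t i)"
  proof (rule sum.mono_neutral_right)
    show "\<forall>i\<in>{..2 * k} - (\<lambda>j. 2 * j) ` {..k}. ?t i = 0"
    proof
      fix i assume i: "i \<in> {..2 * k} - (\<lambda>j. 2 * j) ` {..k}"
      have "odd i"
      proof (rule ccontr)
        assume "\<not> odd i"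
        then obtain j where "i = 2 * j" by (auto elim: evenE)
        with i show False by auto
      qed
      then show "?t i = 0" by simp
    qed
  qed auto
  also have "\<dots> = (\<Sum>j\<le>k. ?t (2 * j))"
    by (subst sum.reindex) (auto simp: inj_on_def mult.assoc)
  also have "\<dots> \<le> (\<Sum>j\<le>k. real (k choose j) * (real (2 * k - 1) * z\<^sup>2) ^ j * (A\<^sup>2) ^ (k - j))"
  proof (rule sum_mono)
    fix j assume "j \<in> {..k}"
    have e: "A ^ (2 * k - 2 * j) = (A\<^sup>2) ^ (k - j)"
      by (simp add: power_mult[symmetric] diff_mult_distrib2)
    have "?t (2 * j) = real (2 * k choose (2 * j)) * ((A\<^sup>2) ^ (k - j) * (z\<^sup>2) ^ j)"
      by (simp add: e power_mult)
    also have "\<dots> \<le> real ((k choose j) * (2 * k - 1) ^ j) * ((A\<^sup>2) ^ (k - j) * (z\<^sup>2) ^ j)"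
      using choose_double_le[of k j] by (intro mult_right_mono) (auto simp del: of_nat_mult)
    finally show "?t (2 * j) \<le> real (k choose j) * (real (2 * k - 1) * z\<^sup>2) ^ j * (A\<^sup>2) ^ (k - j)"
      by (simp add: power_mult_distrib algebra_simps)
  qed
  also have "\<dots> = (A\<^sup>2 + real (2 * k - 1) * z\<^sup>2) ^ k"
    using binomial_ring[of "real (2 * k - 1) * z\<^sup>2" "A\<^sup>2" k] by (simp add: add.commute)
  finally show ?thesis .
qed

lemma power_diff_le:
  fixes a b :: real
  assumes "0 \<le> b" "b \<le> a"
  shows "a ^ Suc m - b ^ Suc m \<le> real (Suc m) * (a - b) * a ^ m"
proof (induction m)
  case (Suc m)
  have "a ^ Suc (Suc m) - b ^ Suc (Suc m) = a * (a ^ Suc m - b ^ Suc m) + (a - b) * b ^ Suc m"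
    by (simp add: algebra_simps)
  also have "\<dots> \<le> a * (real (Suc m) * (a - b) * a ^ m) + (a - b) * a ^ Suc m"
    using assms Suc by (intro add_mono mult_left_mono power_mono) auto
  finally show ?case by (simp add: algebra_simps)
qed simp

lemma power_diff_ge:
  fixes a b :: real
  assumes "0 \<le> b" "b \<le> a"
  shows "(a - b) * a ^ m \<le> a ^ Suc m - b ^ Suc m"
proof -
  have "b * b ^ m \<le> b * a ^ m" using assms by (intro mult_left_mono power_mono) auto
  then show ?thesis by (simp add: algebra_simps)
qed

text \<open>The Bellman function is \<open>(X - c T)\<^sup>h - B T\<^sup>h\<close> with \<open>h = 2 k\<close>: here \<open>X\<close> is the squared norm of
  the martingale, \<open>T\<close> its squared square function, \<open>D\<close> the squared norm of the new increment and
  \<open>z\<close> twice its inner product with the martingale. That \<open>c\<close> is linear in \<open>h\<close> yields the factor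
  \<open>sqrt p\<close> in the Littlewood-Paley inequality.\<close>

lemma bellman_step:
  fixes X T D z c :: real
  assumes k: "1 \<le> k" and nn: "0 \<le> X" "0 \<le> T" "0 \<le> D" and z: "z\<^sup>2 \<le> 4 * X * D"
    and c: "c = 8 * real k - 3"
  shows "((X + D + z - c * (T + D)) ^ (2 * k) + (X + D - z - c * (T + D)) ^ (2 * k)) / 2
    \<le> (X - c * T) ^ (2 * k) + real k * (2 * c\<^sup>2) ^ k * ((T + D) ^ (2 * k) - T ^ (2 * k))"
proof -
  define W where "W = X - c * T"
  define A where "A = W - (c - 1) * D"
  define V where "V = A\<^sup>2 + real (2 * k - 1) * z\<^sup>2"
  have c1: "c \<ge> 1" using c k by simp
  \<comment> \<open>The value of \<open>c\<close> is chosen for this equality. By it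
    \<open>(2 * k - 1) * z^2\<close> contributes at most \<open>(c - 1) * D * (W + c * T)\<close>,
    in which the multiple of \<open>W\<close> is only half of that in the term
    \<open>- 2 * (c - 1) * D * W\<close> of \<open>A^2\<close>; so a negative multiple of
    \<open>W\<close> survives in \<open>V1\<close>.\<close>
  have ck: "4 * real (2 * k - 1) = c - 1" using c k by (simp add: of_nat_diff)
  have V0: "0 \<le> V" by (simp add: V_def)
  have mono: "T ^ (2 * k) \<le> (T + D) ^ (2 * k)" using nn by (intro power_mono) auto
  have "real (2 * k - 1) * z\<^sup>2 \<le> real (2 * k - 1) * (4 * X * D)"
    using z by (intro mult_left_mono) auto
  also have "\<dots> = (4 * real (2 * k - 1)) * (X * D)" by simp
  also have "\<dots> = (c - 1) * ((W + c * T) * D)" by (simp only: ck) (simp add: W_def)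
  finally have V1: "V \<le> W\<^sup>2 + (c - 1) * D * ((c - 1) * D + c * T - W)"
    unfolding V_def A_def by (simp add: power2_eq_square algebra_simps)
  have "X + D + z - c * (T + D) = A + z" "X + D - z - c * (T + D) = A - z"
    by (simp_all add: A_def W_def algebra_simps)
  then have "((X + D + z - c * (T + D)) ^ (2 * k) + (X + D - z - c * (T + D)) ^ (2 * k)) / 2 \<le> V ^ k"
    using two_point_inequality[OF k, of A z] by (simp only: V_def)
  also have "V ^ k \<le> W ^ (2 * k) + real k * (2 * c\<^sup>2) ^ k * ((T + D) ^ (2 * k) - T ^ (2 * k))"
  \<comment> \<open>A large \<open>W\<close> is pulled down by the negative drift in
    \<open>V1\<close>. Otherwise \<open>\<bar>W\<bar>\<close> is at most \<open>c * (T + D)\<close>,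
    from below because \<open>X\<close> is nonnegative, and the growth is charged to the increment
    of \<open>T ^ (2 * k)\<close> by a mean value estimate in the squares.\<close>
  proof (cases "(c - 1) * D + c * T \<le> W")
    case True
    have "(c - 1) * D * ((c - 1) * D + c * T - W) \<le> 0"
      using True c1 nn by (intro mult_nonneg_nonpos) auto
    with V1 have "V \<le> W\<^sup>2" by simp
    with V0 have "V ^ k \<le> (W\<^sup>2) ^ k" by (intro power_mono)
    moreover have "0 \<le> real k * (2 * c\<^sup>2) ^ k * ((T + D) ^ (2 * k) - T ^ (2 * k))"
      using mono by simp
    ultimately show ?thesis by (simp add: power_mult)
  next
    case False
    let ?a = "(T + D)\<^sup>2" and ?b = "T\<^sup>2"
    obtain m where m: "k = Suc m" using k by (cases k) auto
    have ab: "0 \<le> ?b" "?b \<le> ?a" using nn by (auto intro: power_mono)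
    have WT: "- W \<le> c * T" using nn by (simp add: W_def)
    have "c * T + (c - 1) * D \<le> c * (T + D)" using nn by (simp add: algebra_simps)
    then have "\<bar>W\<bar> \<le> \<bar>c * (T + D)\<bar>"
      using False WT nn c1 by (smt (verit) mult_nonneg_nonneg mult_left_mono)
    then have W2: "W\<^sup>2 \<le> c\<^sup>2 * ?a"
      by (metis abs_le_square_iff power_mult_distrib)
    have "(c - 1) * D * ((c - 1) * D + c * T - W) \<le> c * D * (c * D + c * T + c * T)"
    proof (intro mult_mono add_mono)
      show "(c - 1) * D + c * T - W \<le> c * D + c * T + c * T" using WT nn by (simp add: algebra_simps)
      show "0 \<le> (c - 1) * D + c * T - W" using False by simp
    qed (use c1 nn in auto)
    also have "\<dots> = c\<^sup>2 * (?a - ?b)" by (simp add: power2_eq_square algebra_simps)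
    finally have V2: "V \<le> W\<^sup>2 + c\<^sup>2 * (?a - ?b)" using V1 by simp
    let ?V = "W\<^sup>2 + c\<^sup>2 * (?a - ?b)"
    have V3: "?V \<le> 2 * c\<^sup>2 * ?a" using W2 by (simp add: algebra_simps add_increasing)
    have V4: "W\<^sup>2 \<le> ?V" using ab by simp
    have "V ^ k - (W\<^sup>2) ^ k \<le> ?V ^ Suc m - (W\<^sup>2) ^ Suc m"
      using V0 V2 m by (simp add: power_mono del: power_Suc)
    also have "\<dots> \<le> real (Suc m) * (?V - W\<^sup>2) * ?V ^ m"
      using V4 by (intro power_diff_le) auto
    also have "\<dots> \<le> real (Suc m) * (c\<^sup>2 * (?a - ?b)) * (2 * c\<^sup>2 * ?a) ^ m"
      using V3 V4 ab by (intro mult_mono power_mono) auto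
    also have "\<dots> = real (Suc m) * (c\<^sup>2 * (2 * c\<^sup>2) ^ m) * ((?a - ?b) * ?a ^ m)"
      by (simp add: power_mult_distrib)
    also have "\<dots> \<le> real (Suc m) * (2 * c\<^sup>2) ^ Suc m * (?a ^ Suc m - ?b ^ Suc m)"
      using power_diff_ge[OF ab, of m] ab by (intro mult_mono) auto
    finally show ?thesis unfolding m power_mult by linarith
  qed
  finally show ?thesis by (simp add: W_def)
qed

lemma convex_on_power: "convex_on {0::real..} (\<lambda>x. x ^ q)"
  by (cases "even q") (auto intro: convex_on_subset[OF convex_power_even] convex_power_odd)

text \<open>In the application a point is given by the binary digits of its coordinates, and \<open>flip l a\<close>
  changes the digit of the \<open>l\<close>-th coordinate on which the sign of a Haar function of level \<open>a\<close> depends.\<close>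

locale flip_space =
  fixes Om :: "'w set" and flip :: "nat \<Rightarrow> nat \<Rightarrow> 'w \<Rightarrow> 'w"
  assumes finite_Om: "finite Om" and Om_ne: "Om \<noteq> {}"
    and flip_bij: "\<And>l a. bij_betw (flip l a) Om Om"
begin

section \<open>Normalised moments on a finite space\<close>

definition ex :: "('w \<Rightarrow> real) \<Rightarrow> real" where
  "ex f = (\<Sum>p\<in>Om. f p) / card Om"

definition haar_at :: "nat \<Rightarrow> nat \<Rightarrow> ('w \<Rightarrow> real) \<Rightarrow> bool" where
  "haar_at l a f \<longleftrightarrow>
     (\<forall>p\<in>Om. f (flip l a p) = - f p \<and> (\<forall>b>a. f (flip l b p) = f p))"

definition flat_at :: "nat \<Rightarrow> nat \<Rightarrow> ('w \<Rightarrow> real) \<Rightarrow> bool" where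
  "flat_at l a f \<longleftrightarrow> (\<forall>p\<in>Om. \<forall>b\<ge>a. f (flip l b p) = f p)"

text \<open>The L^q norm of \<open>f\<close> for the normalised counting measure is at most
  \<open>a\<close>, stated without a root. For even \<open>q\<close> the inequality alone would not
  exclude a negative \<open>a\<close>.\<close>

definition bd :: "nat \<Rightarrow> ('w \<Rightarrow> real) \<Rightarrow> real \<Rightarrow> bool" where
  "bd q f a \<longleftrightarrow> 0 \<le> a \<and> ex (\<lambda>p. \<bar>f p\<bar> ^ q) \<le> a ^ q"

lemma card_Om: "0 < card Om"
  using finite_Om Om_ne by (simp add: card_gt_0_iff)

lemma ex_mono: "(\<And>p. p \<in> Om \<Longrightarrow> f p \<le> g p) \<Longrightarrow> ex f \<le> ex g"
  unfolding ex_def by (intro divide_right_mono sum_mono) auto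

lemma ex_add: "ex (\<lambda>p. f p + g p) = ex f + ex g"
  by (simp add: ex_def sum.distrib add_divide_distrib)

lemma ex_cmult: "ex (\<lambda>p. c * f p) = c * ex f"
  by (simp add: ex_def sum_distrib_left)

lemma ex_const: "ex (\<lambda>_. c) = c"
  using card_Om by (simp add: ex_def)

lemma ex_sum: "ex (\<lambda>p. \<Sum>i\<in>I. f i p) = (\<Sum>i\<in>I. ex (f i))"
  unfolding ex_def by (subst sum.swap) (simp add: sum_divide_distrib)

lemma ex_nonneg: "(\<And>p. p \<in> Om \<Longrightarrow> 0 \<le> f p) \<Longrightarrow> 0 \<le> ex f"
  using ex_mono[of "\<lambda>_. 0" f] by (simp add: ex_const)

lemma ex_flip: "ex (\<lambda>p. f (flip l a p)) = ex f"
  unfolding ex_def using sum.reindex_bij_betw[OF flip_bij] by metis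

lemma bd_weaken: "bd q f a \<Longrightarrow> a \<le> b \<Longrightarrow> bd q f b"
  unfolding bd_def by (meson order_trans power_mono)

lemma bd_mono: "bd q g a \<Longrightarrow> (\<And>p. p \<in> Om \<Longrightarrow> \<bar>f p\<bar> \<le> \<bar>g p\<bar>) \<Longrightarrow> bd q f a"
  unfolding bd_def
  using ex_mono[of "\<lambda>p. \<bar>f p\<bar> ^ q" "\<lambda>p. \<bar>g p\<bar> ^ q"]
  by (smt (verit) abs_ge_zero power_mono)

lemma bd_cong: "(\<And>p. p \<in> Om \<Longrightarrow> f p = g p) \<Longrightarrow> bd q f a \<longleftrightarrow> bd q g a"
  using bd_mono[of q f a g] bd_mono[of q g a f] by auto

lemma bd_const: "0 \<le> a \<Longrightarrow> (\<And>p. p \<in> Om \<Longrightarrow> \<bar>f p\<bar> \<le> a) \<Longrightarrow> bd q f a"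
  unfolding bd_def using ex_mono[of "\<lambda>p. \<bar>f p\<bar> ^ q" "\<lambda>_. a ^ q"]
  by (simp add: ex_const power_mono)

lemma bd_sq: "0 \<le> a \<Longrightarrow> bd q (\<lambda>p. (f p)\<^sup>2) (a\<^sup>2) \<longleftrightarrow> bd (2 * q) f a"
  by (simp add: bd_def power_mult)

lemma bd_cmult: "bd q f a \<Longrightarrow> bd q (\<lambda>p. c * f p) (\<bar>c\<bar> * a)"
  by (auto simp: bd_def abs_mult power_mult_distrib ex_cmult intro: mult_left_mono)

lemma bd_zero_const:
  assumes "1 \<le> q" "bd q f 0" "p \<in> Om" shows "f p = 0"
proof -
  have "(\<Sum>p\<in>Om. \<bar>f p\<bar> ^ q) \<le> 0"
    using assms(1,2) card_Om by (simp add: bd_def ex_def power_0_left divide_le_0_iff)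
  then have "\<bar>f p\<bar> ^ q = 0"
    using assms(3) finite_Om by (metis (mono_tags, lifting) order_antisym sum_nonneg
        sum_nonneg_eq_0_iff zero_le_power abs_ge_zero)
  then show ?thesis by simp
qed

lemma bd_add:
  assumes q: "1 \<le> q" and f: "bd q f a" and g: "bd q g b"
  shows "bd q (\<lambda>p. f p + g p) (a + b)"
proof -
  have ab: "0 \<le> a" "0 \<le> b" using f g by (auto simp: bd_def)
  consider "a = 0" | "b = 0" | "0 < a" "0 < b" using ab by linarith
  then show ?thesis
  proof cases
    case 1
    then show ?thesis using bd_zero_const[OF q, of f] f g bd_cong[of g "\<lambda>p. f p + g p" q b] by simp
  next
    case 2
    then show ?thesis using bd_zero_const[OF q, of g] f g bd_cong[of f "\<lambda>p. f p + g p" q a] by simp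
  next
    case 3
    let ?s = "a / (a + b)" and ?t = "b / (a + b)"
    have st: "0 \<le> ?s" "0 \<le> ?t" "?s + ?t = 1" using 3 by (auto simp: add_divide_distrib[symmetric])
    have pw: "\<bar>f p + g p\<bar> ^ q \<le> (a + b) ^ q * (?s * (\<bar>f p\<bar> ^ q / a ^ q) + ?t * (\<bar>g p\<bar> ^ q / b ^ q))" for p
    proof -
      let ?m = "?s * (\<bar>f p\<bar> / a) + ?t * (\<bar>g p\<bar> / b)"
      have "\<bar>f p + g p\<bar> \<le> (a + b) * ?m"
        using 3 by (simp add: distrib_left)
      then have "\<bar>f p + g p\<bar> ^ q \<le> ((a + b) * ?m) ^ q"
        by (intro power_mono) auto
      also have "\<dots> = (a + b) ^ q * ?m ^ q"
        by (simp add: power_mult_distrib)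
      also have "?m ^ q
          \<le> ?s * (\<bar>f p\<bar> / a) ^ q + ?t * (\<bar>g p\<bar> / b) ^ q"
        using convex_onD[OF convex_on_power[of q], of ?t "\<bar>f p\<bar> / a" "\<bar>g p\<bar> / b"] st 3
        by (auto simp: field_simps)
      finally show ?thesis using 3 by (simp add: power_divide mult_left_mono)
    qed
    have "ex (\<lambda>p. \<bar>f p + g p\<bar> ^ q)
        \<le> ex (\<lambda>p. (a + b) ^ q * (?s / a ^ q * \<bar>f p\<bar> ^ q + ?t / b ^ q * \<bar>g p\<bar> ^ q))"
      using pw by (intro ex_mono) (simp add: mult.assoc)
    also have "\<dots> = (a + b) ^ q * (?s / a ^ q * ex (\<lambda>p. \<bar>f p\<bar> ^ q) + ?t / b ^ q * ex (\<lambda>p. \<bar>g p\<bar> ^ q))"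
      by (simp only: ex_cmult ex_add)
    also have "\<dots> \<le> (a + b) ^ q * (?s / a ^ q * a ^ q + ?t / b ^ q * b ^ q)"
      using f g 3 by (intro mult_left_mono add_mono) (auto simp: bd_def)
    also have "\<dots> = (a + b) ^ q" using 3 st(3) by simp
    finally show ?thesis using ab by (simp add: bd_def)
  qed
qed

lemma bd_zero: "bd q (\<lambda>_. 0) 0"
  by (simp add: bd_def ex_const power_0_left)

lemma bd_sum:
  assumes "1 \<le> q" "finite I" "\<And>i. i \<in> I \<Longrightarrow> bd q (f i) (a i)"
  shows "bd q (\<lambda>p. \<Sum>i\<in>I. f i p) (\<Sum>i\<in>I. a i)"
  using assms(2,3) by (induction I rule: finite_induct) (auto intro: bd_zero bd_add[OF assms(1)])

lemma bd_sum_const: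
  assumes "1 \<le> q" "finite I" "\<And>i. i \<in> I \<Longrightarrow> bd q (f i) a"
  shows "bd q (\<lambda>p. \<Sum>i\<in>I. f i p) (real (card I) * a)"
  using bd_sum[OF assms(1,2), of f "\<lambda>_. a"] assms(3) by simp

lemma bd_mult:
  assumes f: "bd (2 * q) f a" and g: "bd (2 * q) g b"
  shows "bd q (\<lambda>p. f p * g p) (a * b)"
proof -
  have ab: "0 \<le> a" "0 \<le> b" using f g by (auto simp: bd_def)
  let ?F = "\<lambda>p. \<bar>f p\<bar> ^ q" and ?G = "\<lambda>p. \<bar>g p\<bar> ^ q"
  have sq: "(?F p)\<^sup>2 = \<bar>f p\<bar> ^ (2 * q)" "(?G p)\<^sup>2 = \<bar>g p\<bar> ^ (2 * q)" for p
    by (simp_all add: power_mult[symmetric] mult.commute)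
  have "(ex (\<lambda>p. ?F p * ?G p))\<^sup>2 \<le> ex (\<lambda>p. (?F p)\<^sup>2) * ex (\<lambda>p. (?G p)\<^sup>2)"
    unfolding ex_def power_divide times_divide_times_eq power2_eq_square[of "real (card Om)"]
    by (intro divide_right_mono Cauchy_Schwarz_ineq_sum) auto
  also have "\<dots> \<le> a ^ (2 * q) * b ^ (2 * q)"
    unfolding sq using f g by (intro mult_mono) (auto simp: bd_def intro!: ex_nonneg)
  also have "\<dots> = ((a * b) ^ q)\<^sup>2" by (simp add: power_mult_distrib power_mult[symmetric] mult.commute)
  finally have "ex (\<lambda>p. ?F p * ?G p) \<le> (a * b) ^ q"
    by (rule power2_le_imp_le) (simp add: ab)
  then show ?thesis using ab by (simp add: bd_def abs_mult power_mult_distrib)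
qed

text \<open>A maximum is dominated by the l^q sum, so that \<open>N\<close> functions cost
  \<open>N ^ (1 / q)\<close>, of which \<open>t\<close> is an upper bound. Chaining relies on this
  loss being small for large \<open>q\<close>. The inserted 0 covers an empty
  \<open>Y\<close>.\<close>

lemma bd_Max:
  assumes q: "1 \<le> q" and Y: "finite Y" and g: "\<And>y. y \<in> Y \<Longrightarrow> bd q (g y) a"
    and a: "0 \<le> a" "0 \<le> t" and N: "real (card Y) \<le> t ^ q"
  shows "bd q (\<lambda>p. Max (insert 0 ((\<lambda>y. \<bar>g y p\<bar>) ` Y))) (t * a)"
proof -
  let ?T = "\<lambda>p. Max (insert 0 ((\<lambda>y. \<bar>g y p\<bar>) ` Y))"
  have "\<bar>?T p\<bar> ^ q \<le> (\<Sum>y\<in>Y. \<bar>g y p\<bar> ^ q)" for p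
  proof -
    have "?T p \<in> insert 0 ((\<lambda>y. \<bar>g y p\<bar>) ` Y)"
      using Y by (intro Max_in) auto
    then consider "?T p = 0"
      | y where "y \<in> Y" "?T p = \<bar>g y p\<bar>" by blast
    then show ?thesis
    proof cases
      case 1 with q show ?thesis by (simp add: power_0_left sum_nonneg)
    next
      case 2 then show ?thesis using Y by (auto intro: member_le_sum)
    qed
  qed
  then have "ex (\<lambda>p. \<bar>?T p\<bar> ^ q) \<le> ex (\<lambda>p. \<Sum>y\<in>Y. \<bar>g y p\<bar> ^ q)"
    by (intro ex_mono)
  also have "\<dots> \<le> (\<Sum>y\<in>Y. a ^ q)"
    unfolding ex_sum using g by (intro sum_mono) (auto simp: bd_def)
  also have "\<dots> \<le> t ^ q * a ^ q" using N a by (simp add: mult_right_mono)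
  finally show ?thesis using a by (simp add: bd_def power_mult_distrib)
qed

section \<open>Products and sums of Haar functions in one coordinate\<close>

lemma haar_at_mult_flat:
  "haar_at l a f \<Longrightarrow> flat_at l a g \<Longrightarrow> haar_at l a (\<lambda>p. f p * g p)"
  by (auto simp: haar_at_def flat_at_def)

lemma flat_at_mult_haar:
  "flat_at l a f \<Longrightarrow> haar_at l a g \<Longrightarrow> haar_at l a (\<lambda>p. f p * g p)"
  by (auto simp: haar_at_def flat_at_def)

lemma haar_at_imp_flat: "haar_at l a f \<Longrightarrow> a < b \<Longrightarrow> flat_at l b f"
  by (auto simp: haar_at_def flat_at_def)

lemma haar_at_mult_haar: "haar_at l a f \<Longrightarrow> haar_at l a g \<Longrightarrow> flat_at l a (\<lambda>p. f p * g p)"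
  unfolding haar_at_def flat_at_def
  by (metis le_neq_implies_less minus_mult_minus)

lemma haar_at_mult_max:
  assumes "haar_at l a f" "haar_at l b g" "a \<noteq> b"
  shows "haar_at l (max a b) (\<lambda>p. f p * g p)"
proof (cases "a < b")
  case True
  then show ?thesis
    using flat_at_mult_haar[OF haar_at_imp_flat[OF assms(1) True] assms(2)] by (simp add: max_def)
next
  case False
  then have "b < a" using assms(3) by simp
  then show ?thesis
    using haar_at_mult_flat[OF assms(1) haar_at_imp_flat[OF assms(2)]] by (simp add: max_def)
qed

lemma flat_at_le: "flat_at l a f \<Longrightarrow> a \<le> b \<Longrightarrow> flat_at l b f"
  by (auto simp: flat_at_def)

lemma haar_at_sum: "(\<And>i. i \<in> I \<Longrightarrow> haar_at l a (f i)) \<Longrightarrow> haar_at l a (\<lambda>p. \<Sum>i\<in>I. f i p)"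
  by (auto simp: haar_at_def sum_negf[symmetric] intro!: sum.cong)

lemma flat_at_sum: "(\<And>i. i \<in> I \<Longrightarrow> flat_at l a (f i)) \<Longrightarrow> flat_at l a (\<lambda>p. \<Sum>i\<in>I. f i p)"
  by (auto simp: flat_at_def intro!: sum.cong)

text \<open>Induction on the number of levels. The flip at level \<open>M\<close> changes the sign
  of the increments \<open>Z y M\<close> and fixes the earlier ones, so it turns \<open>z\<close>
  into \<open>- z\<close>. As \<open>ex\<close> is invariant under the flip, the value after the
  step is the average over both signs, which \<open>bellman_step\<close> bounds by the value before
  it.\<close>

lemma bellman_ex:
  assumes k: "1 \<le> k" and Y: "finite Y"
    and Z: "\<And>y a. y \<in> Y \<Longrightarrow> a < M \<Longrightarrow> haar_at l a (Z y a)"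
    and c: "c = 8 * real k - 3"
  shows "ex (\<lambda>p. ((\<Sum>y\<in>Y. (\<Sum>a<M. Z y a p)\<^sup>2) - c * (\<Sum>y\<in>Y. \<Sum>a<M. (Z y a p)\<^sup>2)) ^ (2 * k)
    - real k * (2 * c\<^sup>2) ^ k * (\<Sum>y\<in>Y. \<Sum>a<M. (Z y a p)\<^sup>2) ^ (2 * k)) \<le> 0"
  using Z
proof (induction M)
  case 0
  then show ?case using k by (simp add: ex_const power_0_left)
next
  case (Suc M)
  define x where "x y p = (\<Sum>a<M. Z y a p)" for y p
  define T where "T p = (\<Sum>y\<in>Y. \<Sum>a<M. (Z y a p)\<^sup>2)" for p
  define X where "X p = (\<Sum>y\<in>Y. (x y p)\<^sup>2)" for p
  define D where "D p = (\<Sum>y\<in>Y. (Z y M p)\<^sup>2)" for p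
  define z where "z p = 2 * (\<Sum>y\<in>Y. x y p * Z y M p)" for p
  define B where "B = real k * (2 * c\<^sup>2) ^ k"
  let ?G = "\<lambda>p. (X p + D p + z p - c * (T p + D p)) ^ (2 * k) - B * (T p + D p) ^ (2 * k)"
  let ?G' = "\<lambda>p. (X p + D p - z p - c * (T p + D p)) ^ (2 * k) - B * (T p + D p) ^ (2 * k)"
  have average: "1 / 2 * ((p - s) + (r - s)) \<le> w - t" if "(p + r) / 2 \<le> w + (s - t)" for p r s t w :: real
    using that by simp
  have Zf: "Z y a (flip l M p) = Z y a p" if "y \<in> Y" "a < M" "p \<in> Om" for y a p
    using Suc.prems[of y a] that by (auto simp: haar_at_def)
  have ZM: "Z y M (flip l M p) = - Z y M p" if "y \<in> Y" "p \<in> Om" for y p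
    using Suc.prems[of y M] that by (auto simp: haar_at_def)
  have xf: "x y (flip l M p) = x y p" if "y \<in> Y" "p \<in> Om" for y p
    using Zf that by (simp add: x_def)
  have fl: "?G (flip l M p) = ?G' p" if "p \<in> Om" for p
    using that by (simp add: X_def D_def T_def z_def xf ZM Zf sum_negf)
  have "ex ?G = ex ?G / 2 + ex (\<lambda>p. ?G (flip l M p)) / 2"
    by (subst ex_flip[of ?G l M]) simp
  also have "ex (\<lambda>p. ?G (flip l M p)) = ex ?G'"
    unfolding ex_def by (intro arg_cong2[where f="(/)"] sum.cong refl fl)
  also have "ex ?G / 2 + ex ?G' / 2 = ex (\<lambda>p. (1/2) * (?G p + ?G' p))"
    by (simp only: ex_cmult ex_add) simp
  also have "\<dots> \<le> ex (\<lambda>p. (X p - c * T p) ^ (2 * k) - B * T p ^ (2 * k))"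
  proof (rule ex_mono)
    fix p assume "p \<in> Om"
    have nn: "0 \<le> X p" "0 \<le> T p" "0 \<le> D p"
      by (auto simp: X_def T_def D_def intro!: sum_nonneg)
    have "(z p)\<^sup>2 \<le> 4 * X p * D p"
      using Cauchy_Schwarz_ineq_sum[of "\<lambda>y. x y p" "\<lambda>y. Z y M p" Y]
      by (simp add: z_def X_def D_def power_mult_distrib)
    from bellman_step[OF k nn this c, folded B_def]
    show "(1/2) * (?G p + ?G' p) \<le> (X p - c * T p) ^ (2 * k) - B * T p ^ (2 * k)"
      using average by (simp only: right_diff_distrib)
  qed
  also have "\<dots> \<le> 0" using Suc.IH Suc.prems by (simp add: X_def T_def x_def B_def)
  finally have "ex ?G \<le> 0" .
  moreover have "(\<Sum>y\<in>Y. (\<Sum>a<Suc M. Z y a p)\<^sup>2) = X p + D p + z p" for p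
  proof -
    have "(\<Sum>a<Suc M. Z y a p) = x y p + Z y M p" for y by (simp add: x_def)
    then show ?thesis
      by (simp add: X_def D_def z_def power2_sum sum.distrib sum_distrib_left mult.assoc)
  qed
  moreover have "(\<Sum>y\<in>Y. \<Sum>a<Suc M. (Z y a p)\<^sup>2) = T p + D p" for p
    by (simp add: T_def D_def sum.distrib)
  ultimately show ?case by (simp add: B_def)
qed

text \<open>The family \<open>Y\<close> makes the inequality l^2-valued, which permits iterating it
  over coordinates. Both sides are squares: in L^p with \<open>p = 4 * k\<close> the constant
  \<open>64 * k\<close> is the square of \<open>4 * sqrt p\<close>. By \<open>bellman_ex\<close> the
  norm of \<open>X - c * T\<close> is controlled by that of \<open>T\<close>, and \<open>X\<close>
  differs from it by \<open>c * T\<close>.\<close>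

lemma littlewood_paley:
  assumes k: "1 \<le> k" and Y: "finite Y"
    and Z: "\<And>y a. y \<in> Y \<Longrightarrow> a < M \<Longrightarrow> haar_at l a (Z y a)"
    and T: "bd (2 * k) (\<lambda>p. \<Sum>y\<in>Y. \<Sum>a<M. (Z y a p)\<^sup>2) t"
  shows "bd (2 * k) (\<lambda>p. \<Sum>y\<in>Y. (\<Sum>a<M. Z y a p)\<^sup>2) (64 * real k * t)"
proof -
  define c where "c = 8 * real k - 3"
  define T where "T p = (\<Sum>y\<in>Y. \<Sum>a<M. (Z y a p)\<^sup>2)" for p
  define X where "X p = (\<Sum>y\<in>Y. (\<Sum>a<M. Z y a p)\<^sup>2)" for p
  define B where "B = real k * (2 * c\<^sup>2) ^ k"
  have nn: "0 \<le> X p" "0 \<le> T p" for p by (auto simp: X_def T_def intro!: sum_nonneg)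
  have t0: "0 \<le> t" and tT: "ex (\<lambda>p. T p ^ (2 * k)) \<le> t ^ (2 * k)"
    using T nn(2) by (simp_all add: bd_def T_def sum_nonneg)
  have c1: "c \<ge> 1" using k by (simp add: c_def)
  have kB: "real k \<le> 2 ^ k" using less_exp[of k] by (simp add: of_nat_less_numeral_power_cancel_iff less_imp_le)
  \<comment> \<open>The factor \<open>k\<close> of \<open>B\<close> is absorbed by
    \<open>2 ^ k\<close>, so that the root of order \<open>2 * k\<close> of \<open>B\<close> is
    still linear in \<open>c\<close>.\<close>
  have Bc: "B \<le> (2 * c) ^ (2 * k)"
  proof -
    have "B \<le> 2 ^ k * (2 * c\<^sup>2) ^ k" unfolding B_def using kB by (intro mult_right_mono) auto
    also have "\<dots> = (2 * (2 * c\<^sup>2)) ^ k" by (rule power_mult_distrib[symmetric])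
    also have "\<dots> = (2 * c) ^ (2 * k)" by (simp add: power_mult power2_eq_square mult.left_commute)
    finally show ?thesis .
  qed
  have main: "ex (\<lambda>p. (X p - c * T p) ^ (2 * k)) \<le> B * ex (\<lambda>p. T p ^ (2 * k))"
    using bellman_ex[OF k Y Z c_def]
    by (simp add: X_def T_def B_def ex_def sum_subtractf sum_distrib_left diff_divide_distrib)
  have pw: "X p ^ (2 * k) \<le> 2 ^ (2 * k) * ((X p - c * T p) ^ (2 * k) + (c * T p) ^ (2 * k))" for p
  proof -
    let ?a = "\<bar>X p - c * T p\<bar>" and ?b = "c * T p"
    have "X p \<le> 2 * max ?a ?b" by (auto simp: max_def abs_if)
    then have "X p ^ (2 * k) \<le> (2 * max ?a ?b) ^ (2 * k)" using nn by (intro power_mono) auto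
    also have "\<dots> = 2 ^ (2 * k) * (max ?a ?b) ^ (2 * k)" by (simp add: power_mult_distrib)
    also have "(max ?a ?b) ^ (2 * k) \<le> ?a ^ (2 * k) + ?b ^ (2 * k)"
      using nn c1 by (simp add: max_def)
    also have "?a ^ (2 * k) = (X p - c * T p) ^ (2 * k)" by (simp add: power_mult)
    finally show ?thesis by simp
  qed
  have "ex (\<lambda>p. \<bar>X p\<bar> ^ (2 * k)) \<le> ex (\<lambda>p. 2 ^ (2 * k) * ((X p - c * T p) ^ (2 * k) + c ^ (2 * k) * T p ^ (2 * k)))"
    using pw nn by (intro ex_mono) (simp add: power_mult_distrib)
  also have "\<dots> = 2 ^ (2 * k) * (ex (\<lambda>p. (X p - c * T p) ^ (2 * k)) + c ^ (2 * k) * ex (\<lambda>p. T p ^ (2 * k)))"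
    by (simp only: ex_cmult ex_add)
  also have "\<dots> \<le> 2 ^ (2 * k) * (B * ex (\<lambda>p. T p ^ (2 * k)) + c ^ (2 * k) * ex (\<lambda>p. T p ^ (2 * k)))"
    using main by (intro mult_left_mono add_right_mono) auto
  also have "\<dots> = 2 ^ (2 * k) * ((B + c ^ (2 * k)) * ex (\<lambda>p. T p ^ (2 * k)))"
    by (simp add: algebra_simps)
  also have "\<dots> \<le> 2 ^ (2 * k) * ((4 * c) ^ (2 * k) * t ^ (2 * k))"
  proof (intro mult_left_mono mult_mono tT)
    have "c ^ (2 * k) \<le> (2 * c) ^ (2 * k)" using c1 by (intro power_mono) auto
    with Bc have "B + c ^ (2 * k) \<le> 2 * (2 * c) ^ (2 * k)" by simp
    also have "\<dots> \<le> 2 ^ (2 * k) * (2 * c) ^ (2 * k)"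
      using k self_le_power[of "2::real" "2 * k"] c1 by (intro mult_right_mono) auto
    also have "\<dots> = (2 * (2 * c)) ^ (2 * k)" by (rule power_mult_distrib[symmetric])
    finally show "B + c ^ (2 * k) \<le> (4 * c) ^ (2 * k)" by simp
  qed (use c1 nn in \<open>auto intro!: ex_nonneg\<close>)
  also have "\<dots> = (2 * (4 * c * t)) ^ (2 * k)" by (simp only: power_mult_distrib)
  also have "2 * (4 * c * t) = 8 * c * t" by simp
  also have "(8 * c * t) ^ (2 * k) \<le> (64 * real k * t) ^ (2 * k)"
    using c1 t0 by (intro power_mono mult_right_mono) (auto simp: c_def)
  finally show ?thesis using t0 by (simp add: bd_def X_def)
qed

end

section \<open>Chaining over dyadic blocks\<close>

text \<open>Empty for even \<open>x\<close>, an interval of length \<open>2 ^ k\<close> for odd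
  \<open>x\<close>. With \<open>x = N div 2 ^ k\<close> it is the part of \<open>{..<N}\<close> that
  belongs to the binary digit of \<open>N\<close> of weight \<open>2 ^ k\<close>.\<close>

definition dyadic_block :: "nat \<Rightarrow> nat \<Rightarrow> nat set" where
  "dyadic_block k x = {2 ^ Suc k * (x div 2)..<2 ^ k * x}"

lemma card_dyadic_block: "card (dyadic_block k x) \<le> 2 ^ k"
proof -
  have "2 ^ k * x = 2 ^ k * (2 * (x div 2) + x mod 2)" by simp
  also have "\<dots> = 2 ^ Suc k * (x div 2) + 2 ^ k * (x mod 2)"
    by (simp only: distrib_left power_Suc mult_ac)
  finally have "card (dyadic_block k x) = 2 ^ k * (x mod 2)"
    by (simp add: dyadic_block_def)
  also have "\<dots> \<le> 2 ^ k * 1" by (intro mult_le_mono2) auto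
  finally show ?thesis by simp
qed

text \<open>The block of scale \<open>k\<close> is the gap between \<open>N\<close> rounded down to
  a multiple of \<open>2 ^ Suc k\<close> and to a multiple of \<open>2 ^ k\<close>, so the sums
  telescope. The bound on \<open>N\<close> makes the coarsest rounding 0.\<close>

lemma sum_lessThan_dyadic_blocks:
  fixes g :: "nat \<Rightarrow> real"
  assumes "N \<le> 2 ^ K"
  shows "(\<Sum>m<N. g m) = (\<Sum>k\<le>K. \<Sum>m\<in>dyadic_block k (N div 2 ^ k). g m)"
proof -
  define P where "P k = (\<Sum>m<2 ^ k * (N div 2 ^ k). g m)" for k
  have "(\<Sum>m\<in>dyadic_block k (N div 2 ^ k). g m) = P k - P (Suc k)" for k
  proof -
    have e: "N div 2 ^ k div 2 = N div 2 ^ Suc k"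
      by (simp add: div_mult2_eq[symmetric] mult.commute)
    have "2 ^ Suc k * (N div 2 ^ Suc k) = 2 ^ k * (2 * (N div 2 ^ k div 2))"
      by (simp only: e power_Suc mult_ac)
    also have "\<dots> \<le> 2 ^ k * (N div 2 ^ k)" by (intro mult_le_mono2) simp
    finally show ?thesis
      using sum_diff_nat_ivl[of 0 "2 ^ Suc k * (N div 2 ^ Suc k)" "2 ^ k * (N div 2 ^ k)" g]
      by (simp only: P_def dyadic_block_def e lessThan_atLeast0)
  qed
  then have "(\<Sum>k\<le>K. \<Sum>m\<in>dyadic_block k (N div 2 ^ k). g m) = P 0 - P (Suc K)"
    by (simp only: sum_telescope)
  moreover have "P (Suc K) = 0"
  proof -
    have "N div 2 ^ Suc K = 0" using assms le_less_trans[OF assms, of "2 ^ Suc K"] by (intro div_less) simp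
    then show ?thesis unfolding P_def by simp
  qed
  moreover have "P 0 = (\<Sum>m<N. g m)" by (simp add: P_def)
  ultimately show ?thesis by simp
qed

text \<open>Cauchy-Schwarz with weights that grow away from the top scale \<open>K\<close>. The
  ratio \<open>10 / 9\<close> is small enough to be beaten by the gain \<open>4 / 5\<close> per
  scale in \<open>chaining\<close>: the product is \<open>8 / 9\<close>, whose powers add up to at
  most 9.\<close>

lemma power2_sum_geometric:
  fixes f :: "nat \<Rightarrow> real"
  shows "(\<Sum>k\<le>K. f k)\<^sup>2 \<le> 10 * (\<Sum>k\<le>K. (10 / 9) ^ (K - k) * (f k)\<^sup>2)"
proof (induction K)
  case (Suc K)
  let ?s = "\<Sum>k\<le>K. f k" and ?S = "\<Sum>k\<le>K. (10 / 9) ^ (K - k) * (f k)\<^sup>2"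
  have "0 \<le> (?s / 3 - 3 * f (Suc K))\<^sup>2" by simp
  then have "(?s + f (Suc K))\<^sup>2 \<le> 10 / 9 * ?s\<^sup>2 + 10 * (f (Suc K))\<^sup>2"
    by (simp add: power2_eq_square field_simps)
  also have "\<dots> \<le> 10 / 9 * (10 * ?S) + 10 * (f (Suc K))\<^sup>2" using Suc by simp
  also have "10 / 9 * (10 * ?S) = 10 * (\<Sum>k\<le>K. (10 / 9) ^ (Suc K - k) * (f k)\<^sup>2)"
    by (simp add: sum_distrib_left Suc_diff_le mult.assoc mult.left_commute cong: sum.cong_simp)
  finally show ?case by (simp add: distrib_left)
qed simp

lemma sum_geometric_le: "(\<Sum>k\<le>K. (8 / 9) ^ (K - k)) \<le> (9::real)"
proof (induction K)
  case (Suc K)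
  have "(\<Sum>k\<le>Suc K. (8 / 9) ^ (Suc K - k)) = 8 / 9 * (\<Sum>k\<le>K. (8 / 9) ^ (K - k)) + (1::real)"
    by (simp add: sum_distrib_left Suc_diff_le cong: sum.cong_simp)
  with Suc show ?case by simp
qed simp

lemma obtain_power_two:
  assumes "1 \<le> (M::nat)"
  obtains K where "M \<le> 2 ^ K" "2 ^ K \<le> 2 * M"
proof -
  define K where "K = (LEAST K. M \<le> 2 ^ K)"
  have K: "M \<le> 2 ^ K" unfolding K_def by (rule LeastI[of _ M]) (simp add: less_exp less_imp_le)
  have "2 ^ K \<le> 2 * M"
  proof (cases K)
    case 0 then show ?thesis using assms by simp
  next
    case (Suc K')
    have "\<not> M \<le> 2 ^ K'" using not_less_Least[of K' "\<lambda>K. M \<le> 2 ^ K"] Suc by (simp add: K_def)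
    then show ?thesis by (simp add: Suc)
  qed
  with K that show ?thesis by blast
qed

context flip_space
begin

lemma bd_sq_add:
  assumes "1 \<le> q" "bd q (\<lambda>p. (f p)\<^sup>2) a" "bd q (\<lambda>p. (g p)\<^sup>2) b"
  shows "bd q (\<lambda>p. (f p + g p)\<^sup>2) (2 * (a + b))"
proof -
  have "bd q (\<lambda>p. 2 * ((f p)\<^sup>2 + (g p)\<^sup>2)) (\<bar>2\<bar> * (a + b))"
    using assms by (intro bd_cmult bd_add)
  then have "bd q (\<lambda>p. (f p + g p)\<^sup>2) (\<bar>2\<bar> * (a + b))"
  proof (rule bd_mono)
    fix p
    have "0 \<le> (f p - g p)\<^sup>2" by simp
    then have "(f p + g p)\<^sup>2 \<le> 2 * ((f p)\<^sup>2 + (g p)\<^sup>2)"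
      by (simp add: power2_eq_square algebra_simps)
    then show "\<bar>(f p + g p)\<^sup>2\<bar> \<le> \<bar>2 * ((f p)\<^sup>2 + (g p)\<^sup>2)\<bar>"
      by simp
  qed
  then show ?thesis by simp
qed

lemma bd_sq_mult:
  assumes "bd (2 * q) (\<lambda>p. (f p)\<^sup>2) a" "bd (2 * q) (\<lambda>p. (g p)\<^sup>2) b"
  shows "bd q (\<lambda>p. (f p * g p)\<^sup>2) (a * b)"
  using bd_mult[OF assms] by (simp add: power_mult_distrib)

lemma bd_sq_sum:
  assumes q: "1 \<le> q" and I: "finite I" and f: "\<And>i. i \<in> I \<Longrightarrow> bd q (\<lambda>p. \<Sum>y\<in>Y. (f i y p)\<^sup>2) a"
    and a: "0 \<le> a"
  shows "bd q (\<lambda>p. \<Sum>y\<in>Y. (\<Sum>i\<in>I. f i y p)\<^sup>2) ((real (card I))\<^sup>2 * a)"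
proof -
  have "bd q (\<lambda>p. real (card I) * (\<Sum>i\<in>I. \<Sum>y\<in>Y. (f i y p)\<^sup>2)) (\<bar>real (card I)\<bar> * (card I * a))"
    by (rule bd_cmult, rule bd_sum_const[OF q I], rule f)
  then have "bd q (\<lambda>p. \<Sum>y\<in>Y. (\<Sum>i\<in>I. f i y p)\<^sup>2) (\<bar>real (card I)\<bar> * (card I * a))"
  proof (rule bd_mono)
    fix p
    have "(\<Sum>y\<in>Y. (\<Sum>i\<in>I. f i y p)\<^sup>2) \<le> (\<Sum>y\<in>Y. real (card I) * (\<Sum>i\<in>I. (f i y p)\<^sup>2))"
      using Cauchy_Schwarz_ineq_sum[of "\<lambda>_. 1" "\<lambda>i. f i _ p" I] by (intro sum_mono) simp
    also have "\<dots> = real (card I) * (\<Sum>i\<in>I. \<Sum>y\<in>Y. (f i y p)\<^sup>2)"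
      by (subst sum.swap) (simp add: sum_distrib_left)
    finally show "\<bar>\<Sum>y\<in>Y. (\<Sum>i\<in>I. f i y p)\<^sup>2\<bar> \<le> \<bar>real (card I) * (\<Sum>i\<in>I. \<Sum>y\<in>Y. (f i y p)\<^sup>2)\<bar>"
      by (simp add: sum_nonneg)
  qed
  then show ?thesis by (simp add: power2_eq_square mult.assoc)
qed

text \<open>The block of \<open>F\<close> depends on \<open>v\<close> only through its index, so its
  square may be replaced by the sum of the squares over all blocks of scale \<open>k\<close>. The
  sum over \<open>v\<close> then acts on \<open>G\<close> alone and is at most the maximum
  \<open>T\<close> over the blocks of scale \<open>l\<close>. In \<open>S\<close> only a constant is
  lost, since the blocks have total length at most \<open>2 ^ (K + 1)\<close>. The maximum has size
  \<open>Y * 2 ^ l\<close> instead of \<open>Y * 2 ^ K\<close> and costs \<open>5 / 4\<close> per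
  scale, whence the gain \<open>5 / 8\<close> per scale.\<close>

lemma chain_block:
  fixes F G :: "nat \<Rightarrow> nat \<Rightarrow> 'w \<Rightarrow> real" and X Y :: real
  assumes kappa: "1 \<le> \<mu>" and XY: "0 \<le> X" "0 \<le> Y" and M: "M \<le> 2 ^ K"
    and F: "\<And>\<beta>. \<beta> \<subseteq> {..<M} \<Longrightarrow>
      bd (4 * \<mu>) (\<lambda>p. \<Sum>u<M. (\<Sum>m\<in>\<beta>. F m u p)\<^sup>2) (X * card \<beta>)"
    and G: "\<And>\<beta>. \<beta> \<subseteq> {..<M} \<Longrightarrow>
      bd (4 * \<mu>) (\<lambda>p. \<Sum>v<M. (\<Sum>w\<in>\<beta>. G w v p)\<^sup>2) (Y * card \<beta>)"
    and k: "k \<le> K" and l: "l \<le> K"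
  shows "bd (2 * \<mu>) (\<lambda>p. \<Sum>u<M. \<Sum>v<M. (\<Sum>m\<in>dyadic_block k (Suc v div 2 ^ k). F m u p)\<^sup>2
      * (\<Sum>w\<in>dyadic_block l (Suc u div 2 ^ l). G w v p)\<^sup>2) (5 / 2 * 4 ^ K * X * Y * (5 / 8) ^ (K - l))"
proof -
  define A where "A x u p = (\<Sum>m\<in>dyadic_block k x. F m u p)\<^sup>2" for x u p
  define B where "B y p = (\<Sum>v<M. (\<Sum>w\<in>dyadic_block l y. G w v p)\<^sup>2)" for y p
  define S where "S p = (\<Sum>x\<le>M div 2 ^ k. \<Sum>u<M. A x u p)" for p
  define T where "T p = Max (insert 0 ((\<lambda>y. \<bar>B y p\<bar>) ` {..M div 2 ^ l}))" for p
  have sub: "dyadic_block k x \<subseteq> {..<M}" if "x \<le> M div 2 ^ k" for k x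
  proof -
    have "2 ^ k * x \<le> 2 ^ k * (M div 2 ^ k)" using that by (intro mult_le_mono2)
    also have "\<dots> \<le> M" by simp
    finally show ?thesis by (auto simp: dyadic_block_def)
  qed
  have cnt: "M div 2 ^ k + 1 \<le> 2 ^ (K - k + 1)" if "k \<le> K" for k
  proof -
    have "M div 2 ^ k \<le> 2 ^ K div 2 ^ k" using M by (rule div_le_mono)
    also have "\<dots> = 2 ^ (K - k)" using that by (simp add: power_diff)
    finally have "M div 2 ^ k \<le> 2 ^ (K - k)" .
    moreover have "(1::nat) \<le> 2 ^ (K - k)" by simp
    ultimately show ?thesis unfolding power_add power_one_right by linarith
  qed
  have block_le: "Z * real (card (dyadic_block k x)) \<le> Z * 2 ^ k" if "0 \<le> Z" for Z k x
    using card_dyadic_block[of k x] that by (auto intro!: mult_left_mono simp flip: of_nat_le_iff)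
  have S: "bd (4 * \<mu>) S (2 ^ (K + 1) * X)"
  proof -
    have "bd (4 * \<mu>) S (card {..M div 2 ^ k} * (X * 2 ^ k))"
      unfolding S_def
    proof (rule bd_sum_const)
      fix x assume "x \<in> {..M div 2 ^ k}"
      then have "bd (4 * \<mu>) (\<lambda>p. \<Sum>u<M. A x u p) (X * card (dyadic_block k x))"
        unfolding A_def by (intro F sub) simp
      then show "bd (4 * \<mu>) (\<lambda>p. \<Sum>u<M. A x u p) (X * 2 ^ k)"
        by (rule bd_weaken) (rule block_le[OF XY(1)])
    qed (use kappa in auto)
    moreover have "real (card {..M div 2 ^ k}) * (X * 2 ^ k) \<le> 2 ^ (K + 1) * X"
    proof -
      have "real (M div 2 ^ k + 1) \<le> real (2 ^ (K - k + 1))"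
        using cnt[OF k] by (simp only: of_nat_le_iff)
      then have "real (card {..M div 2 ^ k}) * (X * 2 ^ k) \<le> 2 ^ (K - k + 1) * (X * 2 ^ k)"
        using XY by (intro mult_right_mono) auto
      also have "\<dots> = (2 ^ (K - k + 1) * 2 ^ k) * X" by simp
      also have "2 ^ (K - k + 1) * 2 ^ k = (2 ^ (K + 1) :: real)"
        using k by (simp flip: power_add)
      finally show ?thesis .
    qed
    ultimately show ?thesis by (rule bd_weaken)
  qed
  have T: "bd (4 * \<mu>) T ((5 / 4) ^ (K - l + 1) * (Y * 2 ^ l))"
    unfolding T_def
  proof (rule bd_Max)
    show "bd (4 * \<mu>) (B y) (Y * 2 ^ l)" if "y \<in> {..M div 2 ^ l}" for y
    proof -
      have "bd (4 * \<mu>) (B y) (Y * card (dyadic_block l y))"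
        using that unfolding B_def by (intro G sub) simp
      then show ?thesis
        by (rule bd_weaken) (rule block_le[OF XY(2)])
    qed
    have "real (M div 2 ^ l + 1) \<le> real (2 ^ (K - l + 1))"
      using cnt[OF l] by (simp only: of_nat_le_iff)
    then have "real (card {..M div 2 ^ l}) \<le> 2 ^ (K - l + 1)" by simp
    \<comment> \<open>\<open>(5 / 4) ^ 4\<close> exceeds 2, and the order \<open>4 * \<mu>\<close>
      of the moment is at least 4.\<close>
    also have "\<dots> \<le> ((5 / 4) ^ 4) ^ (K - l + 1)" by (intro power_mono) (auto simp: power4_eq_xxxx)
    also have "\<dots> = ((5 / 4) ^ (K - l + 1)) ^ 4" by (simp only: power_mult[symmetric] mult.commute)
    also have "\<dots> \<le> ((5 / 4) ^ (K - l + 1)) ^ (4 * \<mu>)"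
      using kappa one_le_power[of "5/4::real" "K - l + 1"] by (intro power_increasing) auto
    finally show "real (card {..M div 2 ^ l}) \<le> ((5 / 4) ^ (K - l + 1)) ^ (4 * \<mu>)" .
  qed (use kappa XY in auto)
  have "bd (2 * \<mu>) (\<lambda>p. S p * T p) (2 ^ (K + 1) * X * ((5 / 4) ^ (K - l + 1) * (Y * 2 ^ l)))"
    using S T by (intro bd_mult) simp_all
  also have "2 ^ (K + 1) * X * ((5 / 4) ^ (K - l + 1) * (Y * 2 ^ l)) = 5 / 2 * 4 ^ K * X * Y * (5 / 8) ^ (K - l)"
  proof -
    have "(5 / 8 :: real) ^ (K - l) * 2 ^ K = (5 / 8) ^ (K - l) * 2 ^ ((K - l) + l)" using l by simp
    also have "\<dots> = ((5 / 8) * 2) ^ (K - l) * 2 ^ l" by (simp only: power_add power_mult_distrib mult.assoc)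
    also have "\<dots> = (5 / 4) ^ (K - l) * 2 ^ l" by simp
    finally have e: "(5 / 4) ^ (K - l) * 2 ^ l = (5 / 8 :: real) ^ (K - l) * 2 ^ K" ..
    have "(4::real) ^ K = (2 * 2) ^ K" by simp
    also have "\<dots> = 2 ^ K * 2 ^ K" by (rule power_mult_distrib)
    finally have f: "(4::real) ^ K = 2 ^ K * 2 ^ K" .
    have "2 ^ (K + 1) * X * ((5 / 4) ^ (K - l + 1) * (Y * 2 ^ l))
        = 5 / 2 * 2 ^ K * X * Y * ((5 / 4) ^ (K - l) * 2 ^ l)" by simp
    also have "\<dots> = 5 / 2 * 4 ^ K * X * Y * (5 / 8) ^ (K - l)" unfolding e f by simp
    finally show ?thesis .
  qed
  finally have ST: "bd (2 * \<mu>) (\<lambda>p. S p * T p) (5 / 2 * 4 ^ K * X * Y * (5 / 8) ^ (K - l))" .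
  then show ?thesis
  proof (rule bd_mono)
    fix p
    have A0: "0 \<le> A x u p" for x u by (simp add: A_def)
    have B0: "0 \<le> B y p" for y by (simp add: B_def sum_nonneg)
    have T0: "0 \<le> T p" unfolding T_def by (intro Max_ge) auto
    have BT: "B y p \<le> T p" if "y \<le> M div 2 ^ l" for y
    proof -
      have "\<bar>B y p\<bar> \<le> T p" unfolding T_def using that by (intro Max_ge) auto
      then show ?thesis by simp
    qed
    have idx: "Suc v div 2 ^ k \<le> M div 2 ^ k" if "v < M" for v k
      using that by (intro div_le_mono) auto
    have "(\<Sum>u<M. \<Sum>v<M. A (Suc v div 2 ^ k) u p * (\<Sum>w\<in>dyadic_block l (Suc u div 2 ^ l). G w v p)\<^sup>2)
        \<le> (\<Sum>u<M. \<Sum>v<M. (\<Sum>x\<le>M div 2 ^ k. A x u p) * (\<Sum>w\<in>dyadic_block l (Suc u div 2 ^ l). G w v p)\<^sup>2)"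
      using idx A0 by (intro sum_mono mult_right_mono member_le_sum) auto
    also have "\<dots> = (\<Sum>u<M. (\<Sum>x\<le>M div 2 ^ k. A x u p) * B (Suc u div 2 ^ l) p)"
      by (simp add: B_def sum_distrib_left)
    also have "\<dots> \<le> (\<Sum>u<M. (\<Sum>x\<le>M div 2 ^ k. A x u p) * T p)"
      using idx A0 by (intro sum_mono mult_left_mono BT sum_nonneg) auto
    also have "\<dots> = S p * T p"
      unfolding S_def by (subst sum.swap) (simp add: sum_distrib_right)
    finally show "\<bar>\<Sum>u<M. \<Sum>v<M. (\<Sum>m\<in>dyadic_block k (Suc v div 2 ^ k). F m u p)\<^sup>2
        * (\<Sum>w\<in>dyadic_block l (Suc u div 2 ^ l). G w v p)\<^sup>2\<bar> \<le> \<bar>S p * T p\<bar>"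
      unfolding A_def by (simp add: sum_nonneg)
  qed
qed

text \<open>Estimating the maximal partial sums over \<open>v\<close> and over \<open>u\<close> separately is not possible here
  because \<open>sup\<^sub>v\<close> does not commute with the \<open>\<ell>\<^sup>2\<close> sum over \<open>u\<close>. At fixed dyadic scales a maximum over few
  blocks on either side suffices, with a gain in the finer of the two scales.\<close>

lemma chaining:
  fixes F G :: "nat \<Rightarrow> nat \<Rightarrow> 'w \<Rightarrow> real" and X Y :: real
  assumes kappa: "1 \<le> \<mu>" and XY: "0 \<le> X" "0 \<le> Y" and M: "1 \<le> M"
    and F: "\<And>\<beta>. \<beta> \<subseteq> {..<M} \<Longrightarrow>
      bd (4 * \<mu>) (\<lambda>p. \<Sum>u<M. (\<Sum>m\<in>\<beta>. F m u p)\<^sup>2) (X * card \<beta>)"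
    and G: "\<And>\<beta>. \<beta> \<subseteq> {..<M} \<Longrightarrow>
      bd (4 * \<mu>) (\<lambda>p. \<Sum>v<M. (\<Sum>w\<in>\<beta>. G w v p)\<^sup>2) (Y * card \<beta>)"
  shows "bd (2 * \<mu>) (\<lambda>p. \<Sum>u<M. \<Sum>v<M. (\<Sum>m\<le>v. F m u p)\<^sup>2 * (\<Sum>w\<le>u. G w v p)\<^sup>2)
    (81000 * X * Y * (real M)\<^sup>2)"
proof -
  obtain K where K: "M \<le> 2 ^ K" "2 ^ K \<le> 2 * M" using obtain_power_two[OF M] .
  define Q where "Q = 5 / 2 * 4 ^ K * X * Y"
  define a where "a k v u p = (\<Sum>m\<in>dyadic_block k (Suc v div 2 ^ k). F m u p)\<^sup>2" for k v u p
  define b where "b l u v p = (\<Sum>w\<in>dyadic_block l (Suc u div 2 ^ l). G w v p)\<^sup>2" for l u v p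
  define D where "D k l p = (\<Sum>u<M. \<Sum>v<M. a k v u p * b l u v p)" for k l p
  have Q0: "0 \<le> Q" using XY by (simp add: Q_def)
  have D: "bd (2 * \<mu>) (D k l) (Q * (4 / 5) ^ (K - k) * (4 / 5) ^ (K - l))" if kl: "k \<le> K" "l \<le> K" for k l
  proof -
    have D1: "bd (2 * \<mu>) (D k l) (Q * (5 / 8) ^ (K - l))"
      using chain_block[OF kappa XY K(1) F G kl] by (simp add: D_def[abs_def] a_def b_def Q_def)
    have D2: "bd (2 * \<mu>) (D k l) (Q * (5 / 8) ^ (K - k))"
    proof -
      have "(\<lambda>p. \<Sum>v<M. \<Sum>u<M. b l u v p * a k v u p) = D k l"
        unfolding D_def by (rule ext, subst sum.swap) (simp add: mult.commute)
      then show ?thesis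
        using chain_block[OF kappa XY(2,1) K(1) G F kl(2,1)] by (simp add: a_def b_def Q_def mult_ac)
    qed
    \<comment> \<open>The gain \<open>5 / 8\<close> is available for the larger of the exponents
      \<open>K - k\<close> and \<open>K - l\<close>. Since \<open>5 / 8 \<le> (4 / 5)^2\<close>, it
      pays for a gain \<open>4 / 5\<close> in both, which makes the double sum over the scales
      converge.\<close>
    have le: "Q * (5 / 8) ^ j \<le> Q * (4 / 5) ^ i * (4 / 5) ^ i'" if "i \<le> j" "i' \<le> j" for i i' j :: nat
    proof -
      have "(5 / 8 :: real) ^ j \<le> (4 / 5 * (4 / 5)) ^ j" by (intro power_mono) auto
      also have "\<dots> = (4 / 5) ^ j * (4 / 5) ^ j" by (rule power_mult_distrib)
      also have "\<dots> \<le> (4 / 5) ^ i * (4 / 5) ^ i'"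
        using that by (intro mult_mono power_decreasing) auto
      finally show ?thesis using Q0 by (simp add: mult_left_mono mult.assoc)
    qed
    show ?thesis
    proof (cases "K - k \<le> K - l")
      case True
      then show ?thesis using le[of "K - k" "K - l" "K - l"] D1 bd_weaken by blast
    next
      case False
      then show ?thesis using le[of "K - k" "K - k" "K - l"] D2 bd_weaken by force
    qed
  qed
  let ?w = "\<lambda>k. (10 / 9 :: real) ^ (K - k)"
  let ?W = "\<lambda>p. 100 * (\<Sum>k\<le>K. \<Sum>l\<le>K. (?w k * ?w l) * D k l p)"
  have "bd (2 * \<mu>) ?W
      (\<bar>100\<bar> * (\<Sum>k\<le>K. \<Sum>l\<le>K. \<bar>?w k * ?w l\<bar> * (Q * (4 / 5) ^ (K - k) * (4 / 5) ^ (K - l))))"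
    using kappa by (intro bd_cmult bd_sum D) auto
  also have "(\<Sum>k\<le>K. \<Sum>l\<le>K. \<bar>?w k * ?w l\<bar> * (Q * (4 / 5) ^ (K - k) * (4 / 5) ^ (K - l)))
      = Q * (\<Sum>k\<le>K. (8 / 9) ^ (K - k)) * (\<Sum>l\<le>K. (8 / 9) ^ (K - l))"
  proof -
    have e: "?w k * (4 / 5) ^ (K - k) = (8 / 9) ^ (K - k)" for k
    proof -
      have "?w k * (4 / 5) ^ (K - k) = (10 / 9 * (4 / 5)) ^ (K - k)" by (rule power_mult_distrib[symmetric])
      then show ?thesis by simp
    qed
    have "\<bar>?w k * ?w l\<bar> * (Q * (4 / 5) ^ (K - k) * (4 / 5) ^ (K - l))
        = Q * (?w k * (4 / 5) ^ (K - k)) * (?w l * (4 / 5) ^ (K - l))" for k l by simp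
    then have "(\<Sum>k\<le>K. \<Sum>l\<le>K. \<bar>?w k * ?w l\<bar> * (Q * (4 / 5) ^ (K - k) * (4 / 5) ^ (K - l)))
        = (\<Sum>k\<le>K. \<Sum>l\<le>K. Q * ((8 / 9) ^ (K - k) * (8 / 9) ^ (K - l)))"
      by (simp only: e mult.assoc)
    also have "\<dots> = Q * ((\<Sum>k\<le>K. (8 / 9) ^ (K - k)) * (\<Sum>l\<le>K. (8 / 9) ^ (K - l)))"
      by (subst sum_product) (simp only: sum_distrib_left)
    finally show ?thesis by (simp only: mult.assoc)
  qed
  finally have main: "bd (2 * \<mu>) ?W
      (\<bar>100\<bar> * (Q * (\<Sum>k\<le>K. (8 / 9) ^ (K - k)) * (\<Sum>l\<le>K. (8 / 9) ^ (K - l))))" .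
  \<comment> \<open>The constant is \<open>100 * 81 * (5 / 2) * 4\<close>: two uses of
    \<open>power2_sum_geometric\<close>, two geometric series, the factor in
    \<open>chain_block\<close>, and \<open>2 ^ K \<le> 2 * M\<close> squared.\<close>
  have "Q * (\<Sum>k\<le>K. (8 / 9) ^ (K - k)) * (\<Sum>l\<le>K. (8 / 9) ^ (K - l)) \<le> Q * 9 * 9"
    using Q0 sum_geometric_le[of K] by (intro mult_mono mult_nonneg_nonneg sum_nonneg) auto
  also have "\<dots> \<le> 810 * X * Y * (real M)\<^sup>2"
  proof -
    have "(2::real) ^ K \<le> 2 * real M"
      using K(2) by (metis of_nat_le_iff of_nat_mult of_nat_numeral of_nat_power)
    then have "((2::real) ^ K)\<^sup>2 \<le> (2 * real M)\<^sup>2" by (intro power_mono) auto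
    then have "(4::real) ^ K \<le> 4 * (real M)\<^sup>2"
      by (simp add: power_mult_distrib power2_eq_square power_mult[symmetric] flip: power_mult_distrib)
    then have "4 ^ K * (5 / 2 * X * Y * 81) \<le> 4 * (real M)\<^sup>2 * (5 / 2 * X * Y * 81)"
      using XY by (intro mult_right_mono) auto
    then show ?thesis by (simp add: Q_def mult_ac)
  qed
  finally have "bd (2 * \<mu>) ?W
      (81000 * X * Y * (real M)\<^sup>2)"
    using bd_weaken[OF main, of "81000 * X * Y * (real M)\<^sup>2"] by simp
  then show ?thesis
  proof (rule bd_mono)
    fix p
    have fa: "(\<Sum>m\<le>v. F m u p)\<^sup>2 \<le> 10 * (\<Sum>k\<le>K. ?w k * a k v u p)" if "v < M" for u v
      using sum_lessThan_dyadic_blocks[of "Suc v" K "\<lambda>m. F m u p"] that K(1)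
        power2_sum_geometric[of "\<lambda>k. \<Sum>m\<in>dyadic_block k (Suc v div 2 ^ k). F m u p" K]
      by (simp add: a_def lessThan_Suc_atMost)
    have gb: "(\<Sum>w\<le>u. G w v p)\<^sup>2 \<le> 10 * (\<Sum>l\<le>K. ?w l * b l u v p)" if "u < M" for u v
      using sum_lessThan_dyadic_blocks[of "Suc u" K "\<lambda>w. G w v p"] that K(1)
        power2_sum_geometric[of "\<lambda>l. \<Sum>w\<in>dyadic_block l (Suc u div 2 ^ l). G w v p" K]
      by (simp add: b_def lessThan_Suc_atMost)
    have ab0: "0 \<le> a k v u p" "0 \<le> b l u v p" for k l u v by (simp_all add: a_def b_def)
    have "(\<Sum>u<M. \<Sum>v<M. (\<Sum>m\<le>v. F m u p)\<^sup>2 * (\<Sum>w\<le>u. G w v p)\<^sup>2)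
        \<le> (\<Sum>u<M. \<Sum>v<M. (10 * (\<Sum>k\<le>K. ?w k * a k v u p)) * (10 * (\<Sum>l\<le>K. ?w l * b l u v p)))"
      using ab0 by (intro sum_mono mult_mono fa gb) (auto intro!: sum_nonneg)
    also have "\<dots> = (\<Sum>u<M. \<Sum>v<M. \<Sum>k\<le>K. \<Sum>l\<le>K. 100 * ((?w k * ?w l) * (a k v u p * b l u v p)))"
    proof (intro sum.cong refl)
      fix u v
      let ?A = "\<Sum>k\<le>K. ?w k * a k v u p" and ?B = "\<Sum>l\<le>K. ?w l * b l u v p"
      have "10 * ?A * (10 * ?B)
          = 100 * (?A * ?B)" by simp
      also have "\<dots> = 100 * (\<Sum>k\<le>K. \<Sum>l\<le>K. (?w k * ?w l) * (a k v u p * b l u v p))"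
        by (subst sum_product) (simp only: mult_ac)
      finally show "10 * ?A * (10 * ?B)
          = (\<Sum>k\<le>K. \<Sum>l\<le>K. 100 * ((?w k * ?w l) * (a k v u p * b l u v p)))"
        by (simp only: sum_distrib_left)
    qed
    also have "\<dots> = (\<Sum>k\<le>K. \<Sum>l\<le>K. \<Sum>u<M. \<Sum>v<M. 100 * ((?w k * ?w l) * (a k v u p * b l u v p)))"
      by (simp only: sum.swap[where A="{..<M}" and B="{..K}"])
    also have "\<dots> = 100 * (\<Sum>k\<le>K. \<Sum>l\<le>K. (?w k * ?w l) * D k l p)"
      by (simp only: D_def sum_distrib_left)
    finally show "\<bar>\<Sum>u<M. \<Sum>v<M. (\<Sum>m\<le>v. F m u p)\<^sup>2 * (\<Sum>w\<le>u. G w v p)\<^sup>2\<bar> \<le> \<bar>?W p\<bar>"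
      by (simp add: sum_nonneg)
  qed
qed

end

section \<open>Removing order constraints\<close>

lemma sum_above:
  fixes g :: "nat \<Rightarrow> real"
  assumes "u < M"
  shows "(\<Sum>b\<in>{u<..<M}. g b) = (\<Sum>b<M. g b) - (\<Sum>b\<le>u. g b)"
proof -
  have "sum g ({..u} \<union> {u<..<M}) = sum g {..u} + sum g {u<..<M}"
    by (rule sum.union_disjoint) auto
  also have "{..u} \<union> {u<..<M} = {..<M}" using assms by auto
  finally show ?thesis by simp
qed

lemma sum_above_commute:
  fixes h :: "nat \<Rightarrow> nat \<Rightarrow> real"
  shows "(\<Sum>b<M. \<Sum>u<b. h b u) = (\<Sum>u<M. \<Sum>b\<in>{u<..<M}. h b u)"
proof -
  have "(\<Sum>b<M. \<Sum>u<b. h b u) = (\<Sum>b<M. \<Sum>u<M. if u < b then h b u else 0)"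
    by (intro sum.cong[OF refl] sum.mono_neutral_cong_left) auto
  also have "\<dots> = (\<Sum>u<M. \<Sum>b<M. if u < b then h b u else 0)" by (rule sum.swap)
  also have "\<dots> = (\<Sum>u<M. \<Sum>b\<in>{u<..<M}. h b u)"
    by (intro sum.cong[OF refl] sum.mono_neutral_cong_right) auto
  finally show ?thesis .
qed

text \<open>The constraints are crossed: the outer index of each factor bounds the inner index of
  the other. For fixed \<open>u\<close> and \<open>v\<close> they separate, and the sum factors into
  two tails.\<close>

lemma sum_below_below:
  fixes p q :: "nat \<Rightarrow> nat \<Rightarrow> real"
  shows "(\<Sum>a<M. \<Sum>b<M. \<Sum>u<b. \<Sum>v<a. p a u * q b v)
    = (\<Sum>u<M. \<Sum>v<M. (\<Sum>a\<in>{v<..<M}. p a u) * (\<Sum>b\<in>{u<..<M}. q b v))"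
proof -
  have "(\<Sum>a<M. \<Sum>b<M. \<Sum>u<b. \<Sum>v<a. p a u * q b v)
      = (\<Sum>a<M. \<Sum>u<M. \<Sum>b\<in>{u<..<M}. \<Sum>v<a. p a u * q b v)"
    by (rule sum.cong[OF refl]) (rule sum_above_commute)
  also have "\<dots> = (\<Sum>u<M. \<Sum>a<M. \<Sum>v<a. \<Sum>b\<in>{u<..<M}. p a u * q b v)"
    by (subst sum.swap) (rule sum.cong[OF refl], rule sum.cong[OF refl], rule sum.swap)
  also have "\<dots> = (\<Sum>u<M. \<Sum>v<M. \<Sum>a\<in>{v<..<M}. \<Sum>b\<in>{u<..<M}. p a u * q b v)"
    by (rule sum.cong[OF refl]) (rule sum_above_commute)
  finally show ?thesis by (simp only: sum_product)
qed

context flip_space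
begin

lemma littlewood_paley_single:
  assumes "1 \<le> k" and "\<And>a. a < M \<Longrightarrow> haar_at l a (Z a)"
    and "bd (2 * k) (\<lambda>p. \<Sum>a<M. (Z a p)\<^sup>2) t"
  shows "bd (2 * k) (\<lambda>p. (\<Sum>a<M. Z a p)\<^sup>2) (64 * real k * t)"
  using littlewood_paley[of k "{()}" M l "\<lambda>_. Z" t] assms by simp

text \<open>Removes the constraint \<open>u < b\<close>: where it fails, the summand has a Haar factor of level \<open>u\<close>.\<close>

lemma one_sided_sum:
  fixes F G :: "nat \<Rightarrow> 'w \<Rightarrow> real" and X Y :: real
  assumes kappa: "1 \<le> \<mu>" and XY: "0 \<le> X" "0 \<le> Y" and M: "1 \<le> M"
    and haarF: "\<And>u. u < M \<Longrightarrow> haar_at j u (F u)"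
    and flatG: "\<And>b. b < M \<Longrightarrow> flat_at j b (G b)"
    and F: "bd (4 * \<mu>) (\<lambda>p. \<Sum>u<M. (F u p)\<^sup>2) X"
    and G: "\<And>\<beta>. \<beta> \<subseteq> {..<M} \<Longrightarrow> bd (4 * \<mu>) (\<lambda>p. (\<Sum>b\<in>\<beta>. G b p)\<^sup>2) (Y * card \<beta>)"
  shows "bd (2 * \<mu>) (\<lambda>p. (\<Sum>b<M. \<Sum>u<b. F u p * G b p)\<^sup>2) (200000 * (256 * real \<mu>) * X * Y * real M)"
proof -
  define \<nu> where "\<nu> = 256 * real \<mu>"
  have L0: "0 \<le> \<nu>" by (simp add: \<nu>_def)
  have M0: "0 < real M" using M by simp
  have total: "bd (2 * \<mu>) (\<lambda>p. ((\<Sum>u<M. F u p) * (\<Sum>b<M. G b p))\<^sup>2) (\<nu> * X * (Y * real M))"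
  proof (rule bd_sq_mult)
    have "bd (2 * (2 * \<mu>)) (\<lambda>p. (\<Sum>u<M. F u p)\<^sup>2) (64 * real (2 * \<mu>) * X)"
      using kappa haarF F by (intro littlewood_paley_single) simp_all
    then show "bd (2 * (2 * \<mu>)) (\<lambda>p. (\<Sum>u<M. F u p)\<^sup>2) (\<nu> * X)"
      by (rule bd_weaken) (use XY in \<open>simp add: \<nu>_def mult_right_mono\<close>)
    show "bd (2 * (2 * \<mu>)) (\<lambda>p. (\<Sum>b<M. G b p)\<^sup>2) (Y * real M)"
      using G[of "{..<M}"] by simp
  qed
  have rest: "bd (2 * \<mu>) (\<lambda>p. (\<Sum>u<M. F u p * (\<Sum>b\<le>u. G b p))\<^sup>2) (\<nu> * (81000 * X * Y * real M))"
  proof -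
    \<comment> \<open>A degenerate case of \<open>chaining\<close>: \<open>F u / M\<close> does not
      depend on \<open>m\<close>, and \<open>G\<close> is supported at \<open>v = M - 1\<close>,
      where the inner sum over \<open>m\<close> restores \<open>F u\<close>. Of the sum over
      \<open>v\<close> a single term remains.\<close>
    let ?h = "\<lambda>u v p. (\<Sum>m\<le>v. F u p / real M)\<^sup>2 * (\<Sum>b\<le>u. if v = M - 1 then G b p else 0)\<^sup>2"
    have "bd (2 * \<mu>) (\<lambda>p. \<Sum>u<M. \<Sum>v<M. ?h u v p) (81000 * (X / real M) * Y * (real M)\<^sup>2)"
    proof (rule chaining[OF kappa _ XY(2) M])
      fix \<beta> assume \<beta>: "\<beta> \<subseteq> {..<M}"
      have fin: "card \<beta> \<le> M" using card_mono[OF _ \<beta>] by simp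
      have "bd (4 * \<mu>) (\<lambda>p. (card \<beta> / real M)\<^sup>2 * (\<Sum>u<M. (F u p)\<^sup>2)) (\<bar>(card \<beta> / real M)\<^sup>2\<bar> * X)"
        by (intro bd_cmult F)
      moreover have "(\<lambda>p. (card \<beta> / real M)\<^sup>2 * (\<Sum>u<M. (F u p)\<^sup>2)) = (\<lambda>p. \<Sum>u<M. (\<Sum>m\<in>\<beta>. F u p / real M)\<^sup>2)"
        by (simp add: sum_distrib_left power_mult_distrib power_divide)
      ultimately have "bd (4 * \<mu>) (\<lambda>p. \<Sum>u<M. (\<Sum>m\<in>\<beta>. F u p / real M)\<^sup>2) (\<bar>(card \<beta> / real M)\<^sup>2\<bar> * X)"
        by simp
      then show "bd (4 * \<mu>) (\<lambda>p. \<Sum>u<M. (\<Sum>m\<in>\<beta>. F u p / real M)\<^sup>2) (X / real M * real (card \<beta>))"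
      proof (rule bd_weaken)
        have "card \<beta> / real M \<le> 1" using fin M0 by simp
        then have "(card \<beta> / real M)\<^sup>2 \<le> card \<beta> / real M"
          unfolding power2_eq_square by (intro mult_left_le) auto
        then have "(card \<beta> / real M)\<^sup>2 * X \<le> card \<beta> / real M * X" using XY by (intro mult_right_mono)
        then show "\<bar>(card \<beta> / real M)\<^sup>2\<bar> * X \<le> X / real M * real (card \<beta>)" by (simp add: mult.commute)
      qed
      have "(\<lambda>p. \<Sum>v<M. (\<Sum>b\<in>\<beta>. if v = M - 1 then G b p else 0)\<^sup>2) = (\<lambda>p. (\<Sum>b\<in>\<beta>. G b p)\<^sup>2)"
      proof
        fix p
        have "(\<Sum>v<M. (\<Sum>b\<in>\<beta>. if v = M - 1 then G b p else 0)\<^sup>2)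
            = (\<Sum>v<M. if v = M - 1 then (\<Sum>b\<in>\<beta>. G b p)\<^sup>2 else 0)"
          by (intro sum.cong) auto
        then show "(\<Sum>v<M. (\<Sum>b\<in>\<beta>. if v = M - 1 then G b p else 0)\<^sup>2) = (\<Sum>b\<in>\<beta>. G b p)\<^sup>2"
          using M by simp
      qed
      with G[OF \<beta>] show "bd (4 * \<mu>) (\<lambda>p. \<Sum>v<M. (\<Sum>b\<in>\<beta>. if v = M - 1 then G b p else 0)\<^sup>2) (Y * real (card \<beta>))"
        by simp
    qed (use XY in simp)
    also have "81000 * (X / real M) * Y * (real M)\<^sup>2 = 81000 * X * Y * real M"
      using M0 by (simp add: power2_eq_square)
    also have "(\<lambda>p. \<Sum>u<M. \<Sum>v<M. ?h u v p) = (\<lambda>p. \<Sum>u<M. (F u p * (\<Sum>b\<le>u. G b p))\<^sup>2)"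
    proof (intro ext sum.cong refl)
      fix p u
      have "(\<Sum>v<M. ?h u v p)
          = (\<Sum>v<M. if v = M - 1 then (F u p * (\<Sum>b\<le>u. G b p))\<^sup>2 else 0)"
        using M0 by (intro sum.cong) (auto simp: power_mult_distrib)
      then show "(\<Sum>v<M. ?h u v p)
          = (F u p * (\<Sum>b\<le>u. G b p))\<^sup>2"
        using M by simp
    qed
    finally have "bd (2 * \<mu>) (\<lambda>p. \<Sum>u<M. (F u p * (\<Sum>b\<le>u. G b p))\<^sup>2) (81000 * X * Y * real M)" .
    then have "bd (2 * \<mu>) (\<lambda>p. (\<Sum>u<M. F u p * (\<Sum>b\<le>u. G b p))\<^sup>2) (64 * real \<mu> * (81000 * X * Y * real M))"
      using kappa haarF flat_at_le[OF flatG]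
      by (intro littlewood_paley_single[where l=j] haar_at_mult_flat flat_at_sum) auto
    then show ?thesis
      by (rule bd_weaken) (use XY in \<open>simp add: \<nu>_def mult_right_mono\<close>)
  qed
  have "bd (2 * \<mu>) (\<lambda>p. ((\<Sum>u<M. F u p) * (\<Sum>b<M. G b p) + - (\<Sum>u<M. F u p * (\<Sum>b\<le>u. G b p)))\<^sup>2)
      (2 * (\<nu> * X * (Y * real M) + \<nu> * (81000 * X * Y * real M)))"
    using total rest kappa by (intro bd_sq_add) simp_all
  moreover have "(\<Sum>u<M. F u p) * (\<Sum>b<M. G b p) + - (\<Sum>u<M. F u p * (\<Sum>b\<le>u. G b p))
      = (\<Sum>b<M. \<Sum>u<b. F u p * G b p)" for p
  proof -
    have "(\<Sum>b<M. \<Sum>u<b. F u p * G b p) = (\<Sum>u<M. F u p * ((\<Sum>b<M. G b p) - (\<Sum>b\<le>u. G b p)))"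
      unfolding sum_above_commute sum_distrib_left[symmetric] by (intro sum.cong) (auto simp: sum_above)
    then show ?thesis by (simp add: right_diff_distrib sum_subtractf sum_distrib_right)
  qed
  ultimately have "bd (2 * \<mu>) (\<lambda>p. (\<Sum>b<M. \<Sum>u<b. F u p * G b p)\<^sup>2)
      (2 * (\<nu> * X * (Y * real M) + \<nu> * (81000 * X * Y * real M)))" by simp
  then show ?thesis
  proof (rule bd_weaken)
    have "0 \<le> \<nu> * X * Y * real M" using L0 XY by simp
    then show "2 * (\<nu> * X * (Y * real M) + \<nu> * (81000 * X * Y * real M))
        \<le> 200000 * (256 * real \<mu>) * X * Y * real M"
      by (simp add: \<nu>_def)
  qed
qed

lemma block_sum_bd:
  fixes F :: "nat \<Rightarrow> nat \<Rightarrow> 'w \<Rightarrow> real" and X :: real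
  assumes kappa: "1 \<le> \<mu>" and X: "0 \<le> X"
    and haarF: "\<And>m u. m < M \<Longrightarrow> u < M \<Longrightarrow> haar_at j u (F m u)" and \<beta>: "\<beta> \<subseteq> {..<M}"
    and F: "bd (4 * \<mu>) (\<lambda>p. \<Sum>u<M. (\<Sum>m\<in>\<beta>. F m u p)\<^sup>2) (X * card \<beta>)"
  shows "bd (4 * \<mu>) (\<lambda>p. (\<Sum>m\<in>\<beta>. \<Sum>u<M. F m u p)\<^sup>2) (256 * real \<mu> * X * card \<beta>)"
proof -
  have "bd (2 * (2 * \<mu>)) (\<lambda>p. (\<Sum>u<M. \<Sum>m\<in>\<beta>. F m u p)\<^sup>2) (64 * real (2 * \<mu>) * (X * card \<beta>))"
    using kappa haarF F \<beta> by (intro littlewood_paley_single[where l=j] haar_at_sum) auto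
  then have "bd (2 * (2 * \<mu>)) (\<lambda>p. (\<Sum>u<M. \<Sum>m\<in>\<beta>. F m u p)\<^sup>2) (256 * real \<mu> * (X * card \<beta>))"
    by (rule bd_weaken) (use X in \<open>auto intro!: mult_right_mono\<close>)
  then show ?thesis by (subst sum.swap) (simp add: mult.assoc)
qed

text \<open>For fixed \<open>u\<close> and \<open>v\<close> let \<open>P\<close>, \<open>Q\<close>
  be the complete sums over \<open>a\<close>, \<open>b\<close>, and \<open>p\<close>,
  \<open>q\<close> the parts with \<open>a \<le> v\<close>, \<open>b \<le> u\<close>. Then \<open>(P
  - p) * (Q - q) = P * (Q - q) + Q * (P - p) - P * Q + p * q\<close>. The first two terms have one
  constraint, the third has none. In \<open>p * q\<close> both constraints fail, so that it is a
  Haar function of level \<open>v\<close> in coordinate \<open>i\<close> and of level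
  \<open>u\<close> in coordinate \<open>j\<close>, and Littlewood-Paley in both reduces it to
  \<open>chaining\<close>.\<close>

lemma two_sided_sum:
  fixes F G :: "nat \<Rightarrow> nat \<Rightarrow> 'w \<Rightarrow> real" and X Y :: real
  assumes kappa: "1 \<le> \<mu>" and XY: "0 \<le> X" "0 \<le> Y" and M: "1 \<le> M"
    and haarF: "\<And>m u. m < M \<Longrightarrow> u < M \<Longrightarrow> haar_at j u (F m u)"
    and flatF: "\<And>m u. m < M \<Longrightarrow> u < M \<Longrightarrow> flat_at i m (F m u)"
    and haarG: "\<And>w v. w < M \<Longrightarrow> v < M \<Longrightarrow> haar_at i v (G w v)"
    and flatG: "\<And>w v. w < M \<Longrightarrow> v < M \<Longrightarrow> flat_at j w (G w v)"
    and F: "\<And>\<beta>. \<beta> \<subseteq> {..<M} \<Longrightarrow>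
      bd (4 * \<mu>) (\<lambda>p. \<Sum>u<M. (\<Sum>m\<in>\<beta>. F m u p)\<^sup>2) (X * card \<beta>)"
    and G: "\<And>\<beta>. \<beta> \<subseteq> {..<M} \<Longrightarrow>
      bd (4 * \<mu>) (\<lambda>p. \<Sum>v<M. (\<Sum>w\<in>\<beta>. G w v p)\<^sup>2) (Y * card \<beta>)"
  shows "bd (2 * \<mu>) (\<lambda>p. (\<Sum>a<M. \<Sum>b<M. \<Sum>u<b. \<Sum>v<a. F a u p * G b v p)\<^sup>2)
    (2000000 * (256 * real \<mu>)\<^sup>2 * X * Y * (real M)\<^sup>2)"
proof -
  define \<nu> where "\<nu> = 256 * real \<mu>"
  have L: "1 \<le> \<nu>" using kappa by (simp add: \<nu>_def)
  have LF: "bd (4 * \<mu>) (\<lambda>p. (\<Sum>m\<in>\<beta>. \<Sum>u<M. F m u p)\<^sup>2) (\<nu> * X * card \<beta>)"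
    and LG: "bd (4 * \<mu>) (\<lambda>p. (\<Sum>w\<in>\<beta>. \<Sum>v<M. G w v p)\<^sup>2) (\<nu> * Y * card \<beta>)"
    if \<beta>: "\<beta> \<subseteq> {..<M}" for \<beta>
  proof -
    show "bd (4 * \<mu>) (\<lambda>p. (\<Sum>m\<in>\<beta>. \<Sum>u<M. F m u p)\<^sup>2) (\<nu> * X * card \<beta>)"
      unfolding \<nu>_def by (rule block_sum_bd[OF kappa XY(1) _ \<beta> F[OF \<beta>]]) (rule haarF)
    show "bd (4 * \<mu>) (\<lambda>p. (\<Sum>w\<in>\<beta>. \<Sum>v<M. G w v p)\<^sup>2) (\<nu> * Y * card \<beta>)"
      unfolding \<nu>_def by (rule block_sum_bd[OF kappa XY(2) _ \<beta> G[OF \<beta>]]) (rule haarG)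
  qed
  define z where "z = \<nu>\<^sup>2 * X * Y * (real M)\<^sup>2"
  define S1 where "S1 p = (\<Sum>b<M. \<Sum>u<b. (\<Sum>a<M. F a u p) * (\<Sum>v<M. G b v p))" for p
  define S2 where "S2 p = (\<Sum>a<M. \<Sum>v<a. (\<Sum>b<M. G b v p) * (\<Sum>u<M. F a u p))" for p
  define S3 where "S3 p = (\<Sum>a<M. \<Sum>u<M. F a u p) * (\<Sum>b<M. \<Sum>v<M. G b v p)" for p
  define S4 where "S4 p = (\<Sum>u<M. \<Sum>v<M. (\<Sum>a\<le>v. F a u p) * (\<Sum>b\<le>u. G b v p))" for p
  have S1: "bd (2 * \<mu>) (\<lambda>p. (S1 p)\<^sup>2) (200000 * z)"
  proof -
    have "bd (2 * \<mu>) (\<lambda>p. (S1 p)\<^sup>2) (200000 * (256 * real \<mu>) * (X * M) * (\<nu> * Y) * real M)"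
      unfolding S1_def using XY L haarF flatG F[of "{..<M}"] LG
      by (intro one_sided_sum[OF kappa _ _ M, where j=j] haar_at_sum flat_at_sum) auto
    then show ?thesis by (simp add: z_def \<nu>_def power2_eq_square mult_ac)
  qed
  have S2: "bd (2 * \<mu>) (\<lambda>p. (S2 p)\<^sup>2) (200000 * z)"
  proof -
    have "bd (2 * \<mu>) (\<lambda>p. (S2 p)\<^sup>2) (200000 * (256 * real \<mu>) * (Y * M) * (\<nu> * X) * real M)"
      unfolding S2_def using XY L haarG flatF G[of "{..<M}"] LF
      by (intro one_sided_sum[OF kappa _ _ M, where j=i] haar_at_sum flat_at_sum) auto
    then show ?thesis by (simp add: z_def \<nu>_def power2_eq_square mult_ac)
  qed
  have S3: "bd (2 * \<mu>) (\<lambda>p. (S3 p)\<^sup>2) z"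
  proof -
    have "bd (2 * \<mu>) (\<lambda>p. (S3 p)\<^sup>2) ((\<nu> * X * M) * (\<nu> * Y * M))"
      unfolding S3_def using LF[of "{..<M}"] LG[of "{..<M}"] by (intro bd_sq_mult) simp_all
    then show ?thesis by (simp add: z_def power2_eq_square mult_ac)
  qed
  have S4: "bd (2 * \<mu>) (\<lambda>p. (S4 p)\<^sup>2) (81000 * z)"
  proof -
    let ?Z = "\<lambda>u v p. (\<Sum>a\<le>v. F a u p) * (\<Sum>b\<le>u. G b v p)"
    have Zi: "haar_at i v (?Z u v)" if "u < M" "v < M" for u v
      using that haarG flat_at_le[OF flatF] by (intro flat_at_mult_haar flat_at_sum haar_at_sum) auto
    have Zj: "haar_at j u (?Z u v)" if "u < M" "v < M" for u v
      using that haarF flat_at_le[OF flatG] by (intro haar_at_mult_flat flat_at_sum haar_at_sum) auto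
    have "bd (2 * \<mu>) (\<lambda>p. \<Sum>u<M. \<Sum>v<M. (?Z u v p)\<^sup>2) (81000 * X * Y * (real M)\<^sup>2)"
      unfolding power_mult_distrib by (rule chaining[OF kappa XY M F G])
    then have "bd (2 * \<mu>) (\<lambda>p. \<Sum>u<M. (\<Sum>v<M. ?Z u v p)\<^sup>2) (64 * real \<mu> * (81000 * X * Y * (real M)\<^sup>2))"
      using kappa Zi by (intro littlewood_paley[where l=i]) auto
    then have "bd (2 * \<mu>) (\<lambda>p. (\<Sum>u<M. \<Sum>v<M. ?Z u v p)\<^sup>2) (64 * real \<mu> * (64 * real \<mu> * (81000 * X * Y * (real M)\<^sup>2)))"
      using kappa Zj by (intro littlewood_paley_single[where l=j] haar_at_sum) auto
    then show ?thesis unfolding S4_def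
    proof (rule bd_weaken)
      have "(64 * real \<mu>) * (64 * real \<mu>) \<le> \<nu> * \<nu>" by (intro mult_mono) (auto simp: \<nu>_def)
      then have "(64 * real \<mu>) * (64 * real \<mu>) * (81000 * X * Y * (real M)\<^sup>2) \<le> \<nu> * \<nu> * (81000 * X * Y * (real M)\<^sup>2)"
        using XY by (intro mult_right_mono) auto
      then show "64 * real \<mu> * (64 * real \<mu> * (81000 * X * Y * (real M)\<^sup>2)) \<le> 81000 * z"
        by (simp add: z_def power2_eq_square mult_ac)
    qed
  qed
  have "bd (2 * \<mu>) (\<lambda>p. ((S1 p + S2 p) + (S4 p + - S3 p))\<^sup>2)
      (2 * (2 * (200000 * z + 200000 * z) + 2 * (81000 * z + z)))"
    using kappa S1 S2 S3 S4 by (intro bd_sq_add) simp_all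
  moreover have "(S1 p + S2 p) + (S4 p + - S3 p) = (\<Sum>a<M. \<Sum>b<M. \<Sum>u<b. \<Sum>v<a. F a u p * G b v p)" for p
  proof -
    let ?p = "\<lambda>u. \<Sum>a<M. F a u p" and ?q = "\<lambda>v. \<Sum>b<M. G b v p"
    let ?p' = "\<lambda>u v. \<Sum>a\<in>{v<..<M}. F a u p" and ?q' = "\<lambda>u v. \<Sum>b\<in>{u<..<M}. G b v p"
    have "S1 p = (\<Sum>u<M. ?p u * (\<Sum>b\<in>{u<..<M}. \<Sum>v<M. G b v p))"
      unfolding S1_def sum_above_commute sum_distrib_left ..
    also have "\<dots> = (\<Sum>u<M. \<Sum>v<M. ?p u * ?q' u v)"
      by (rule sum.cong[OF refl], subst sum.swap) (rule sum_distrib_left)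
    finally have e1: "S1 p = (\<Sum>u<M. \<Sum>v<M. ?p u * ?q' u v)" .
    have "S2 p = (\<Sum>v<M. ?q v * (\<Sum>a\<in>{v<..<M}. \<Sum>u<M. F a u p))"
      unfolding S2_def sum_above_commute sum_distrib_left ..
    also have "\<dots> = (\<Sum>v<M. \<Sum>u<M. ?q v * ?p' u v)"
      by (rule sum.cong[OF refl], subst sum.swap) (rule sum_distrib_left)
    also have "\<dots> = (\<Sum>u<M. \<Sum>v<M. ?q v * ?p' u v)" by (rule sum.swap)
    finally have e2: "S2 p = (\<Sum>u<M. \<Sum>v<M. ?q v * ?p' u v)" .
    have e3: "S3 p = (\<Sum>u<M. \<Sum>v<M. ?p u * ?q v)"
      unfolding S3_def sum_product[symmetric]
      by (intro arg_cong2[where f="(*)"] sum.swap)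
    show ?thesis
      unfolding sum_below_below e1 e2 e3 S4_def sum_negf[symmetric] sum.distrib[symmetric]
      by (intro sum.cong refl) (simp add: sum_above algebra_simps)
  qed
  ultimately have "bd (2 * \<mu>) (\<lambda>p. (\<Sum>a<M. \<Sum>b<M. \<Sum>u<b. \<Sum>v<a. F a u p * G b v p)\<^sup>2)
      (2 * (2 * (200000 * z + 200000 * z) + 2 * (81000 * z + z)))" by simp
  then show ?thesis
  proof (rule bd_weaken)
    have "0 \<le> z" using XY by (simp add: z_def)
    moreover have "2000000 * (256 * real \<mu>)\<^sup>2 * X * Y * (real M)\<^sup>2 = 2000000 * z"
      unfolding z_def \<nu>_def by (simp only: mult.assoc)
    ultimately show "2 * (2 * (200000 * z + 200000 * z) + 2 * (81000 * z + z))
        \<le> 2000000 * (256 * real \<mu>)\<^sup>2 * X * Y * (real M)\<^sup>2" by simp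
  qed
qed

text \<open>In the application \<open>e b v\<close> collects pairs with both levels equal to
  \<open>v\<close> in a coordinate, where such products have no Haar structure. So the sum over
  \<open>v\<close> is estimated by the triangle inequality; its loss of \<open>M ^ 2\<close> in the
  square is compensated by the smaller bound \<open>Y / M ^ 2\<close> for \<open>e\<close>.\<close>

lemma equal_level_sum:
  fixes F e :: "nat \<Rightarrow> nat \<Rightarrow> 'w \<Rightarrow> real" and X Y :: real
  assumes kappa: "1 \<le> \<mu>" and XY: "0 \<le> X" "0 \<le> Y" and M: "1 \<le> M"
    and haarF: "\<And>m u. haar_at j u (F m u)" and flat: "\<And>b v. flat_at j b (e b v)"
    and F: "\<And>\<beta>. \<beta> \<subseteq> {..<M} \<Longrightarrow>
      bd (4 * \<mu>) (\<lambda>p. \<Sum>u<M. (\<Sum>m\<in>\<beta>. F m u p)\<^sup>2) (X * card \<beta>)"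
    and e: "\<And>\<beta> v. \<beta> \<subseteq> {..<M} \<Longrightarrow> bd (4 * \<mu>) (\<lambda>p. (\<Sum>b\<in>\<beta>. e b v p)\<^sup>2) (Y / (real M)\<^sup>2 * card \<beta>)"
  shows "bd (2 * \<mu>) (\<lambda>p. (\<Sum>v<M. \<Sum>b<M. \<Sum>u<b. (\<Sum>a\<in>{v<..<M}. F a u p) * e b v p)\<^sup>2)
    (200000 * (256 * real \<mu>) * X * Y * (real M)\<^sup>2)"
proof -
  let ?z = "200000 * (256 * real \<mu>) * (X * real M) * (Y / (real M)\<^sup>2) * real M"
  have one: "bd (2 * \<mu>) (\<lambda>p. (\<Sum>b<M. \<Sum>u<b. (\<Sum>a\<in>{v<..<M}. F a u p) * e b v p)\<^sup>2) ?z" for v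
  proof (rule one_sided_sum[OF kappa _ _ M, where j = j])
    have "bd (4 * \<mu>) (\<lambda>p. \<Sum>u<M. (\<Sum>m\<in>{v<..<M}. F m u p)\<^sup>2) (X * real (card {v<..<M}))"
      by (rule F) auto
    then show "bd (4 * \<mu>) (\<lambda>p. \<Sum>u<M. (\<Sum>m\<in>{v<..<M}. F m u p)\<^sup>2) (X * real M)"
      by (rule bd_weaken) (use XY in \<open>auto intro!: mult_left_mono\<close>)
    show "bd (4 * \<mu>) (\<lambda>p. (\<Sum>b\<in>\<beta>. e b v p)\<^sup>2) (Y / (real M)\<^sup>2 * card \<beta>)" if "\<beta> \<subseteq> {..<M}" for \<beta>
      by (rule e[OF that])
  qed (use XY in \<open>auto intro!: haar_at_sum haarF flat\<close>)
  have "bd (2 * \<mu>) (\<lambda>p. \<Sum>n\<in>{()}. (\<Sum>v<M. \<Sum>b<M. \<Sum>u<b. (\<Sum>a\<in>{v<..<M}. F a u p) * e b v p)\<^sup>2)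
      ((real (card {..<M}))\<^sup>2 * ?z)"
    using kappa one XY by (intro bd_sq_sum) auto
  moreover have "(real (card {..<M}))\<^sup>2 * ?z = 200000 * (256 * real \<mu>) * X * Y * (real M)\<^sup>2"
    using M by (simp add: power2_eq_square)
  ultimately show ?thesis by simp
qed

end

section \<open>Square functions of sums over pairs\<close>

context flip_space
begin

text \<open>The square function in the coordinates of \<open>L\<close>, squared to avoid the root;
  over the other coordinates the sum is taken inside the square.\<close>

definition sq_fun ::
  "nat \<Rightarrow> nat set \<Rightarrow> ('i \<Rightarrow> nat \<Rightarrow> nat) \<Rightarrow> ('i \<Rightarrow> 'w \<Rightarrow> real) \<Rightarrow> 'i set \<Rightarrow> 'w \<Rightarrow> real" where
  "sq_fun M L lev \<phi> P p =
     (\<Sum>m\<in>L \<rightarrow>\<^sub>E {..<M}. (\<Sum>\<pi>\<in>{\<pi>\<in>P. \<forall>l\<in>L. lev \<pi> l = m l}. \<phi> \<pi> p)\<^sup>2)"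

lemma sum_PiE_insert:
  fixes g :: "(nat \<Rightarrow> nat) \<Rightarrow> real"
  assumes "l \<notin> L"
  shows "(\<Sum>m\<in>insert l L \<rightarrow>\<^sub>E S. g m) = (\<Sum>m\<in>L \<rightarrow>\<^sub>E S. \<Sum>a\<in>S. g (m(l := a)))"
proof -
  have "inj_on (\<lambda>(a, m). m(l := a)) (S \<times> (L \<rightarrow>\<^sub>E S))"
    using inj_combinator[OF assms, of "\<lambda>_. S"] .
  then have "(\<Sum>m\<in>insert l L \<rightarrow>\<^sub>E S. g m) = (\<Sum>(a, m)\<in>S \<times> (L \<rightarrow>\<^sub>E S). g (m(l := a)))"
    by (subst PiE_insert_eq, subst sum.reindex) (simp_all add: case_prod_unfold)
  then show ?thesis by (simp add: sum.cartesian_product[symmetric] sum.swap[of _ S])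
qed

lemma sq_fun_empty: "sq_fun M {} lev \<phi> P p = (\<Sum>\<pi>\<in>P. \<phi> \<pi> p)\<^sup>2"
  by (simp add: sq_fun_def)

lemma sq_fun_insert:
  assumes "l \<notin> L"
  shows "sq_fun M (insert l L) lev \<phi> P p =
    (\<Sum>m\<in>L \<rightarrow>\<^sub>E {..<M}. \<Sum>a<M. (\<Sum>\<pi>\<in>{\<pi>\<in>P. (\<forall>l\<in>L. lev \<pi> l = m l) \<and> lev \<pi> l = a}. \<phi> \<pi> p)\<^sup>2)"
proof -
  have "{\<pi>\<in>P. \<forall>l'\<in>insert l L. lev \<pi> l' = (m(l := a)) l'} = {\<pi>\<in>P. (\<forall>l\<in>L. lev \<pi> l = m l) \<and> lev \<pi> l = a}" for m a
    using assms by auto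
  then show ?thesis unfolding sq_fun_def sum_PiE_insert[OF assms] by (simp only:)
qed

lemma sq_fun_nonneg: "0 \<le> sq_fun M L lev \<phi> P p"
  by (simp add: sq_fun_def sum_nonneg)

text \<open>The coordinates of \<open>U\<close> are removed one at a time. The level assignments in
  the remaining ones index the l^2-valued family, so the constant enters once per
  coordinate.\<close>

lemma littlewood_paley_levels:
  assumes k: "1 \<le> k" and fin: "finite U" "finite T" "finite P" and disj: "U \<inter> T = {}"
    and lev: "\<And>\<pi> l. \<pi> \<in> P \<Longrightarrow> l \<in> U \<Longrightarrow> lev \<pi> l < M \<and> haar_at l (lev \<pi> l) (\<phi> \<pi>)"
    and t: "bd (2 * k) (sq_fun M (U \<union> T) lev \<phi> P) t"
  shows "bd (2 * k) (sq_fun M T lev \<phi> P) ((64 * real k) ^ card U * t)"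
  using fin(1) disj lev t
proof (induction U arbitrary: t rule: finite_induct)
  case (insert l U)
  let ?Z = "\<lambda>m a p. \<Sum>\<pi>\<in>{\<pi>\<in>P. (\<forall>l\<in>U \<union> T. lev \<pi> l = m l) \<and> lev \<pi> l = a}. \<phi> \<pi> p"
  have l: "l \<notin> U \<union> T" using insert.hyps insert.prems by auto
  have "bd (2 * k) (\<lambda>p. \<Sum>m\<in>U \<union> T \<rightarrow>\<^sub>E {..<M}. \<Sum>a<M. (?Z m a p)\<^sup>2) t"
    using insert.prems(3) sq_fun_insert[OF l, of M lev \<phi> P] by (simp add: fun_eq_iff[symmetric])
  note increments = this
  have "bd (2 * k) (\<lambda>p. \<Sum>m\<in>U \<union> T \<rightarrow>\<^sub>E {..<M}. (\<Sum>a<M. ?Z m a p)\<^sup>2) (64 * real k * t)"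
  proof (rule littlewood_paley[OF k _ _ increments])
    show "finite (U \<union> T \<rightarrow>\<^sub>E {..<M})" using insert.hyps fin by (intro finite_PiE) auto
    show "haar_at l a (?Z m a)" for m a
      using insert.prems(2) by (intro haar_at_sum) auto
  qed
  moreover have "(\<Sum>a<M. ?Z m a p) = (\<Sum>\<pi>\<in>{\<pi>\<in>P. \<forall>l\<in>U \<union> T. lev \<pi> l = m l}. \<phi> \<pi> p)" for m p
  proof -
    have "(\<Sum>a<M. \<Sum>\<pi>\<in>{\<pi>\<in>{\<pi>\<in>P. \<forall>l\<in>U \<union> T. lev \<pi> l = m l}. lev \<pi> l = a}. \<phi> \<pi> p)
        = (\<Sum>\<pi>\<in>{\<pi>\<in>P. \<forall>l\<in>U \<union> T. lev \<pi> l = m l}. \<phi> \<pi> p)"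
      using fin insert.prems(2) by (intro sum.group) auto
    then show ?thesis by (simp add: conj_assoc)
  qed
  ultimately have "bd (2 * k) (sq_fun M (U \<union> T) lev \<phi> P) (64 * real k * t)"
    by (simp add: sq_fun_def[abs_def])
  then have "bd (2 * k) (sq_fun M T lev \<phi> P) ((64 * real k) ^ card U * (64 * real k * t))"
    using insert.prems by (intro insert.IH) auto
  then show ?case using insert.hyps by (simp add: mult_ac)
qed simp

end

section \<open>Pairs of exponent vectors and the bounds carried through the induction\<close>

definition agree_on :: "(nat \<Rightarrow> nat) set \<Rightarrow> nat set \<Rightarrow> bool" where
  "agree_on R Z \<longleftrightarrow> (\<forall>r\<in>R. \<forall>s\<in>R. \<forall>z\<in>Z. r z = s z)"

lemma agree_on_subset: "agree_on R Z \<Longrightarrow> R' \<subseteq> R \<Longrightarrow> Z' \<subseteq> Z \<Longrightarrow> agree_on R' Z'"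
  unfolding agree_on_def by blast

lemma agree_on_restrict:
  assumes "agree_on R Z" "Z' \<subseteq> Z \<union> E"
  shows "agree_on {r\<in>R. restrict r E = e} Z'"
  unfolding agree_on_def
proof (intro ballI)
  fix r s z assume a: "r \<in> {r\<in>R. restrict r E = e}" "s \<in> {r\<in>R. restrict r E = e}" "z \<in> Z'"
  show "r z = s z"
  proof (cases "z \<in> E")
    case True
    have "restrict r E z = restrict s E z" using a by simp
    with True show ?thesis by simp
  qed (use a assms in \<open>auto simp: agree_on_def\<close>)
qed

definition max_lev :: "(nat \<Rightarrow> nat) \<times> (nat \<Rightarrow> nat) \<Rightarrow> nat \<Rightarrow> nat" where
  "max_lev = (\<lambda>(r, s) l. max (r l) (s l))"

definition pattern_pairs ::
  "nat \<Rightarrow> (nat \<Rightarrow> nat) set \<Rightarrow> (nat \<Rightarrow> nat) set \<Rightarrow> nat set \<Rightarrow> nat set \<Rightarrow> ((nat \<Rightarrow> nat) \<times> (nat \<Rightarrow> nat)) set" where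
  "pattern_pairs k R S A B = {(r, s). r \<in> R \<and> s \<in> S \<and> r k = s k \<and> (\<forall>l\<in>A. s l < r l) \<and> (\<forall>l\<in>B. r l < s l)}"

text \<open>\<open>T\<close> is meant for the coordinates whose levels a square function keeps
  apart. There the product has to be a Haar function, hence the levels must differ.\<close>

definition distinct_pairs ::
  "nat \<Rightarrow> (nat \<Rightarrow> nat) set \<Rightarrow> (nat \<Rightarrow> nat) set \<Rightarrow> nat set \<Rightarrow> nat set \<Rightarrow> ((nat \<Rightarrow> nat) \<times> (nat \<Rightarrow> nat)) set" where
  "distinct_pairs k R S L T =
     {(r, s). r \<in> R \<and> s \<in> S \<and> r k = s k \<and> (\<exists>l\<in>L. r l \<noteq> s l) \<and> (\<forall>l\<in>T. r l \<noteq> s l)}"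

text \<open>The condition \<open>\<Sum>j. r j = n\<close> enters only through \<open>determined\<close>: a vector is known once all but one
  of its coordinates are.\<close>

locale haar_family = flip_space Om flip
  for Om :: "'w set" and flip :: "nat \<Rightarrow> nat \<Rightarrow> 'w \<Rightarrow> 'w" +
  fixes V :: "nat set" and X :: "(nat \<Rightarrow> nat) set" and M \<mu> :: nat
    and f :: "(nat \<Rightarrow> nat) \<Rightarrow> 'w \<Rightarrow> real"
  assumes finite_V: "finite V" and finite_X: "finite X" and M_pos: "1 \<le> M" and kappa_pos: "1 \<le> \<mu>"
    and level_less: "\<And>r l. r \<in> X \<Longrightarrow> l \<in> V \<Longrightarrow> r l < M"
    and determined: "\<And>r s l. r \<in> X \<Longrightarrow> s \<in> X \<Longrightarrow> l \<in> V \<Longrightarrow> (\<And>j. j \<in> V - {l} \<Longrightarrow> r j = s j) \<Longrightarrow> r = s"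
    and bounded: "\<And>r p. r \<in> X \<Longrightarrow> p \<in> Om \<Longrightarrow> \<bar>f r p\<bar> \<le> 1"
    and haar_f: "\<And>r l. r \<in> X \<Longrightarrow> l \<in> V \<Longrightarrow> haar_at l (r l) (f r)"
begin

abbreviation levels :: "nat set \<Rightarrow> (nat \<Rightarrow> nat) set" where
  "levels L \<equiv> L \<rightarrow>\<^sub>E {..<M}"

text \<open>Littlewood-Paley for squares costs \<open>64 * k\<close> in order \<open>2 * k\<close>.
  This is the cost for \<open>k = 4 * \<mu>\<close>, the largest case that occurs, and it dominates
  the cost in the orders \<open>2 * \<mu>\<close> and \<open>4 * \<mu>\<close>.\<close>

abbreviation \<nu> :: real where "\<nu> \<equiv> 256 * real \<mu>"

definition ff :: "(nat \<Rightarrow> nat) \<times> (nat \<Rightarrow> nat) \<Rightarrow> 'w \<Rightarrow> real" where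
  "ff = (\<lambda>(r, s) p. f r p * f s p)"

lemma Lambda_ge: "1 \<le> \<nu>"
  using kappa_pos by simp

lemma finite_sub: "R \<subseteq> X \<Longrightarrow> finite R"
  using finite_X finite_subset by blast

lemma haar_ff:
  assumes "r \<in> X" "s \<in> X" "l \<in> V" "r l \<noteq> s l"
  shows "haar_at l (max_lev (r, s) l) (ff (r, s))"
  using haar_at_mult_max[OF haar_f[of r l] haar_f[of s l]] assms by (simp add: max_lev_def ff_def)

lemma flat_ff:
  assumes "r \<in> X" "s \<in> X" "l \<in> V" "r l = s l"
  shows "flat_at l (r l) (ff (r, s))"
  using haar_at_mult_haar[of l "r l" "f r" "f s"] haar_f[of r l] haar_f[of s l] assms by (simp add: ff_def)

lemma finite_pattern_pairs: "R \<subseteq> X \<Longrightarrow> S \<subseteq> X \<Longrightarrow> finite (pattern_pairs k R S A B)"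
  by (rule finite_subset[of _ "X \<times> X"]) (auto simp: pattern_pairs_def finite_X)

lemma finite_distinct_pairs: "R \<subseteq> X \<Longrightarrow> S \<subseteq> X \<Longrightarrow> finite (distinct_pairs k R S L T)"
  by (rule finite_subset[of _ "X \<times> X"]) (auto simp: distinct_pairs_def finite_X)

lemma card_PiE_levels: "finite L \<Longrightarrow> card (levels L) = M ^ card L"
  by (simp add: card_PiE)

text \<open>Littlewood-Paley is used in all coordinates of \<open>L\<close> but one. By
  \<open>determined\<close> prescribed levels in these leave at most one vector, so each square is
  at most 1 and only their number counts.\<close>

lemma hyperbolic_sum_bd:
  assumes j: "1 \<le> j" and R: "R \<subseteq> X" and L: "L \<subseteq> V" "L \<noteq> {}" and agree: "agree_on R (V - L)"
  shows "bd (2 * j) (\<lambda>p. (\<Sum>r\<in>R. f r p)\<^sup>2) ((64 * real j * real M) ^ (card L - 1))"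
proof -
  obtain l0 where l0: "l0 \<in> L" using L by blast
  have finL: "finite L" using L finite_V finite_subset by blast
  have "bd (2 * j) (sq_fun M (L - {l0} \<union> {}) (\<lambda>r. r) f R) (real M ^ (card L - 1))"
  proof (rule bd_const)
    fix p assume p: "p \<in> Om"
    have one: "(\<Sum>r\<in>{r\<in>R. \<forall>l\<in>L - {l0}. r l = m l}. f r p)\<^sup>2 \<le> 1" for m
    proof (cases "{r\<in>R. \<forall>l\<in>L - {l0}. r l = m l} = {}")
      case False
      then obtain r where r: "r \<in> R" "\<forall>l\<in>L - {l0}. r l = m l" by blast
      have "s = r" if s: "s \<in> R" "\<forall>l\<in>L - {l0}. s l = m l" for s
      proof (rule determined[of s r l0])
        fix z assume "z \<in> V - {l0}"
        then show "s z = r z" using r s agree by (cases "z \<in> L") (auto simp: agree_on_def)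
      qed (use r s R L l0 in auto)
      then have "{r\<in>R. \<forall>l\<in>L - {l0}. r l = m l} = {r}" using r by blast
      then show ?thesis using bounded[of r p] r R p by (simp add: abs_square_le_1 subsetD)
    qed (simp only: sum.empty, simp)
    have "sq_fun M (L - {l0} \<union> {}) (\<lambda>r. r) f R p \<le> (\<Sum>m\<in>levels (L - {l0}). 1)"
      unfolding sq_fun_def Un_empty_right by (intro sum_mono one)
    also have "\<dots> = real M ^ (card L - 1)" using finL l0 by (simp add: card_PiE_levels)
    finally show "\<bar>sq_fun M (L - {l0} \<union> {}) (\<lambda>r. r) f R p\<bar> \<le> real M ^ (card L - 1)"
      by (simp add: sq_fun_nonneg)
  qed simp
  then have "bd (2 * j) (sq_fun M {} (\<lambda>r. r) f R) ((64 * real j) ^ card (L - {l0}) * real M ^ (card L - 1))"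
    using j finL R L level_less haar_f by (intro littlewood_paley_levels finite_sub) (auto simp: subset_iff)
  then show ?thesis
    using finL l0 by (simp add: sq_fun_empty[abs_def] power_mult_distrib)
qed

text \<open>Coordinates outside \<open>L \<union> {k}\<close> are frozen (possibly at different values in \<open>R\<close> and \<open>S\<close>), \<open>k\<close> is the
  coordinate of the coincidence, and the gain in the sum over its values is measured by \<open>card J\<close>.\<close>

definition admissible ::
  "nat set \<Rightarrow> nat \<Rightarrow> (nat \<Rightarrow> nat) set \<Rightarrow> (nat \<Rightarrow> nat) set \<Rightarrow> nat set \<Rightarrow> bool" where
  "admissible L k R S J \<longleftrightarrow> L \<subseteq> V \<and> k \<in> V - L \<and> R \<subseteq> X \<and> S \<subseteq> X \<and>
     agree_on R (V - L - {k}) \<and> agree_on S (V - L - {k}) \<and> J \<subseteq> {..<M} \<and> (\<forall>r\<in>R \<union> S. r k \<in> J)"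

text \<open>\<open>card J * M ^ (2 * D - 2)\<close> bounds the number of pairs: by
  \<open>determined\<close> there are at most \<open>card J * M ^ (D - 1)\<close> vectors
  \<open>r\<close>, and for each at most \<open>M ^ (D - 1)\<close> vectors \<open>s\<close> with
  the same entry at \<open>k\<close>.\<close>

definition pattern_bound :: "nat \<Rightarrow> real \<Rightarrow> bool" where
  "pattern_bound D C \<longleftrightarrow> (\<forall>A B k R S J. A \<inter> B = {} \<longrightarrow> admissible (A \<union> B) k R S J \<longrightarrow> card (A \<union> B) = D \<longrightarrow>
     bd (4 * \<mu>) (sq_fun M (A \<union> B) max_lev ff (pattern_pairs k R S A B))
       (C * \<nu> ^ (D - 1) * real (card J) * real M ^ (2 * D - 2)))"

text \<open>The exponent of \<open>\<nu>\<close> exceeds that in \<open>pattern_bound\<close> by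
  \<open>D - card T\<close>: one factor for each coordinate outside \<open>T\<close>, over which the
  sum is no longer taken in the square function.\<close>

definition distinct_bound :: "nat \<Rightarrow> real \<Rightarrow> bool" where
  "distinct_bound D C \<longleftrightarrow> (\<forall>L k R S J T. admissible L k R S J \<longrightarrow> card L = D \<longrightarrow> T \<subseteq> L \<longrightarrow>
     bd (4 * \<mu>) (sq_fun M T max_lev ff (distinct_pairs k R S L T))
       (C * \<nu> ^ (2 * D - 1 - card T) * real (card J) * real M ^ (2 * D - 2)))"

lemmas pattern_boundD = pattern_bound_def[THEN iffD1, rule_format]
lemmas distinct_boundD = distinct_bound_def[THEN iffD1, rule_format]

text \<open>Pairs are sorted by the sets \<open>A\<close> and \<open>B\<close> on which
  \<open>r\<close> or \<open>s\<close> is larger and by their common values \<open>e\<close> on the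
  rest of \<open>L\<close>. There are at most \<open>4 ^ D\<close> choices of the sets, and the
  square of this number is the new constant. The triangle inequality over \<open>e\<close> costs
  \<open>M ^ (2 * (D - D'))\<close> in the square, which is exactly the quotient of the powers of
  \<open>M\<close> in the bounds for \<open>D\<close> and \<open>D'\<close>.\<close>

lemma distinct_bound_if_pattern_bound:
  assumes D: "1 \<le> D" and C: "0 \<le> C" and pb: "\<And>D'. 1 \<le> D' \<Longrightarrow> D' \<le> D \<Longrightarrow> pattern_bound D' C"
  shows "distinct_bound D (16 ^ D * C)"
  unfolding distinct_bound_def
proof (intro allI impI)
  fix L k R S J T
  assume adm: "admissible L k R S J" and card_L: "card L = D" and T: "T \<subseteq> L"
  then have L: "L \<subseteq> V" and k: "k \<in> V - L" and R: "R \<subseteq> X" and S: "S \<subseteq> X"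
    and agree: "agree_on R (V - L - {k})" "agree_on S (V - L - {k})"
    by (simp_all add: admissible_def)
  have finL: "finite L" using L finite_V finite_subset by blast
  have finT: "finite T" using T finL finite_subset by blast
  define K where "K = {(A, B). A \<subseteq> L \<and> B \<subseteq> L \<and> A \<inter> B = {} \<and> A \<union> B \<noteq> {} \<and> T \<subseteq> A \<union> B}"
  define key where "key = (\<lambda>(r, s). ({l\<in>L. s l < r l}, {l\<in>L. r l < (s l :: nat)}))"
  define N where "N = distinct_pairs k R S L T"
  define Re where "Re E e = {r\<in>R. restrict r E = e}" for E :: "nat set" and e :: "nat \<Rightarrow> nat"
  define Se where "Se E e = {r\<in>S. restrict r E = e}" for E :: "nat set" and e :: "nat \<Rightarrow> nat"
  define E where "E A B = L - (A \<union> B)" for A B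
  define w where "w AB e m p = (\<Sum>\<pi>\<in>{\<pi>\<in>pattern_pairs k (Re (E (fst AB) (snd AB)) e) (Se (E (fst AB) (snd AB)) e) (fst AB) (snd AB).
      \<forall>l\<in>T. max_lev \<pi> l = m l}. ff \<pi> p)" for AB e m p
  define z where "z = C * \<nu> ^ (2 * D - 1 - card T) * real (card J) * real M ^ (2 * D - 2)"
  have z0: "0 \<le> z" using C by (simp add: z_def)
  have finN: "finite N" unfolding N_def using R S by (rule finite_distinct_pairs)
  have subK: "K \<subseteq> Pow L \<times> Pow L" by (auto simp: K_def)
  have finK: "finite K" using subK finL by (meson finite_Pow_iff finite_SigmaI finite_subset)
  have cardK: "card K \<le> 4 ^ D"
  proof -
    have "card K \<le> card (Pow L \<times> Pow L)" using subK finL by (intro card_mono) auto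
    also have "\<dots> = 2 ^ D * 2 ^ D" using finL card_L by (simp add: card_Pow)
    also have "\<dots> = (2 * 2) ^ D" by (rule power_mult_distrib[symmetric])
    finally show ?thesis by simp
  qed
  have split: "(\<Sum>\<pi>\<in>{\<pi>\<in>N. \<forall>l\<in>T. max_lev \<pi> l = m l}. ff \<pi> p)
      = (\<Sum>AB\<in>K. \<Sum>e\<in>levels (E (fst AB) (snd AB)). w AB e m p)" for m p
  proof -
    let ?N = "{\<pi>\<in>N. \<forall>l\<in>T. max_lev \<pi> l = m l}"
    have "(\<Sum>\<pi>\<in>?N. ff \<pi> p) = (\<Sum>AB\<in>K. \<Sum>\<pi>\<in>{\<pi>\<in>?N. key \<pi> = AB}. ff \<pi> p)"
    proof (rule sum.group[symmetric])
      show "key ` ?N \<subseteq> K"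
        using T by (auto simp: K_def key_def N_def distinct_pairs_def) (metis nat_neq_iff)+
    qed (use finN finK in auto)
    also have "\<dots> = (\<Sum>AB\<in>K. \<Sum>e\<in>levels (E (fst AB) (snd AB)). w AB e m p)"
    proof (intro sum.cong refl)
      fix AB assume AB: "AB \<in> K"
      obtain A B where [simp]: "AB = (A, B)" by (cases AB)
      have AB': "A \<subseteq> L" "B \<subseteq> L" "A \<inter> B = {}" "A \<union> B \<noteq> {}" "T \<subseteq> A \<union> B"
        using AB by (auto simp: K_def)
      let ?NAB = "{\<pi>\<in>?N. key \<pi> = AB}"
      have "(\<Sum>\<pi>\<in>?NAB. ff \<pi> p)
          = (\<Sum>e\<in>levels (E A B). \<Sum>\<pi>\<in>{\<pi>\<in>?NAB. restrict (fst \<pi>) (E A B) = e}. ff \<pi> p)"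
      proof (rule sum.group[symmetric])
        have "r l < M" if "r \<in> R" "l \<in> L" for r l using level_less[of r l] that R L by auto
        moreover have "fst \<pi> \<in> R" if "\<pi> \<in> ?NAB" for \<pi>
          using that by (auto simp: N_def distinct_pairs_def)
        ultimately show "(\<lambda>\<pi>. restrict (fst \<pi>) (E A B)) ` ?NAB \<subseteq> levels (E A B)"
          by (intro image_subsetI) (simp add: restrict_PiE Pi_iff E_def)
        show "finite (levels (E A B))" using finL by (intro finite_PiE) (auto simp: E_def)
      qed (use finN in auto)
      also have "\<dots> = (\<Sum>e\<in>levels (E A B). w AB e m p)"
      proof (intro sum.cong refl)
        fix e assume "e \<in> levels (E A B)"
        let ?L = "{\<pi>\<in>?NAB. restrict (fst \<pi>) (E A B) = e}"
        let ?Q = "{\<pi>\<in>pattern_pairs k (Re (E A B) e) (Se (E A B) e) A B. \<forall>l\<in>T. max_lev \<pi> l = m l}"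
        have "?L
            = ?Q"
        proof (intro set_eqI iffI)
          fix \<pi> assume a: "\<pi> \<in> ?L"
          obtain r s where [simp]: "\<pi> = (r, s)" by (cases \<pi>)
          have key: "A = {l\<in>L. s l < r l}" "B = {l\<in>L. r l < s l}" using a by (auto simp: key_def)
          have "s l = r l" if "l \<in> E A B" for l
            using that unfolding E_def key by (auto intro: antisym simp: not_less)
          then have "restrict s (E A B) = restrict r (E A B)" by (rule restrict_ext)
          then have "restrict s (E A B) = e" using a by simp
          then show "\<pi> \<in> ?Q"
            using a key by (auto simp: pattern_pairs_def Re_def Se_def N_def distinct_pairs_def)
        next
          fix \<pi> assume a: "\<pi> \<in> ?Q"
          obtain r s where [simp]: "\<pi> = (r, s)" by (cases \<pi>)
          have p: "r \<in> R" "s \<in> S" "r k = s k" "\<forall>l\<in>A. s l < r l" "\<forall>l\<in>B. r l < s l"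
            and re: "restrict r (E A B) = e" and se: "restrict s (E A B) = e"
            using a by (auto simp: pattern_pairs_def Re_def Se_def)
          have eq: "r l = s l" if "l \<in> E A B" for l
            using re se that by (metis restrict_apply')
          have mem: "(l \<in> A \<longleftrightarrow> s l < r l) \<and> (l \<in> B \<longleftrightarrow> r l < s l)" if "l \<in> L" for l
            using p(4,5) eq[of l] that AB'(3) by (cases "l \<in> A"; cases "l \<in> B") (auto simp: E_def not_less less_imp_le)
          have Aeq: "A = {l\<in>L. s l < r l}" and Beq: "B = {l\<in>L. r l < s l}" using mem AB'(1,2) by blast+
          have ne: "r l \<noteq> s l" if "l \<in> A \<union> B" for l using p that by force
          have "\<exists>l\<in>L. r l \<noteq> s l" "\<forall>l\<in>T. r l \<noteq> s l" using ne AB' by blast+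
          then have "\<pi> \<in> N" using p by (simp add: N_def distinct_pairs_def)
          moreover have "key \<pi> = AB" by (simp add: key_def Aeq[symmetric] Beq[symmetric])
          ultimately show "\<pi> \<in> ?L"
            using a re by simp
        qed
        then show "(\<Sum>\<pi>\<in>?L. ff \<pi> p) = w AB e m p"
          by (simp add: w_def)
      qed
      finally show "(\<Sum>\<pi>\<in>?NAB. ff \<pi> p) = (\<Sum>e\<in>levels (E (fst AB) (snd AB)). w AB e m p)" by simp
    qed
    finally show ?thesis .
  qed
  have piece: "bd (4 * \<mu>) (\<lambda>p. \<Sum>m\<in>levels T. (\<Sum>e\<in>levels (E (fst AB) (snd AB)). w AB e m p)\<^sup>2) z"
    if AB: "AB \<in> K" for AB
  proof -
    obtain A B where [simp]: "AB = (A, B)" by (cases AB)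
    have AB': "A \<subseteq> L" "B \<subseteq> L" "A \<inter> B = {}" "A \<union> B \<noteq> {}" "T \<subseteq> A \<union> B"
      using AB by (auto simp: K_def)
    define D' where "D' = card (A \<union> B)"
    have finAB: "finite (A \<union> B)" using AB' finL finite_subset by blast
    have D': "1 \<le> D'" "D' \<le> D" "card T \<le> D'"
      using AB' finAB finL card_L by (auto simp: D'_def Suc_le_eq card_gt_0_iff intro!: card_mono)
    have cardE: "card (levels (E A B)) = M ^ (D - D')"
    proof -
      have "card (E A B) = D - D'"
        unfolding E_def D'_def using AB' card_L by (subst card_Diff_subset[OF finAB]) auto
      then show ?thesis using finL by (subst card_PiE_levels) (auto simp: E_def)
    qed
    let ?z = "C * \<nu> ^ (2 * D' - 1 - card T) * real (card J) * real M ^ (2 * D' - 2)"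
    have one: "bd (4 * \<mu>) (\<lambda>p. \<Sum>m\<in>levels T. (w AB e m p)\<^sup>2)
        ?z" for e
    proof -
      let ?P = "pattern_pairs k (Re (E A B) e) (Se (E A B) e) A B"
      let ?y = "C * \<nu> ^ (D' - 1) * real (card J) * real M ^ (2 * D' - 2)"
      have sub: "Re (E A B) e \<subseteq> R" "Se (E A B) e \<subseteq> S" by (auto simp: Re_def Se_def)
      have adm': "admissible (A \<union> B) k (Re (E A B) e) (Se (E A B) e) J"
        using adm sub AB' unfolding admissible_def Re_def Se_def
        by (intro conjI agree_on_restrict[OF agree(1)] agree_on_restrict[OF agree(2)]) (auto simp: E_def)
      have "bd (4 * \<mu>) (sq_fun M (A \<union> B) max_lev ff ?P)
          ?y"
        by (rule pattern_boundD[OF pb[OF D'(1,2)] AB'(3) adm']) (simp add: D'_def)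
      then have "bd (2 * (2 * \<mu>)) (sq_fun M (A \<union> B - T \<union> T) max_lev ff ?P)
          ?y"
        using AB' by (simp add: Un_absorb2)
      then have "bd (2 * (2 * \<mu>)) (sq_fun M T max_lev ff ?P)
          ((64 * real (2 * \<mu>)) ^ card (A \<union> B - T) * ?y)"
      proof (intro littlewood_paley_levels)
        show "finite ?P" using sub R S by (intro finite_pattern_pairs) auto
        fix \<pi> l assume \<pi>: "\<pi> \<in> ?P" and l: "l \<in> A \<union> B - T"
        obtain r s where [simp]: "\<pi> = (r, s)" by (cases \<pi>)
        have rs: "r \<in> X" "s \<in> X" "l \<in> V" "r l \<noteq> s l"
          using \<pi> l sub R S AB' L by (auto simp: pattern_pairs_def)
        then show "max_lev \<pi> l < M \<and> haar_at l (max_lev \<pi> l) (ff \<pi>)"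
          using haar_ff[OF rs] level_less by (simp add: max_lev_def)
      qed (use kappa_pos finAB finT in auto)
      moreover have "2 * (2 * \<mu>) = 4 * \<mu>" by simp
      ultimately have "bd (4 * \<mu>) (sq_fun M T max_lev ff ?P)
          ((64 * real (2 * \<mu>)) ^ card (A \<union> B - T) * ?y)"
        by (simp only:)
      then have "bd (4 * \<mu>) (sq_fun M T max_lev ff ?P)
          ?z"
      proof (rule bd_weaken)
        have cd: "card (A \<union> B - T) = D' - card T"
          using AB' finT by (simp add: card_Diff_subset D'_def)
        have "(64 * real (2 * \<mu>)) ^ card (A \<union> B - T) * \<nu> ^ (D' - 1) \<le> \<nu> ^ (D' - card T) * \<nu> ^ (D' - 1)"
          unfolding cd by (intro mult_right_mono power_mono) auto
        also have "\<dots> = \<nu> ^ (D' - card T + (D' - 1))" by (rule power_add[symmetric])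
        also have "D' - card T + (D' - 1) = 2 * D' - 1 - card T" using D' by simp
        finally have "(64 * real (2 * \<mu>)) ^ card (A \<union> B - T) * \<nu> ^ (D' - 1) * (C * real (card J) * real M ^ (2 * D' - 2))
            \<le> \<nu> ^ (2 * D' - 1 - card T) * (C * real (card J) * real M ^ (2 * D' - 2))"
          using C by (intro mult_right_mono) auto
        then show "(64 * real (2 * \<mu>)) ^ card (A \<union> B - T) * ?y
          \<le> ?z"
          by (simp only: mult_ac)
      qed
      then show ?thesis by (simp add: sq_fun_def[abs_def] w_def)
    qed
    have "bd (4 * \<mu>) (\<lambda>p. \<Sum>m\<in>levels T. (\<Sum>e\<in>levels (E A B). w AB e m p)\<^sup>2)
        ((real (card (levels (E A B))))\<^sup>2 * ?z)"
      using kappa_pos finL C by (intro bd_sq_sum one finite_PiE) (auto simp: E_def)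
    moreover have "(real (card (levels (E A B))))\<^sup>2 * ?z \<le> z"
    proof -
      have "(real (card (levels (E A B))))\<^sup>2 * real M ^ (2 * D' - 2) = real M ^ (2 * D - 2)"
      proof -
        have "(real (card (levels (E A B))))\<^sup>2 * real M ^ (2 * D' - 2) = real M ^ ((D - D') * 2 + (2 * D' - 2))"
          unfolding cardE by (simp add: power_add power_mult)
        also have "(D - D') * 2 + (2 * D' - 2) = 2 * D - 2" using D' by simp
        finally show ?thesis .
      qed
      then have "(real (card (levels (E A B))))\<^sup>2 * ?z
          = C * \<nu> ^ (2 * D' - 1 - card T) * real (card J) * real M ^ (2 * D - 2)"
        by (simp add: mult_ac)
      also have "\<dots> \<le> z"
        unfolding z_def using C Lambda_ge D' by (intro mult_right_mono mult_left_mono power_increasing) auto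
      finally show ?thesis .
    qed
    ultimately show ?thesis by (simp add: bd_weaken)
  qed
  have "bd (4 * \<mu>) (\<lambda>p. \<Sum>m\<in>levels T. (\<Sum>AB\<in>K. \<Sum>e\<in>levels (E (fst AB) (snd AB)). w AB e m p)\<^sup>2) ((real (card K))\<^sup>2 * z)"
    using kappa_pos by (intro bd_sq_sum finK piece z0) auto
  then have "bd (4 * \<mu>) (sq_fun M T max_lev ff N) ((real (card K))\<^sup>2 * z)"
    by (simp add: sq_fun_def[abs_def] split)
  moreover have "(real (card K))\<^sup>2 * z \<le> 16 ^ D * z"
  proof -
    have "real (card K) \<le> 4 ^ D" using cardK by (metis of_nat_le_iff of_nat_numeral of_nat_power)
    then have "(real (card K))\<^sup>2 \<le> (4 ^ D)\<^sup>2" by (intro power_mono) auto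
    also have "\<dots> = (4\<^sup>2) ^ D" by (simp only: power_mult[symmetric] mult.commute)
    finally show ?thesis using z0 by (simp add: mult_right_mono)
  qed
  ultimately have "bd (4 * \<mu>) (sq_fun M T max_lev ff N) (16 ^ D * z)" by (rule bd_weaken)
  then show "bd (4 * \<mu>) (sq_fun M T max_lev ff (distinct_pairs k R S L T))
       (16 ^ D * C * \<nu> ^ (2 * D - 1 - card T) * real (card J) * real M ^ (2 * D - 2))"
    by (simp add: N_def z_def mult.assoc)
qed

end

section \<open>Off-diagonal terms as products of sums with a new coincidence\<close>

context haar_family
begin

definition unequal_part ::
  "(nat \<Rightarrow> nat) set \<Rightarrow> (nat \<Rightarrow> nat) set \<Rightarrow> nat \<Rightarrow> nat \<Rightarrow> nat \<Rightarrow> nat \<Rightarrow> 'w \<Rightarrow> real" where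
  "unequal_part R S i j a u p =
     (\<Sum>\<pi>\<in>{(r, s). r \<in> R \<and> s \<in> S \<and> r i = a \<and> s i = a \<and> r j \<noteq> s j \<and> max (r j) (s j) = u}. ff \<pi> p)"

definition equal_part ::
  "(nat \<Rightarrow> nat) set \<Rightarrow> (nat \<Rightarrow> nat) set \<Rightarrow> nat \<Rightarrow> nat \<Rightarrow> nat \<Rightarrow> nat \<Rightarrow> 'w \<Rightarrow> real" where
  "equal_part R S i j a u p =
     (\<Sum>\<pi>\<in>{(r, s). r \<in> R \<and> s \<in> S \<and> r i = a \<and> s i = a \<and> r j = u \<and> s j = u}. ff \<pi> p)"

lemma finite_pairs: "R \<subseteq> X \<Longrightarrow> S \<subseteq> X \<Longrightarrow> finite {(r, s). r \<in> R \<and> s \<in> S \<and> P r s}"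
  by (rule finite_subset[of _ "X \<times> X"]) (auto simp: finite_X)

text \<open>The conditions \<open>r j < b\<close> and \<open>s j < b\<close> concern only the larger
  level \<open>u\<close>, so together they become one summation range. Pairs with different levels
  at \<open>j\<close> give Haar functions of level \<open>u\<close> there and those with equal
  levels do not, which is why the two parts are kept separate.\<close>

lemma slice_product:
  assumes R: "R \<subseteq> X" and S: "S \<subseteq> X"
  shows "(\<Sum>r\<in>{r\<in>R. r i = a \<and> r j < b}. f r p) * (\<Sum>s\<in>{s\<in>S. s i = a \<and> s j < b}. f s p)
    = (\<Sum>u<b. unequal_part R S i j a u p + equal_part R S i j a u p)"
proof -
  let ?P = "{r\<in>R. r i = a \<and> r j < b} \<times> {s\<in>S. s i = a \<and> s j < b}"
  have fin: "finite ?P" using finite_sub[OF R] finite_sub[OF S] by simp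
  have "(\<Sum>r\<in>{r\<in>R. r i = a \<and> r j < b}. f r p) * (\<Sum>s\<in>{s\<in>S. s i = a \<and> s j < b}. f s p)
      = (\<Sum>\<pi>\<in>?P. ff \<pi> p)"
    by (simp add: sum_product sum.cartesian_product ff_def case_prod_unfold)
  also have "\<dots> = (\<Sum>u<b. \<Sum>\<pi>\<in>{\<pi>\<in>?P. max (fst \<pi> j) (snd \<pi> j) = u}. ff \<pi> p)"
    using fin by (intro sum.group[symmetric]) auto
  also have "\<dots> = (\<Sum>u<b. unequal_part R S i j a u p + equal_part R S i j a u p)"
  proof (rule sum.cong[OF refl])
    fix u assume "u \<in> {..<b}"
    then have eq: "{\<pi>\<in>?P. max (fst \<pi> j) (snd \<pi> j) = u}
        = {(r, s). r \<in> R \<and> s \<in> S \<and> r i = a \<and> s i = a \<and> r j \<noteq> s j \<and> max (r j) (s j) = u}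
        \<union> {(r, s). r \<in> R \<and> s \<in> S \<and> r i = a \<and> s i = a \<and> r j = u \<and> s j = u}"
      by auto
    have fins: "finite {(r, s). r \<in> R \<and> s \<in> S \<and> r i = a \<and> s i = a \<and> r j \<noteq> s j \<and> max (r j) (s j) = u}"
      "finite {(r, s). r \<in> R \<and> s \<in> S \<and> r i = a \<and> s i = a \<and> r j = u \<and> s j = u}"
      by (rule finite_pairs[OF R S])+
    show "(\<Sum>\<pi>\<in>{\<pi>\<in>?P. max (fst \<pi> j) (snd \<pi> j) = u}. ff \<pi> p)
        = unequal_part R S i j a u p + equal_part R S i j a u p"
      unfolding unequal_part_def equal_part_def eq by (rule sum.union_disjoint[OF fins]) auto
  qed
  finally show ?thesis .
qed

lemma haar_unequal_part:
  assumes "R \<subseteq> X" "S \<subseteq> X" "j \<in> V"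
  shows "haar_at j u (unequal_part R S i j a u)"
  unfolding unequal_part_def
proof (rule haar_at_sum)
  fix \<pi> assume p: "\<pi> \<in> {(r, s). r \<in> R \<and> s \<in> S \<and> r i = a \<and> s i = a \<and> r j \<noteq> s j \<and> max (r j) (s j) = u}"
  then obtain r s where "\<pi> = (r, s)" by (cases \<pi>)
  then show "haar_at j u (ff \<pi>)"
    using p haar_ff[of r s j] assms by (auto simp: max_lev_def)
qed

lemma flat_ff_sum:
  assumes "\<And>r s. (r, s) \<in> P \<Longrightarrow> r \<in> X \<and> s \<in> X \<and> r i = a \<and> s i = a" "i \<in> V"
  shows "flat_at i a (\<lambda>p. \<Sum>\<pi>\<in>P. ff \<pi> p)"
proof (rule flat_at_sum)
  fix \<pi> assume "\<pi> \<in> P"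
  moreover obtain r s where "\<pi> = (r, s)" by (cases \<pi>)
  ultimately show "flat_at i a (ff \<pi>)" using flat_ff[of r s i] assms(1)[of r s] assms(2) by simp
qed

lemma flat_unequal_part: "R \<subseteq> X \<Longrightarrow> S \<subseteq> X \<Longrightarrow> i \<in> V \<Longrightarrow> flat_at i a (unequal_part R S i j a u)"
  unfolding unequal_part_def by (rule flat_ff_sum) auto

lemma flat_equal_part: "R \<subseteq> X \<Longrightarrow> S \<subseteq> X \<Longrightarrow> i \<in> V \<Longrightarrow> flat_at i a (equal_part R S i j a u)"
  unfolding equal_part_def by (rule flat_ff_sum) auto

text \<open>The value of \<open>distinct_bound\<close> for \<open>card B\<close> coordinates and a
  one-element \<open>T\<close>, per element of \<open>J\<close>.\<close>

definition pair_const :: "real \<Rightarrow> nat set \<Rightarrow> real" where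
  "pair_const C B = C * \<nu> ^ (2 * card B - 2) * real M ^ (2 * card B - 2)"

text \<open>The common level at \<open>i\<close> is a new coincidence: \<open>i\<close> takes the
  role of \<open>k\<close>, \<open>\<beta>\<close> that of \<open>J\<close>, and the coordinates of
  \<open>B\<close> are free. Keeping the levels at \<open>j\<close> apart is the case
  \<open>T = {j}\<close> of the induction hypothesis.\<close>

lemma unequal_part_bd:
  assumes B: "B \<subseteq> V" and i: "i \<in> V - B" and j: "j \<in> B" and R: "R \<subseteq> X" and S: "S \<subseteq> X"
    and agree: "agree_on R (V - B - {i})" "agree_on S (V - B - {i})"
    and ne: "\<And>r s. r \<in> R \<Longrightarrow> s \<in> S \<Longrightarrow> r i = s i \<Longrightarrow> \<exists>l\<in>B. r l \<noteq> s l"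
    and db: "distinct_bound (card B) C" and \<beta>: "\<beta> \<subseteq> {..<M}"
  shows "bd (4 * \<mu>) (\<lambda>p. \<Sum>u<M. (\<Sum>m\<in>\<beta>. unequal_part R S i j m u p)\<^sup>2) (pair_const C B * real (card \<beta>))"
proof -
  define R' where "R' = {r\<in>R. r i \<in> \<beta>}"
  define S' where "S' = {r\<in>S. r i \<in> \<beta>}"
  define P where "P = distinct_pairs i R' S' B {j}"
  have sub: "R' \<subseteq> R" "S' \<subseteq> S" by (auto simp: R'_def S'_def)
  have fin: "finite P" unfolding P_def using sub R S by (intro finite_distinct_pairs) auto
  have "bd (4 * \<mu>) (sq_fun M {j} max_lev ff P)
      (C * \<nu> ^ (2 * card B - 1 - card {j}) * real (card \<beta>) * real M ^ (2 * card B - 2))"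
    unfolding P_def
  proof (rule distinct_boundD[OF db])
    show "admissible B i R' S' \<beta>"
      unfolding admissible_def using B i R S sub \<beta>
      by (intro conjI agree_on_subset[OF agree(1) sub(1)] agree_on_subset[OF agree(2) sub(2)])
        (auto simp: R'_def S'_def)
  qed (use j in auto)
  also have "C * \<nu> ^ (2 * card B - 1 - card {j}) * real (card \<beta>) * real M ^ (2 * card B - 2) = pair_const C B * real (card \<beta>)"
  proof -
    have "2 * card B - 1 - card {j} = 2 * card B - 2" by simp
    then show ?thesis by (simp only: pair_const_def mult_ac)
  qed
  also have "sq_fun M {j} max_lev ff P = (\<lambda>p. \<Sum>u<M. (\<Sum>m\<in>\<beta>. unequal_part R S i j m u p)\<^sup>2)"
  proof
    fix p
    have "(\<Sum>\<pi>\<in>{\<pi>\<in>P. max_lev \<pi> j = u}. ff \<pi> p) = (\<Sum>m\<in>\<beta>. unequal_part R S i j m u p)" for u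
    proof -
      have "(\<Sum>\<pi>\<in>{\<pi>\<in>P. max_lev \<pi> j = u}. ff \<pi> p)
          = (\<Sum>m\<in>\<beta>. \<Sum>\<pi>\<in>{\<pi>\<in>{\<pi>\<in>P. max_lev \<pi> j = u}. fst \<pi> i = m}. ff \<pi> p)"
        using fin finite_subset[OF \<beta>]
        by (intro sum.group[symmetric]) (auto simp: P_def distinct_pairs_def R'_def)
      also have "\<dots> = (\<Sum>m\<in>\<beta>. unequal_part R S i j m u p)"
      proof (rule sum.cong[OF refl])
        fix m assume m: "m \<in> \<beta>"
        have "{\<pi>\<in>{\<pi>\<in>P. max_lev \<pi> j = u}. fst \<pi> i = m}
            = {(r, s). r \<in> R \<and> s \<in> S \<and> r i = m \<and> s i = m \<and> r j \<noteq> s j \<and> max (r j) (s j) = u}"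
          using m j by (auto simp: P_def distinct_pairs_def R'_def S'_def max_lev_def)
        then show "(\<Sum>\<pi>\<in>{\<pi>\<in>{\<pi>\<in>P. max_lev \<pi> j = u}. fst \<pi> i = m}. ff \<pi> p) = unequal_part R S i j m u p"
          by (simp only: unequal_part_def)
      qed
      finally show ?thesis .
    qed
    then show "sq_fun M {j} max_lev ff P p = (\<Sum>u<M. (\<Sum>m\<in>\<beta>. unequal_part R S i j m u p)\<^sup>2)"
      using sq_fun_insert[of j "{}" M max_lev ff P p] by simp
  qed
  finally show ?thesis .
qed

text \<open>Equal levels at \<open>j\<close> freeze that coordinate too, which leaves
  \<open>card B - 1\<close> free ones and saves \<open>M ^ 2\<close>. If \<open>B\<close> is
  \<open>{j}\<close>, no pair is left, as a pair must differ somewhere on \<open>B\<close>.\<close>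

lemma equal_part_bd:
  assumes B: "B \<subseteq> V" and i: "i \<in> V - B" and j: "j \<in> B" and R: "R \<subseteq> X" and S: "S \<subseteq> X"
    and agree: "agree_on R (V - B - {i})" "agree_on S (V - B - {i})"
    and ne: "\<And>r s. r \<in> R \<Longrightarrow> s \<in> S \<Longrightarrow> r i = s i \<Longrightarrow> \<exists>l\<in>B. r l \<noteq> s l"
    and C: "0 \<le> C" and db: "2 \<le> card B \<Longrightarrow> distinct_bound (card B - 1) C" and \<beta>: "\<beta> \<subseteq> {..<M}"
  shows "bd (4 * \<mu>) (\<lambda>p. (\<Sum>m\<in>\<beta>. equal_part R S i j m u p)\<^sup>2)
    (\<nu> * pair_const C B / (real M)\<^sup>2 * real (card \<beta>))"
proof -
  define R' where "R' = {r\<in>R. r i \<in> \<beta> \<and> r j = u}"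
  define S' where "S' = {r\<in>S. r i \<in> \<beta> \<and> r j = u}"
  define P where "P = distinct_pairs i R' S' (B - {j}) {}"
  have finB: "finite B" using B finite_V finite_subset by blast
  have sub: "R' \<subseteq> R" "S' \<subseteq> S" by (auto simp: R'_def S'_def)
  have fin: "finite P" unfolding P_def using sub R S by (intro finite_distinct_pairs) auto
  have Peq: "P = {(r, s). r \<in> R' \<and> s \<in> S' \<and> r i = s i}"
  proof (intro set_eqI iffI)
    fix \<pi> assume p: "\<pi> \<in> {(r, s). r \<in> R' \<and> s \<in> S' \<and> r i = s i}"
    obtain r s where [simp]: "\<pi> = (r, s)" by (cases \<pi>)
    have rs: "r \<in> R" "s \<in> S" "r i = s i" "r j = s j" using p by (auto simp: R'_def S'_def)
    from ne[OF rs(1-3)] rs(4) have "\<exists>l\<in>B - {j}. r l \<noteq> s l" by blast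
    then show "\<pi> \<in> P" using p by (auto simp: P_def distinct_pairs_def)
  qed (auto simp: P_def distinct_pairs_def)
  have "(\<Sum>\<pi>\<in>P. ff \<pi> p) = (\<Sum>m\<in>\<beta>. equal_part R S i j m u p)" for p
  proof -
    have "(\<Sum>\<pi>\<in>P. ff \<pi> p) = (\<Sum>m\<in>\<beta>. \<Sum>\<pi>\<in>{\<pi>\<in>P. fst \<pi> i = m}. ff \<pi> p)"
      using fin finite_subset[OF \<beta>] by (intro sum.group[symmetric]) (auto simp: Peq R'_def)
    also have "\<dots> = (\<Sum>m\<in>\<beta>. equal_part R S i j m u p)"
    proof (rule sum.cong[OF refl])
      fix m assume m: "m \<in> \<beta>"
      have "{\<pi>\<in>P. fst \<pi> i = m} = {(r, s). r \<in> R \<and> s \<in> S \<and> r i = m \<and> s i = m \<and> r j = u \<and> s j = u}"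
        using m by (auto simp: Peq R'_def S'_def)
      then show "(\<Sum>\<pi>\<in>{\<pi>\<in>P. fst \<pi> i = m}. ff \<pi> p) = equal_part R S i j m u p"
        by (simp only: equal_part_def)
    qed
    finally show ?thesis .
  qed
  then have sq: "sq_fun M {} max_lev ff P = (\<lambda>p. (\<Sum>m\<in>\<beta>. equal_part R S i j m u p)\<^sup>2)"
    by (simp add: sq_fun_empty fun_eq_iff)
  have pc: "0 \<le> \<nu> * pair_const C B / (real M)\<^sup>2 * real (card \<beta>)"
    using C by (simp add: pair_const_def)
  show ?thesis
  proof (cases "2 \<le> card B")
    case False
    then have "B = {j}" using j finB by (metis card_1_singletonE card_le_Suc0_iff_eq le_antisym
          not_less_eq_eq numeral_2_eq_2 singletonD One_nat_def card_0_eq empty_iff le_zero_eq not_less_eq_eq)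
    then have "P = {}" by (auto simp: P_def distinct_pairs_def)
    then show ?thesis using pc by (simp add: sq[symmetric] sq_fun_def[abs_def] bd_const)
  next
    case True
    have cB: "card (B - {j}) = card B - 1" using j finB by simp
    have ag: "agree_on R' (V - (B - {j}) - {i})" "agree_on S' (V - (B - {j}) - {i})"
      using agree unfolding agree_on_def R'_def S'_def by (metis (mono_tags, lifting) Diff_iff mem_Collect_eq singletonD)+
    have "bd (4 * \<mu>) (sq_fun M {} max_lev ff P)
        (C * \<nu> ^ (2 * (card B - 1) - 1 - card ({} :: nat set)) * real (card \<beta>) * real M ^ (2 * (card B - 1) - 2))"
      unfolding P_def
    proof (rule distinct_boundD[OF db[OF True]])
      show "admissible (B - {j}) i R' S' \<beta>"
        unfolding admissible_def using B i R S sub \<beta> ag by (auto simp: R'_def S'_def)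
    qed (use cB in auto)
    then show ?thesis unfolding sq
    proof (rule bd_weaken)
      have "real M ^ (2 * (card B - 1) - 2) = real M ^ (2 * card B - 2) / (real M)\<^sup>2"
      proof -
        have "2 * card B - 2 = (2 * (card B - 1) - 2) + 2" using True by simp
        then have "real M ^ (2 * card B - 2) = real M ^ (2 * (card B - 1) - 2) * (real M)\<^sup>2"
          by (simp only: power_add)
        then show ?thesis using M_pos by simp
      qed
      moreover have "\<nu> ^ (2 * (card B - 1) - 1 - card ({} :: nat set)) \<le> \<nu> * \<nu> ^ (2 * card B - 2)"
      proof -
        have "\<nu> ^ (2 * (card B - 1) - 1 - card ({} :: nat set)) \<le> \<nu> ^ Suc (2 * card B - 2)"
          using Lambda_ge by (intro power_increasing) auto
        then show ?thesis by simp
      qed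
      ultimately have "C * real (card \<beta>) * real M ^ (2 * (card B - 1) - 2) * \<nu> ^ (2 * (card B - 1) - 1 - card ({} :: nat set))
          \<le> C * real (card \<beta>) * (real M ^ (2 * card B - 2) / (real M)\<^sup>2) * (\<nu> * \<nu> ^ (2 * card B - 2))"
        using C by (intro mult_mono) auto
      then show "C * \<nu> ^ (2 * (card B - 1) - 1 - card ({} :: nat set)) * real (card \<beta>) * real M ^ (2 * (card B - 1) - 2)
          \<le> \<nu> * pair_const C B / (real M)\<^sup>2 * real (card \<beta>)"
        by (simp add: pair_const_def mult_ac)
    qed
  qed
qed

text \<open>The equality of the levels \<open>r i = r' i\<close> in the first product and \<open>s j = s' j\<close> in the second leaves
  two sums with a coincidence in fewer coordinates, once the constraints tying them are removed.\<close>

lemma cross_sum_bd: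
  assumes A: "A \<subseteq> V" and B: "B \<subseteq> V" and AB: "A \<inter> B = {}" and i: "i \<in> A" and j: "j \<in> B"
    and sub: "R1 \<subseteq> X" "R2 \<subseteq> X" "S1 \<subseteq> X" "S2 \<subseteq> X"
    and agR: "agree_on R1 (V - B - {i})" "agree_on R2 (V - B - {i})"
    and agS: "agree_on S1 (V - A - {j})" "agree_on S2 (V - A - {j})"
    and neR: "\<And>r s. r \<in> R1 \<Longrightarrow> s \<in> R2 \<Longrightarrow> r i = s i \<Longrightarrow> \<exists>l\<in>B. r l \<noteq> s l"
    and neS: "\<And>r s. r \<in> S1 \<Longrightarrow> s \<in> S2 \<Longrightarrow> r j = s j \<Longrightarrow> \<exists>l\<in>A. r l \<noteq> s l"
    and C: "0 \<le> C"
    and db: "\<And>D'. 1 \<le> D' \<Longrightarrow> D' < card (A \<union> B) \<Longrightarrow> distinct_bound D' C"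
  shows "bd (4 * \<mu>) (\<lambda>p. \<Sum>a<M. \<Sum>b<M.
      (\<Sum>r\<in>{r\<in>R1. r i = a \<and> r j < b}. f r p) * (\<Sum>r\<in>{r\<in>R2. r i = a \<and> r j < b}. f r p) *
      ((\<Sum>s\<in>{s\<in>S1. s j = b \<and> s i < a}. f s p) * (\<Sum>s\<in>{s\<in>S2. s j = b \<and> s i < a}. f s p)))
    (4000 * C * \<nu> ^ (card (A \<union> B) - 1) * real M ^ (card (A \<union> B) - 1))"
proof -
  have fin: "finite A" "finite B" using A B finite_V finite_subset by blast+
  have card_AB: "card (A \<union> B) = card A + card B" using fin AB by (rule card_Un_disjoint)
  have cA: "1 \<le> card A" and cB: "1 \<le> card B" using i j fin by (auto simp: Suc_le_eq card_gt_0_iff)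
  have iV: "i \<in> V - B" and jV: "j \<in> V - A" and iV': "i \<in> V" and jV': "j \<in> V" using i j A B AB by auto
  let ?F = "unequal_part R1 R2 i j" and ?Fe = "equal_part R1 R2 i j"
  let ?G = "unequal_part S1 S2 j i" and ?Ge = "equal_part S1 S2 j i"
  define x where "x = pair_const C B"
  define y where "y = pair_const C A"
  have x0: "0 \<le> x" and y0: "0 \<le> y" using C by (simp_all add: x_def y_def pair_const_def)
  have L0: "0 \<le> \<nu>" by simp
  have M0: "0 < real M" using M_pos by simp
  have F: "bd (4 * \<mu>) (\<lambda>p. \<Sum>u<M. (\<Sum>m\<in>\<beta>. ?F m u p)\<^sup>2) (x * real (card \<beta>))" if "\<beta> \<subseteq> {..<M}" for \<beta>
    unfolding x_def using cA cB card_AB by (intro unequal_part_bd B iV j sub agR neR db that) auto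
  have G: "bd (4 * \<mu>) (\<lambda>p. \<Sum>u<M. (\<Sum>m\<in>\<beta>. ?G m u p)\<^sup>2) (y * real (card \<beta>))" if "\<beta> \<subseteq> {..<M}" for \<beta>
    unfolding y_def using cA cB card_AB by (intro unequal_part_bd A jV i sub agS neS db that) auto
  have Fe: "bd (4 * \<mu>) (\<lambda>p. (\<Sum>m\<in>\<beta>. ?Fe m u p)\<^sup>2) (\<nu> * x / (real M)\<^sup>2 * real (card \<beta>))"
    if "\<beta> \<subseteq> {..<M}" for \<beta> u
    unfolding x_def using cA cB card_AB by (intro equal_part_bd B iV j sub agR neR C db that) auto
  have Ge: "bd (4 * \<mu>) (\<lambda>p. (\<Sum>m\<in>\<beta>. ?Ge m u p)\<^sup>2) (\<nu> * y / (real M)\<^sup>2 * real (card \<beta>))"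
    if "\<beta> \<subseteq> {..<M}" for \<beta> u
    unfolding y_def using cA cB card_AB by (intro equal_part_bd A jV i sub agS neS C db that) auto
  have hF: "haar_at j u (?F m u)" and fF: "flat_at i m (?F m u)" and fFe: "flat_at i m (?Fe m u)"
    and hG: "haar_at i u (?G m u)" and fG: "flat_at j m (?G m u)" and fGe: "flat_at j m (?Ge m u)" for m u
    using sub iV' jV' by (auto intro: haar_unequal_part flat_unequal_part flat_equal_part)
  define z where "z = \<nu>\<^sup>2 * x * y * (real M)\<^sup>2"
  have z0: "0 \<le> z" using x0 y0 by (simp add: z_def)
  \<comment> \<open>The expansion by unequal or equal levels in the product of the
    \<open>f r\<close> and in that of the \<open>f s\<close>. \<open>Q1\<close> has Haar structure
    in both coordinates, \<open>Q2\<close> and \<open>Q3\<close> in one. \<open>Q4\<close> has none,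
    but its two equal parts are small enough for the triangle inequality over \<open>u\<close> and
    \<open>v\<close>.\<close>
  define Q1 where "Q1 p = (\<Sum>a<M. \<Sum>b<M. \<Sum>u<b. \<Sum>v<a. ?F a u p * ?G b v p)" for p
  define Q2 where "Q2 p = (\<Sum>v<M. \<Sum>b<M. \<Sum>u<b. (\<Sum>a\<in>{v<..<M}. ?F a u p) * ?Ge b v p)" for p
  define Q3 where "Q3 p = (\<Sum>u<M. \<Sum>a<M. \<Sum>v<a. (\<Sum>b\<in>{u<..<M}. ?G b v p) * ?Fe a u p)" for p
  define Q4 where "Q4 p = (\<Sum>u<M. \<Sum>v<M. (\<Sum>a\<in>{v<..<M}. ?Fe a u p) * (\<Sum>b\<in>{u<..<M}. ?Ge b v p))" for p
  have Q1: "bd (2 * \<mu>) (\<lambda>p. (Q1 p)\<^sup>2) (2000000 * z)"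
  proof -
    have "bd (2 * \<mu>) (\<lambda>p. (Q1 p)\<^sup>2) (2000000 * \<nu>\<^sup>2 * x * y * (real M)\<^sup>2)"
      unfolding Q1_def by (rule two_sided_sum[OF kappa_pos x0 y0 M_pos hF fF hG fG F G])
    then show ?thesis by (simp add: z_def mult.assoc)
  qed
  have Q2: "bd (2 * \<mu>) (\<lambda>p. (Q2 p)\<^sup>2) (200000 * z)"
  proof -
    have "bd (2 * \<mu>) (\<lambda>p. (Q2 p)\<^sup>2) (200000 * \<nu> * x * (\<nu> * y) * (real M)\<^sup>2)"
      unfolding Q2_def by (rule equal_level_sum[OF kappa_pos x0 _ M_pos hF fGe F Ge]) (use y0 in simp)
    then show ?thesis by (simp add: z_def power2_eq_square mult_ac)
  qed
  have Q3: "bd (2 * \<mu>) (\<lambda>p. (Q3 p)\<^sup>2) (200000 * z)"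
  proof -
    have "bd (2 * \<mu>) (\<lambda>p. (Q3 p)\<^sup>2) (200000 * \<nu> * y * (\<nu> * x) * (real M)\<^sup>2)"
      unfolding Q3_def by (rule equal_level_sum[OF kappa_pos y0 _ M_pos hG fFe G Fe]) (use x0 in simp)
    then show ?thesis by (simp add: z_def power2_eq_square mult_ac)
  qed
  have Q4: "bd (2 * \<mu>) (\<lambda>p. (Q4 p)\<^sup>2) z"
  proof -
    have one: "bd (2 * \<mu>) (\<lambda>p. ((\<Sum>a\<in>{v<..<M}. ?Fe a u p) * (\<Sum>b\<in>{u<..<M}. ?Ge b v p))\<^sup>2)
        (\<nu> * x / (real M)\<^sup>2 * real M * (\<nu> * y / (real M)\<^sup>2 * real M))" for u v
    proof (rule bd_sq_mult)
      have "bd (4 * \<mu>) (\<lambda>p. (\<Sum>a\<in>{v<..<M}. ?Fe a u p)\<^sup>2) (\<nu> * x / (real M)\<^sup>2 * real (card {v<..<M}))"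
        by (rule Fe) auto
      then have "bd (4 * \<mu>) (\<lambda>p. (\<Sum>a\<in>{v<..<M}. ?Fe a u p)\<^sup>2) (\<nu> * x / (real M)\<^sup>2 * real M)"
        by (rule bd_weaken) (use x0 in \<open>intro mult_left_mono; simp\<close>)
      then show "bd (2 * (2 * \<mu>)) (\<lambda>p. (\<Sum>a\<in>{v<..<M}. ?Fe a u p)\<^sup>2) (\<nu> * x / (real M)\<^sup>2 * real M)" by simp
      have "bd (4 * \<mu>) (\<lambda>p. (\<Sum>b\<in>{u<..<M}. ?Ge b v p)\<^sup>2) (\<nu> * y / (real M)\<^sup>2 * real (card {u<..<M}))"
        by (rule Ge) auto
      then have "bd (4 * \<mu>) (\<lambda>p. (\<Sum>b\<in>{u<..<M}. ?Ge b v p)\<^sup>2) (\<nu> * y / (real M)\<^sup>2 * real M)"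
        by (rule bd_weaken) (use y0 in \<open>intro mult_left_mono; simp\<close>)
      then show "bd (2 * (2 * \<mu>)) (\<lambda>p. (\<Sum>b\<in>{u<..<M}. ?Ge b v p)\<^sup>2) (\<nu> * y / (real M)\<^sup>2 * real M)" by simp
    qed
    let ?t = "\<lambda>(u, v) p. (\<Sum>a\<in>{v<..<M}. ?Fe a u p) * (\<Sum>b\<in>{u<..<M}. ?Ge b v p)"
    have "bd (2 * \<mu>) (\<lambda>p. \<Sum>n\<in>{()}. (\<Sum>w\<in>{..<M} \<times> {..<M}. ?t w p)\<^sup>2)
        ((real (card ({..<M} \<times> {..<M})))\<^sup>2 * (\<nu> * x / (real M)\<^sup>2 * real M * (\<nu> * y / (real M)\<^sup>2 * real M)))"
      using kappa_pos one x0 y0 by (intro bd_sq_sum) auto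
    moreover have "(real (card ({..<M} \<times> {..<M})))\<^sup>2 * (\<nu> * x / (real M)\<^sup>2 * real M * (\<nu> * y / (real M)\<^sup>2 * real M)) = z"
      using M0 by (simp add: z_def power2_eq_square field_simps)
    moreover have "(\<Sum>w\<in>{..<M} \<times> {..<M}. ?t w p) = Q4 p" for p
      by (simp add: Q4_def sum.cartesian_product case_prod_unfold)
    ultimately show ?thesis by simp
  qed
  have "bd (2 * \<mu>) (\<lambda>p. ((Q1 p + Q2 p) + (Q3 p + Q4 p))\<^sup>2)
      (2 * (2 * (2000000 * z + 200000 * z) + 2 * (200000 * z + z)))"
    using kappa_pos Q1 Q2 Q3 Q4 by (intro bd_sq_add) simp_all
  then have "bd (2 * \<mu>) (\<lambda>p. ((Q1 p + Q2 p) + (Q3 p + Q4 p))\<^sup>2)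
      ((4000 * C * \<nu> ^ (card (A \<union> B) - 1) * real M ^ (card (A \<union> B) - 1))\<^sup>2)"
  proof (rule bd_weaken)
    have e: "2 * card B - 2 + (2 * card A - 2) + 2 = 2 * (card (A \<union> B) - 1)"
      using cA cB card_AB by simp
    have "z = C\<^sup>2 * (\<nu> ^ (2 * card B - 2) * \<nu> ^ (2 * card A - 2) * \<nu>\<^sup>2) *
        (real M ^ (2 * card B - 2) * real M ^ (2 * card A - 2) * (real M)\<^sup>2)"
      unfolding z_def x_def y_def pair_const_def by (simp only: power2_eq_square mult_ac)
    also have "\<dots> = C\<^sup>2 * (\<nu> ^ (card (A \<union> B) - 1))\<^sup>2 * (real M ^ (card (A \<union> B) - 1))\<^sup>2"
      unfolding power_add[symmetric] e power_mult[symmetric] by (simp only: mult.commute)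
    finally have "(4000 * C * \<nu> ^ (card (A \<union> B) - 1) * real M ^ (card (A \<union> B) - 1))\<^sup>2 = 16000000 * z"
      unfolding power_mult_distrib by simp
    then show "2 * (2 * (2000000 * z + 200000 * z) + 2 * (200000 * z + z))
      \<le> (4000 * C * \<nu> ^ (card (A \<union> B) - 1) * real M ^ (card (A \<union> B) - 1))\<^sup>2"
      using z0 by simp
  qed
  \<comment> \<open>Passing from the square to the sum doubles the order, back to
    \<open>4 * \<mu>\<close>. The constants of the four parts add up to less than
    \<open>4000 ^ 2\<close>.\<close>
  then have main: "bd (4 * \<mu>) (\<lambda>p. (Q1 p + Q2 p) + (Q3 p + Q4 p))
      (4000 * C * \<nu> ^ (card (A \<union> B) - 1) * real M ^ (card (A \<union> B) - 1))"
    using C by (subst (asm) bd_sq) simp_all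
  have "(\<Sum>a<M. \<Sum>b<M.
      (\<Sum>r\<in>{r\<in>R1. r i = a \<and> r j < b}. f r p) * (\<Sum>r\<in>{r\<in>R2. r i = a \<and> r j < b}. f r p) *
      ((\<Sum>s\<in>{s\<in>S1. s j = b \<and> s i < a}. f s p) * (\<Sum>s\<in>{s\<in>S2. s j = b \<and> s i < a}. f s p)))
    = (Q1 p + Q2 p) + (Q3 p + Q4 p)" for p
  proof -
    have e2: "(\<Sum>a<M. \<Sum>b<M. \<Sum>u<b. \<Sum>v<a. ?F a u p * ?Ge b v p) = Q2 p"
      unfolding sum_below_below unfolding Q2_def sum_above_commute sum_distrib_left[symmetric] by (rule sum.swap)
    have e3: "(\<Sum>a<M. \<Sum>b<M. \<Sum>u<b. \<Sum>v<a. ?Fe a u p * ?G b v p) = Q3 p"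
      unfolding sum_below_below unfolding Q3_def sum_above_commute sum_distrib_left[symmetric] by (simp only: mult.commute)
    have e4: "(\<Sum>a<M. \<Sum>b<M. \<Sum>u<b. \<Sum>v<a. ?Fe a u p * ?Ge b v p) = Q4 p"
      unfolding sum_below_below Q4_def ..
    have "(\<Sum>u<b. ?F a u p + ?Fe a u p) * (\<Sum>v<a. ?G b v p + ?Ge b v p)
        = (\<Sum>u<b. \<Sum>v<a. ?F a u p * ?G b v p) + (\<Sum>u<b. \<Sum>v<a. ?F a u p * ?Ge b v p)
        + ((\<Sum>u<b. \<Sum>v<a. ?Fe a u p * ?G b v p) + (\<Sum>u<b. \<Sum>v<a. ?Fe a u p * ?Ge b v p))" for a b
      unfolding sum_product sum.distrib[symmetric] by (intro sum.cong refl) (simp add: algebra_simps)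
    then show ?thesis
      unfolding slice_product[OF sub(1,2)] slice_product[OF sub(3,4)]
      by (simp add: sum.distrib e2 e3 e4 Q1_def)
  qed
  with main show ?thesis by (simp only:)
qed

end

section \<open>Induction on the number of coordinates\<close>

text \<open>One step of the induction loses \<open>16 ^ D\<close> in sorting the pairs by order
  pattern and 4000 in the off-diagonal terms; the summand 1 pays for the diagonal.\<close>

primrec bound_const :: "nat \<Rightarrow> real" where
  "bound_const 0 = 1"
| "bound_const (Suc D) = 1 + 4000 * (16 ^ D * bound_const D)"

lemma bound_const_pos: "0 < bound_const D"
  by (induction D) (auto intro: add_pos_pos)

lemma bound_const_nonneg: "0 \<le> bound_const D"
  using bound_const_pos[of D] by simp

lemma bound_const_le_Suc: "16 ^ D * bound_const D \<le> bound_const (Suc D)"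
proof -
  have "0 \<le> 16 ^ D * bound_const D" by (simp add: bound_const_nonneg)
  then show ?thesis unfolding bound_const.simps by linarith
qed

context haar_family
begin

lemma ff_swap: "ff (s, r) = ff (r, s)"
  by (simp add: ff_def mult.commute)

lemma sq_fun_pattern_swap:
  "sq_fun M L max_lev ff (pattern_pairs k R S A B) p = sq_fun M L max_lev ff (pattern_pairs k S R B A) p"
proof -
  have "(\<Sum>\<pi>\<in>{\<pi>\<in>pattern_pairs k R S A B. \<forall>l\<in>L. max_lev \<pi> l = m l}. ff \<pi> p)
      = (\<Sum>\<pi>\<in>{\<pi>\<in>pattern_pairs k S R B A. \<forall>l\<in>L. max_lev \<pi> l = m l}. ff \<pi> p)" for m
    by (rule sum.reindex_bij_witness[of _ prod.swap prod.swap])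
      (auto simp: pattern_pairs_def max_lev_def max.commute ff_swap)
  then show ?thesis by (simp add: sq_fun_def)
qed

text \<open>When \<open>r\<close> is larger on all of \<open>A\<close>, the maximal levels determine
  \<open>r\<close>, and each group of the square function is a single \<open>f r\<close> times a sum
  of \<open>f s\<close>. That sum is bounded by \<open>hyperbolic_sum_bd\<close>, and the number of
  vectors \<open>r\<close> supplies \<open>card J * M ^ (card A - 1)\<close>.\<close>

lemma one_sided_pattern_bd:
  assumes ne: "A \<noteq> {}" and adm: "admissible A k R S J"
  shows "bd (4 * \<mu>) (sq_fun M A max_lev ff (pattern_pairs k R S A {}))
    (\<nu> ^ (card A - 1) * real (card J) * real M ^ (2 * card A - 2))"
proof -
  have A: "A \<subseteq> V" "A \<noteq> {}" and k: "k \<in> V - A" and R: "R \<subseteq> X" and S: "S \<subseteq> X"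
    and agR: "agree_on R (V - A - {k})" and agS: "agree_on S (V - A - {k})"
    and J: "J \<subseteq> {..<M}" "\<forall>r\<in>R. r k \<in> J"
    using adm ne by (simp_all add: admissible_def)
  define G where "G r = {s\<in>S. s k = r k \<and> (\<forall>l\<in>A. s l < r l)}" for r
  obtain l0 where l0: "l0 \<in> A" using A by blast
  have finA: "finite A" using A finite_V finite_subset by blast
  have finJ: "finite J" using J finite_subset by blast
  have finR: "finite R" using R by (rule finite_sub)
  have finG: "finite (G r)" for r using finite_sub[OF S] by (simp add: G_def)
  have lev: "r l < M" if "r \<in> R" "l \<in> A" for r l using level_less that R A by blast
  have same: "s = r" if "r \<in> R" "s \<in> R" "\<And>l. l \<in> A \<Longrightarrow> s l = r l" for r s
  proof (rule determined[of s r k])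
    fix z assume "z \<in> V - {k}"
    then show "s z = r z" using that agR by (cases "z \<in> A") (auto simp: agree_on_def)
  qed (use that R k in auto)
  \<comment> \<open>Here \<open>determined\<close> is used with \<open>l0\<close> as the omitted
    coordinate, in \<open>same\<close> with \<open>k\<close>.\<close>
  have cardR: "card R \<le> card J * M ^ (card A - 1)"
  proof -
    let ?h = "\<lambda>r :: nat \<Rightarrow> nat. (r k, restrict r (A - {l0}))"
    have "inj_on ?h R"
    proof (rule inj_onI)
      fix r s assume rs: "r \<in> R" "s \<in> R" "?h r = ?h s"
      have eqA: "r z = s z" if "z \<in> A - {l0}" for z
        using rs(3) that by (metis restrict_apply' snd_conv)
      show "r = s"
      proof (rule determined[of r s l0])
        fix z assume "z \<in> V - {l0}"
        then show "r z = s z"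
          using rs agR eqA by (cases "z \<in> A"; cases "z = k") (auto simp: agree_on_def)
      qed (use rs R A l0 in auto)
    qed
    moreover have "?h ` R \<subseteq> J \<times> (levels (A - {l0}))"
      using lev J(2) by (intro image_subsetI) (simp add: restrict_PiE Pi_iff)
    ultimately have "card R \<le> card (J \<times> (levels (A - {l0})))"
      using finJ finA by (intro card_inj_on_le) (auto intro: finite_PiE)
    also have "\<dots> = card J * M ^ (card A - 1)"
      using finA l0 by (simp add: card_cartesian_product card_PiE_levels)
    finally show ?thesis .
  qed
  have "bd (4 * \<mu>) (\<lambda>p. \<Sum>r\<in>R. (\<Sum>s\<in>G r. f s p)\<^sup>2) (real (card R) * (\<nu> * real M) ^ (card A - 1))"
  proof (rule bd_sum_const)
    fix r assume "r \<in> R"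
    have "agree_on (G r) (V - A)"
      unfolding agree_on_def
    proof (intro ballI)
      fix s t z assume "s \<in> G r" "t \<in> G r" "z \<in> V - A"
      then show "s z = t z" using agS by (cases "z = k") (auto simp: G_def agree_on_def)
    qed
    then have "bd (2 * (2 * \<mu>)) (\<lambda>p. (\<Sum>s\<in>G r. f s p)\<^sup>2) ((64 * real (2 * \<mu>) * real M) ^ (card A - 1))"
      using kappa_pos S A by (intro hyperbolic_sum_bd) (auto simp: G_def)
    then have "bd (2 * (2 * \<mu>)) (\<lambda>p. (\<Sum>s\<in>G r. f s p)\<^sup>2) ((\<nu> * real M) ^ (card A - 1))"
      by (rule bd_weaken) (intro power_mono mult_right_mono; simp)
    then show "bd (4 * \<mu>) (\<lambda>p. (\<Sum>s\<in>G r. f s p)\<^sup>2) ((\<nu> * real M) ^ (card A - 1))" by simp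
  qed (use kappa_pos finR in auto)
  then have "bd (4 * \<mu>) (sq_fun M A max_lev ff (pattern_pairs k R S A {}))
      (real (card R) * (\<nu> * real M) ^ (card A - 1))"
  proof (rule bd_mono)
    fix p assume p: "p \<in> Om"
    have "sq_fun M A max_lev ff (pattern_pairs k R S A {}) p
        \<le> (\<Sum>m\<in>levels A. \<Sum>r\<in>{r\<in>R. restrict r A = m}. (\<Sum>s\<in>G r. f s p)\<^sup>2)"
      unfolding sq_fun_def
    proof (rule sum_mono)
      fix m assume m: "m \<in> levels A"
      let ?R = "{r\<in>R. restrict r A = m}" and ?Q = "{\<pi>\<in>pattern_pairs k R S A {}. \<forall>l\<in>A. max_lev \<pi> l = m l}"
      have Req: "restrict r A = m \<longleftrightarrow> (\<forall>l\<in>A. r l = m l)" for r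
        using m by (auto simp: fun_eq_iff PiE_def extensional_def)
      have "?Q = Sigma ?R G"
        unfolding Req by (auto simp: pattern_pairs_def max_lev_def G_def max_def less_imp_le) force+
      then have eq: "(\<Sum>\<pi>\<in>?Q. ff \<pi> p)
          = (\<Sum>r\<in>?R. f r p * (\<Sum>s\<in>G r. f s p))"
        using finR finG by (simp add: sum.Sigma ff_def sum_distrib_left case_prod_unfold)
      show "(\<Sum>\<pi>\<in>?Q. ff \<pi> p)\<^sup>2
          \<le> (\<Sum>r\<in>?R. (\<Sum>s\<in>G r. f s p)\<^sup>2)"
      proof (cases "?R = {}")
        case True
        then show ?thesis unfolding eq by (simp only: sum.empty) simp
      next
        case False
        then obtain r where r: "r \<in> ?R" by blast
        then have "?R = {r}" unfolding Req using same by auto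
        moreover have "(f r p * (\<Sum>s\<in>G r. f s p))\<^sup>2 \<le> 1 * (\<Sum>s\<in>G r. f s p)\<^sup>2"
          unfolding power_mult_distrib using bounded[of r p] r R p
          by (intro mult_right_mono) (auto simp: abs_square_le_1)
        ultimately show ?thesis unfolding eq by simp
      qed
    qed
    also have "\<dots> = (\<Sum>r\<in>R. (\<Sum>s\<in>G r. f s p)\<^sup>2)"
    proof (rule sum.group[OF finR])
      show "finite (levels A)" using finA by (intro finite_PiE) auto
      show "(\<lambda>r. restrict r A) ` R \<subseteq> levels A"
        using lev by (intro image_subsetI) (simp add: restrict_PiE Pi_iff)
    qed
    finally show "\<bar>sq_fun M A max_lev ff (pattern_pairs k R S A {}) p\<bar> \<le> \<bar>\<Sum>r\<in>R. (\<Sum>s\<in>G r. f s p)\<^sup>2\<bar>"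
      by (simp add: sq_fun_nonneg)
  qed
  then show ?thesis
  proof (rule bd_weaken)
    have "real (card R) \<le> real (card J * M ^ (card A - 1))" using cardR by (simp only: of_nat_le_iff)
    then have "real (card R) * (\<nu> * real M) ^ (card A - 1) \<le> real (card J * M ^ (card A - 1)) * (\<nu> * real M) ^ (card A - 1)"
      by (intro mult_right_mono) auto
    also have "\<dots> = \<nu> ^ (card A - 1) * real (card J) * (real M ^ (card A - 1) * real M ^ (card A - 1))"
      by (simp only: of_nat_mult of_nat_power power_mult_distrib mult_ac)
    also have "real M ^ (card A - 1) * real M ^ (card A - 1) = real M ^ (2 * card A - 2)"
      by (simp add: power_add[symmetric] mult_2[symmetric] diff_mult_distrib2)
    finally show "real (card R) * (\<nu> * real M) ^ (card A - 1)
      \<le> \<nu> ^ (card A - 1) * real (card J) * real M ^ (2 * card A - 2)" .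
  qed
qed

section \<open>Slices with prescribed maximal levels\<close>

lemma ball_remove:
  assumes "i \<in> A" "m i = a" "\<And>l. l \<in> A - {i} \<Longrightarrow> m l = y l"
  shows "(\<forall>l\<in>A. P l (m l)) \<longleftrightarrow> P i a \<and> (\<forall>l\<in>A - {i}. P l (y l))"
proof -
  have "(\<forall>l\<in>A. P l (m l)) \<longleftrightarrow> (\<forall>l\<in>insert i (A - {i}). P l (m l))" using assms(1) by (simp only: insert_Diff)
  also have "\<dots> \<longleftrightarrow> P i a \<and> (\<forall>l\<in>A - {i}. P l (m l))" using assms(2) by (simp only: ball_simps)
  also have "(\<forall>l\<in>A - {i}. P l (m l)) \<longleftrightarrow> (\<forall>l\<in>A - {i}. P l (y l))" using assms(3) by (intro ball_cong) auto
  finally show ?thesis .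
qed

text \<open>The vector \<open>r\<close> attains the maximal levels \<open>m\<close> on
  \<open>A\<close> and stays below them on \<open>B\<close>; for \<open>s\<close> the two sets are
  exchanged. So the pairs with given \<open>m\<close> and coincidence value \<open>c\<close> form a
  product of two slices.\<close>

definition slice :: "(nat \<Rightarrow> nat) set \<Rightarrow> nat \<Rightarrow> nat set \<Rightarrow> nat set \<Rightarrow> nat \<Rightarrow> (nat \<Rightarrow> nat) \<Rightarrow> (nat \<Rightarrow> nat) set" where
  "slice R k A B c m = {r\<in>R. r k = c \<and> (\<forall>l\<in>A. r l = m l) \<and> (\<forall>l\<in>B. r l < m l)}"

lemma slice_subset: "slice R k A B c m \<subseteq> R"
  by (auto simp: slice_def)

lemma slice_agree:
  assumes "agree_on R (V - (A \<union> B) - {k})"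
  shows "agree_on (slice R k (A - I) B' c m) (V - B - I)"
  unfolding agree_on_def
proof (intro ballI)
  fix r s z assume a: "r \<in> slice R k (A - I) B' c m" "s \<in> slice R k (A - I) B' c m" "z \<in> V - B - I"
  show "r z = s z"
  proof (cases "z = k \<or> z \<in> A")
    case False
    then show ?thesis using a assms by (auto simp: agree_on_def slice_def)
  qed (use a in \<open>auto simp: slice_def\<close>)
qed

lemma slice_sum_bd:
  assumes B: "B \<subseteq> V" "B \<noteq> {}" and R: "R \<subseteq> X" and ag: "agree_on R (V - (A \<union> B) - {k})"
  shows "bd (2 * (4 * \<mu>)) (\<lambda>p. (\<Sum>r\<in>slice R k A B c m. f r p)\<^sup>2) ((\<nu> * real M) ^ (card B - 1))"
proof -
  have "agree_on (slice R k A B c m) (V - B)" using slice_agree[OF ag, of "{}"] by simp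
  then have "bd (2 * (4 * \<mu>)) (\<lambda>p. (\<Sum>r\<in>slice R k A B c m. f r p)\<^sup>2) ((64 * real (4 * \<mu>) * real M) ^ (card B - 1))"
    using kappa_pos by (intro hyperbolic_sum_bd order_trans[OF slice_subset R] B) auto
  then show ?thesis by simp
qed

text \<open>Vectors that differ at \<open>k\<close> cannot agree on all of \<open>V - {k}\<close>,
  by \<open>determined\<close>. Thus \<open>c \<noteq> c'\<close> ensures that the new pairs, which
  share the level at \<open>i\<close>, are again pairs of distinct vectors.\<close>

lemma slice_distinct:
  assumes R: "R \<subseteq> X" and k: "k \<in> V" and ag: "agree_on R (V - (A \<union> B) - {k})" and c: "c \<noteq> c'"
    and r: "r \<in> slice R k (A - {i}) B' c y" and s: "s \<in> slice R k (A - {i}) B' c' y" and eq: "r i = s i"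
  shows "\<exists>l\<in>B. r l \<noteq> s l"
proof (rule ccontr)
  assume B: "\<not> (\<exists>l\<in>B. r l \<noteq> s l)"
  have "r = s"
  proof (rule determined[of r s k])
    fix z assume z: "z \<in> V - {k}"
    consider "z = i" | "z \<in> A - {i}" | "z \<in> B" | "z \<in> V - (A \<union> B) - {k}" using z by blast
    then show "r z = s z"
    proof cases
      case 4
      then show ?thesis using ag r s by (auto simp: agree_on_def slice_def)
    qed (use eq B r s in \<open>auto simp: slice_def\<close>)
  qed (use r s R k slice_subset in blast)+
  then show False using r s c by (auto simp: slice_def)
qed

text \<open>For given \<open>m\<close> the inner sum is the sum of \<open>h c m * g c m\<close> over
  \<open>c\<close>, and its square splits into \<open>Diag\<close> and \<open>Off\<close>. In
  \<open>Off\<close> the triangle inequality is used over \<open>c \<noteq> c'\<close> and over all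
  maximal levels except those at one \<open>i\<close> in \<open>A\<close> and one \<open>j\<close>
  in \<open>B\<close>; the sum over these two is left to \<open>cross_sum_bd\<close>.\<close>

lemma mixed_pattern_bd:
  assumes ne: "A \<noteq> {}" "B \<noteq> {}" and AB: "A \<inter> B = {}" and adm: "admissible (A \<union> B) k R S J" and card_D: "card (A \<union> B) = D"
    and C: "0 \<le> C" and db: "\<And>D'. 1 \<le> D' \<Longrightarrow> D' < D \<Longrightarrow> distinct_bound D' C"
  shows "bd (4 * \<mu>) (sq_fun M (A \<union> B) max_lev ff (pattern_pairs k R S A B))
    ((1 + 4000 * C) * \<nu> ^ (D - 1) * real (card J) * real M ^ (2 * D - 2))"
proof -
  have A: "A \<subseteq> V" and B: "B \<subseteq> V" and k: "k \<in> V - (A \<union> B)" and R: "R \<subseteq> X" and S: "S \<subseteq> X"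
    and agR: "agree_on R (V - (A \<union> B) - {k})" and agS: "agree_on S (V - (A \<union> B) - {k})"
    and J: "J \<subseteq> {..<M}" "\<forall>r\<in>R. r k \<in> J"
    using adm by (simp_all add: admissible_def)
  obtain i where i: "i \<in> A" using ne by blast
  obtain j where j: "j \<in> B" using ne by blast
  have ij: "i \<noteq> j" "i \<notin> B" "j \<notin> A" using i j AB by auto
  have fin: "finite A" "finite B" using A B finite_V finite_subset by blast+
  have finJ: "finite J" using J finite_subset by blast
  have cardJ: "card J \<le> M" using card_mono[OF _ J(1)] by simp
  have card_AB: "card A + card B = D" using fin AB card_D by (simp add: card_Un_disjoint)
  have cA: "1 \<le> card A" and cB: "1 \<le> card B" using i j fin by (auto simp: Suc_le_eq card_gt_0_iff)
  define L0 where "L0 = A \<union> B - {i, j}"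
  have ins: "A \<union> B = insert i (insert j L0)" "i \<notin> insert j L0" "j \<notin> L0"
    using i j ij by (auto simp: L0_def)
  have finL0: "finite L0" using fin by (simp add: L0_def)
  have cardL0: "card L0 = D - 2"
  proof -
    have "D = Suc (Suc (card L0))" unfolding card_D[symmetric] ins(1) using ins(2,3) finL0 by simp
    then show ?thesis by simp
  qed
  define h where "h c m p = (\<Sum>r\<in>slice R k A B c m. f r p)" for c m p
  define g where "g c m p = (\<Sum>s\<in>slice S k B A c m. f s p)" for c m p
  define Diag where "Diag p = (\<Sum>m\<in>levels (A \<union> B). \<Sum>c\<in>J. (h c m p * g c m p)\<^sup>2)" for p
  define Off where "Off p = (\<Sum>c\<in>J. \<Sum>c'\<in>J - {c}. \<Sum>y\<in>levels L0. \<Sum>a<M. \<Sum>b<M.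
      h c (y(j := b, i := a)) p * h c' (y(j := b, i := a)) p *
      (g c (y(j := b, i := a)) p * g c' (y(j := b, i := a)) p))" for p
  define z where "z = \<nu> ^ (D - 1) * real (card J) * real M ^ (2 * D - 2)"
  have Z: "(\<Sum>\<pi>\<in>{\<pi>\<in>pattern_pairs k R S A B. \<forall>l\<in>A \<union> B. max_lev \<pi> l = m l}. ff \<pi> p) = (\<Sum>c\<in>J. h c m p * g c m p)"
    for m p
  proof -
    let ?P = "{\<pi>\<in>pattern_pairs k R S A B. \<forall>l\<in>A \<union> B. max_lev \<pi> l = m l}"
    have "(\<Sum>\<pi>\<in>?P. ff \<pi> p) = (\<Sum>c\<in>J. \<Sum>\<pi>\<in>{\<pi>\<in>?P. fst \<pi> k = c}. ff \<pi> p)"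
      using finite_pattern_pairs[OF R S, of k A B] finJ J(2)
      by (intro sum.group[symmetric]) (auto simp: pattern_pairs_def)
    also have "\<dots> = (\<Sum>c\<in>J. h c m p * g c m p)"
    proof (rule sum.cong[OF refl])
      fix c
      have "{\<pi>\<in>?P. fst \<pi> k = c} = slice R k A B c m \<times> slice S k B A c m"
      proof (intro set_eqI)
        fix \<pi> :: "(nat \<Rightarrow> nat) \<times> (nat \<Rightarrow> nat)"
        obtain r s where [simp]: "\<pi> = (r, s)" by (cases \<pi>)
        have "(\<forall>l\<in>A. s l < r l) \<and> (\<forall>l\<in>B. r l < s l) \<and> (\<forall>l\<in>A \<union> B. max (r l) (s l) = m l)
            \<longleftrightarrow> (\<forall>l\<in>A. r l = m l \<and> s l < m l) \<and> (\<forall>l\<in>B. s l = m l \<and> r l < m l)"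
          by (auto simp: max_def split: if_splits)
        then show "\<pi> \<in> {\<pi>\<in>?P. fst \<pi> k = c} \<longleftrightarrow> \<pi> \<in> slice R k A B c m \<times> slice S k B A c m"
          by (auto simp: pattern_pairs_def slice_def max_lev_def)
      qed
      then show "(\<Sum>\<pi>\<in>{\<pi>\<in>?P. fst \<pi> k = c}. ff \<pi> p) = h c m p * g c m p"
        by (simp add: h_def g_def sum_product sum.cartesian_product ff_def case_prod_unfold)
    qed
    finally show ?thesis .
  qed
  have expand: "sq_fun M (A \<union> B) max_lev ff (pattern_pairs k R S A B) p = Diag p + Off p" for p
  proof -
    let ?x = "\<lambda>c m. h c m p * g c m p"
    let ?t = "\<lambda>c c' m. h c m p * h c' m p * (g c m p * g c' m p)"
    have "(\<Sum>c\<in>J. ?x c m)\<^sup>2 = (\<Sum>c\<in>J. (?x c m)\<^sup>2) + (\<Sum>c\<in>J. \<Sum>c'\<in>J - {c}. ?t c c' m)" for m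
    proof -
      have "(\<Sum>c\<in>J. ?x c m)\<^sup>2 = (\<Sum>c\<in>J. ?x c m * (\<Sum>c'\<in>J. ?x c' m))"
        by (simp only: power2_eq_square sum_distrib_right)
      also have "\<dots> = (\<Sum>c\<in>J. (?x c m)\<^sup>2 + (\<Sum>c'\<in>J - {c}. ?t c c' m))"
      proof (rule sum.cong[OF refl])
        fix c assume "c \<in> J"
        then have "(\<Sum>c'\<in>J. ?x c' m) = ?x c m + (\<Sum>c'\<in>J - {c}. ?x c' m)"
          by (rule sum.remove[OF finJ])
        then show "?x c m * (\<Sum>c'\<in>J. ?x c' m) = (?x c m)\<^sup>2 + (\<Sum>c'\<in>J - {c}. ?t c c' m)"
          by (simp add: distrib_left sum_distrib_left power2_eq_square mult_ac)
      qed
      finally show ?thesis by (simp only: sum.distrib)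
    qed
    then have "sq_fun M (A \<union> B) max_lev ff (pattern_pairs k R S A B) p
        = Diag p + (\<Sum>m\<in>levels (A \<union> B). \<Sum>c\<in>J. \<Sum>c'\<in>J - {c}. ?t c c' m)"
      unfolding sq_fun_def Z Diag_def by (simp only: sum.distrib)
    also have "(\<Sum>m\<in>levels (A \<union> B). \<Sum>c\<in>J. \<Sum>c'\<in>J - {c}. ?t c c' m)
        = (\<Sum>c\<in>J. \<Sum>m\<in>levels (A \<union> B). \<Sum>c'\<in>J - {c}. ?t c c' m)" by (rule sum.swap)
    also have "\<dots> = (\<Sum>c\<in>J. \<Sum>c'\<in>J - {c}. \<Sum>m\<in>levels (A \<union> B). ?t c c' m)"
      by (rule sum.cong[OF refl], rule sum.swap)
    also have "\<dots> = Off p"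
      unfolding Off_def
    proof (rule sum.cong[OF refl], rule sum.cong[OF refl])
      fix c c'
      have "(\<Sum>m\<in>levels (A \<union> B). ?t c c' m)
          = (\<Sum>y\<in>levels L0. \<Sum>b<M. \<Sum>a<M. ?t c c' (y(j := b, i := a)))"
        unfolding ins(1) sum_PiE_insert[OF ins(2)] sum_PiE_insert[OF ins(3)] ..
      also have "\<dots> = (\<Sum>y\<in>levels L0. \<Sum>a<M. \<Sum>b<M. ?t c c' (y(j := b, i := a)))"
        by (rule sum.cong[OF refl], rule sum.swap)
      finally show "(\<Sum>m\<in>levels (A \<union> B). ?t c c' m)
          = (\<Sum>y\<in>levels L0. \<Sum>a<M. \<Sum>b<M. ?t c c' (y(j := b, i := a)))" .
    qed
    finally show ?thesis .
  qed
  \<comment> \<open>There are \<open>M ^ D\<close> assignments \<open>m\<close>, and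
    \<open>h\<close>, \<open>g\<close> contribute \<open>M ^ (D - 2)\<close> to the square, since
    each loses one free coordinate to the condition on the sum.\<close>
  have Diag: "bd (4 * \<mu>) Diag z"
  proof -
    have hb: "bd (2 * (4 * \<mu>)) (\<lambda>p. (h c m p)\<^sup>2) ((\<nu> * real M) ^ (card B - 1))"
      and gb: "bd (2 * (4 * \<mu>)) (\<lambda>p. (g c m p)\<^sup>2) ((\<nu> * real M) ^ (card A - 1))" for c m
      unfolding h_def g_def using slice_sum_bd[OF B ne(2) R agR] slice_sum_bd[OF A ne(1) S, of B k] agS
      by (simp_all add: Un_commute)
    have "bd (4 * \<mu>) Diag (real (card (levels (A \<union> B))) *
        (real (card J) * ((\<nu> * real M) ^ (card B - 1) * (\<nu> * real M) ^ (card A - 1))))"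
      unfolding Diag_def using kappa_pos fin finJ
      by (intro bd_sum_const bd_sq_mult hb gb finite_PiE) auto
    then show ?thesis
    proof (rule bd_weaken)
      have e1: "card B - 1 + (card A - 1) = D - 2" using cA cB card_AB by simp
      have e2: "D + (D - 2) = 2 * D - 2" using cA cB card_AB by simp
      have "real (card (levels (A \<union> B))) * (real (card J) * ((\<nu> * real M) ^ (card B - 1) * (\<nu> * real M) ^ (card A - 1)))
          = real M ^ D * (real (card J) * (\<nu> * real M) ^ (D - 2))"
        using fin card_D by (simp only: power_add[symmetric] e1) (simp add: card_PiE_levels)
      also have "\<dots> = \<nu> ^ (D - 2) * real (card J) * real M ^ (2 * D - 2)"
        unfolding power_mult_distrib e2[symmetric] power_add by (simp only: mult_ac)
      also have "\<dots> \<le> z" unfolding z_def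
        using Lambda_ge by (intro mult_right_mono power_increasing) auto
      finally show "real (card (levels (A \<union> B))) * (real (card J) * ((\<nu> * real M) ^ (card B - 1) * (\<nu> * real M) ^ (card A - 1))) \<le> z" .
    qed
  qed
  have Off: "bd (4 * \<mu>) Off (4000 * C * z)"
  proof -
    let ?w = "4000 * C * \<nu> ^ (D - 1) * real M ^ (D - 1)"
    let ?t = "\<lambda>c c' y a b p. h c (y(j := b, i := a)) p * h c' (y(j := b, i := a)) p *
      (g c (y(j := b, i := a)) p * g c' (y(j := b, i := a)) p)"
    have one: "bd (4 * \<mu>) (\<lambda>p. \<Sum>a<M. \<Sum>b<M. ?t c c' y a b p) ?w" if cc: "c \<noteq> c'" for c c' y
    proof -
      have rem: "(\<forall>l\<in>A. Q l ((y(j := b, i := a)) l)) \<longleftrightarrow> Q i a \<and> (\<forall>l\<in>A - {i}. Q l (y l))"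
        "(\<forall>l\<in>B. Q l ((y(j := b, i := a)) l)) \<longleftrightarrow> Q j b \<and> (\<forall>l\<in>B - {j}. Q l (y l))" for a b Q
        using i j ij by (intro ball_remove; auto)+
      have hs: "slice R k A B c (y(j := b, i := a)) = {r\<in>slice R k (A - {i}) (B - {j}) c y. r i = a \<and> r j < b}" for a b c
        unfolding slice_def rem(1)[where ?Q1="\<lambda>l v. r l = v" for r] rem(2)[where ?Q1="\<lambda>l v. r l < v" for r] by blast
      have gs: "slice S k B A c (y(j := b, i := a)) = {s\<in>slice S k (B - {j}) (A - {i}) c y. s j = b \<and> s i < a}" for a b c
        unfolding slice_def rem(2)[where ?Q1="\<lambda>l v. r l = v" for r] rem(1)[where ?Q1="\<lambda>l v. r l < v" for r] by blast
      have agS': "agree_on S (V - (B \<union> A) - {k})" using agS by (simp add: Un_commute)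
      have sl: "slice R k (A - {i}) (B - {j}) c y \<subseteq> X" "slice S k (B - {j}) (A - {i}) c y \<subseteq> X" for c
        using slice_subset R S by blast+
      have kV: "k \<in> V" using k by simp
      show ?thesis
        unfolding h_def g_def hs gs card_D[symmetric]
      proof (rule cross_sum_bd[OF A B AB i j sl(1) sl(1) sl(2) sl(2)
            slice_agree[OF agR] slice_agree[OF agR] slice_agree[OF agS'] slice_agree[OF agS'] _ _ C])
        show "\<exists>l\<in>B. r l \<noteq> s l" if "r \<in> slice R k (A - {i}) (B - {j}) c y"
          "s \<in> slice R k (A - {i}) (B - {j}) c' y" "r i = s i" for r s
          by (rule slice_distinct[OF R kV agR cc that])
        show "\<exists>l\<in>A. r l \<noteq> s l" if "r \<in> slice S k (B - {j}) (A - {i}) c y"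
          "s \<in> slice S k (B - {j}) (A - {i}) c' y" "r j = s j" for r s
          by (rule slice_distinct[OF S kV agS' cc that])
        show "distinct_bound D' C" if "1 \<le> D'" "D' < card (A \<union> B)" for D'
          using db that card_D by simp
      qed
    qed
    have "bd (4 * \<mu>) Off (real (card J) * (real M * (real (card (levels L0)) * ?w)))"
      unfolding Off_def
    proof (rule bd_sum_const)
      fix c assume "c \<in> J"
      have "bd (4 * \<mu>) (\<lambda>p. \<Sum>c'\<in>J - {c}. \<Sum>y\<in>levels L0. \<Sum>a<M. \<Sum>b<M. ?t c c' y a b p)
          (real (card (J - {c})) * (real (card (levels L0)) * ?w))"
        using kappa_pos finJ finL0 by (intro bd_sum_const one finite_PiE) auto
      then show "bd (4 * \<mu>) (\<lambda>p. \<Sum>c'\<in>J - {c}. \<Sum>y\<in>levels L0. \<Sum>a<M. \<Sum>b<M. ?t c c' y a b p)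
          (real M * (real (card (levels L0)) * ?w))"
      proof (rule bd_weaken)
        have "card (J - {c}) \<le> M" using cardJ card_Diff1_le[of J c] by simp
        then show "real (card (J - {c})) * (real (card (levels L0)) * ?w) \<le> real M * (real (card (levels L0)) * ?w)"
          using C by (intro mult_right_mono mult_nonneg_nonneg) auto
      qed
    qed (use kappa_pos finJ in auto)
    \<comment> \<open>Nothing is lost: at most \<open>M\<close> values of \<open>c'\<close>,
      \<open>M ^ (D - 2)\<close> fixed levels and the factor \<open>M ^ (D - 1)\<close> from
      \<open>cross_sum_bd\<close> combine to \<open>M ^ (2 * D - 2)\<close>.\<close>
    moreover have "real (card J) * (real M * (real (card (levels L0)) * ?w)) = 4000 * C * z"
    proof -
      have e: "1 + (D - 2) + (D - 1) = 2 * D - 2" using cA cB card_AB by simp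
      have "real (card J) * (real M * (real (card (levels L0)) * ?w))
          = 4000 * C * (\<nu> ^ (D - 1) * real (card J) * (real M ^ 1 * real M ^ (D - 2) * real M ^ (D - 1)))"
        by (simp add: card_PiE_levels[OF finL0] cardL0)
      then show ?thesis unfolding power_add[symmetric] e z_def .
    qed
    ultimately show ?thesis by (simp only:)
  qed
  have "bd (4 * \<mu>) (\<lambda>p. Diag p + Off p) (z + 4000 * C * z)"
    using kappa_pos Diag Off by (intro bd_add) auto
  then show ?thesis
    by (simp only: expand[abs_def] z_def distrib_right mult.assoc mult_1)
qed

lemma pattern_step:
  assumes D: "1 \<le> D" and C: "0 \<le> C" and db: "\<And>D'. 1 \<le> D' \<Longrightarrow> D' < D \<Longrightarrow> distinct_bound D' C"
  shows "pattern_bound D (1 + 4000 * C)"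
  unfolding pattern_bound_def
proof (intro allI impI)
  fix A B k R S J
  assume AB: "A \<inter> B = {}" and adm: "admissible (A \<union> B) k R S J" and card_D: "card (A \<union> B) = D"
  have weaken: "\<nu> ^ (D - 1) * real (card J) * real M ^ (2 * D - 2)
      \<le> (1 + 4000 * C) * \<nu> ^ (D - 1) * real (card J) * real M ^ (2 * D - 2)"
    using C by (simp add: mult.assoc mult_right_mono distrib_right)
  have "A \<union> B \<noteq> {}" using card_D D by (metis card.empty not_one_le_zero)
  then consider "B = {}" "A \<noteq> {}" | "A = {}" "B \<noteq> {}" | "A \<noteq> {}" "B \<noteq> {}" by blast
  then show "bd (4 * \<mu>) (sq_fun M (A \<union> B) max_lev ff (pattern_pairs k R S A B))
       ((1 + 4000 * C) * \<nu> ^ (D - 1) * real (card J) * real M ^ (2 * D - 2))"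
  proof cases
    case 1
    have "bd (4 * \<mu>) (sq_fun M A max_lev ff (pattern_pairs k R S A {}))
        (\<nu> ^ (card A - 1) * real (card J) * real M ^ (2 * card A - 2))"
      using 1 adm by (intro one_sided_pattern_bd) auto
    then show ?thesis using 1 card_D bd_weaken[OF _ weaken] by simp
  next
    case 2
    have "bd (4 * \<mu>) (sq_fun M B max_lev ff (pattern_pairs k S R B {}))
        (\<nu> ^ (card B - 1) * real (card J) * real M ^ (2 * card B - 2))"
      using 2 adm by (intro one_sided_pattern_bd) (auto simp: admissible_def)
    moreover have "sq_fun M B max_lev ff (pattern_pairs k S R B {}) = sq_fun M B max_lev ff (pattern_pairs k R S {} B)"
      by (rule ext) (rule sq_fun_pattern_swap)
    ultimately show ?thesis using 2 card_D bd_weaken[OF _ weaken] by simp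
  next
    case 3
    show ?thesis
      using mixed_pattern_bd[OF 3 AB adm card_D C db] .
  qed
qed

lemma pattern_bound_mono: "pattern_bound D C \<Longrightarrow> C \<le> C' \<Longrightarrow> pattern_bound D C'"
  unfolding pattern_bound_def[of D C'] by (auto intro!: bd_weaken[OF pattern_boundD] mult_right_mono)

lemma distinct_bound_mono: "distinct_bound D C \<Longrightarrow> C \<le> C' \<Longrightarrow> distinct_bound D C'"
  unfolding distinct_bound_def[of D C'] by (auto intro!: bd_weaken[OF distinct_boundD] mult_right_mono)

text \<open>\<open>cross_sum_bd\<close> draws on every smaller number of coordinates, so one
  constant is carried for all \<open>D' \<le> D\<close>.\<close>

lemma pattern_bounds: "1 \<le> D' \<Longrightarrow> D' \<le> D \<Longrightarrow> pattern_bound D' (bound_const D)"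
proof (induction D arbitrary: D')
  case (Suc D)
  have db: "distinct_bound D'' (16 ^ D * bound_const D)" if D'': "1 \<le> D''" "D'' \<le> D" for D''
  proof -
    have "distinct_bound D'' (16 ^ D'' * bound_const D)"
      using D'' Suc.IH by (intro distinct_bound_if_pattern_bound bound_const_nonneg) auto
    then show ?thesis
      using D'' bound_const_nonneg by (elim distinct_bound_mono) (auto intro: mult_right_mono power_increasing)
  qed
  show ?case
  proof (cases "D' \<le> D")
    case True
    have "bound_const D \<le> 16 ^ D * bound_const D"
      using mult_right_mono[of 1 "16 ^ D" "bound_const D"] bound_const_nonneg by simp
    then have "bound_const D \<le> bound_const (Suc D)" using bound_const_le_Suc[of D] by linarith
    then show ?thesis using Suc True pattern_bound_mono by blast
  next
    case False
    then show ?thesis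
      using pattern_step[of D' "16 ^ D * bound_const D"] db Suc.prems bound_const_nonneg by simp
  qed
qed simp

text \<open>All coordinates but \<open>k\<close> are free and all coincidence values are allowed, so
  \<open>D = card V - 1\<close> and \<open>card J = M\<close>. The square root of
  \<open>M ^ (2 * card V - 3)\<close> is the power \<open>card V - 3 / 2\<close> of the
  theorem.\<close>

theorem coincidence_bd:
  assumes k: "k \<in> V" and V: "2 \<le> card V" and R: "R \<subseteq> X" and S: "S \<subseteq> X"
  shows "bd (8 * \<mu>) (\<lambda>p. \<Sum>(r, s)\<in>{(r, s). r \<in> R \<and> s \<in> S \<and> r k = s k \<and> (\<exists>l\<in>V - {k}. r l \<noteq> s l)}. f r p * f s p)
    (sqrt (16 ^ (card V - 1) * bound_const (card V - 1) * \<nu> ^ (2 * card V - 3) * real M ^ (2 * card V - 3)))"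
proof -
  let ?D = "card V - 1"
  let ?z = "16 ^ ?D * bound_const ?D * \<nu> ^ (2 * card V - 3) * real M ^ (2 * card V - 3)"
  let ?P = "distinct_pairs k R S (V - {k}) {}"
  have cV: "card (V - {k}) = ?D" using k finite_V by simp
  have db: "distinct_bound ?D (16 ^ ?D * bound_const ?D)"
    using V pattern_bounds bound_const_nonneg by (intro distinct_bound_if_pattern_bound) auto
  have "bd (4 * \<mu>) (sq_fun M {} max_lev ff ?P)
      (16 ^ ?D * bound_const ?D * \<nu> ^ (2 * ?D - 1 - card ({} :: nat set)) * real (card {..<M}) * real M ^ (2 * ?D - 2))"
  proof (rule distinct_boundD[OF db])
    show "admissible (V - {k}) k R S {..<M}"
      using k R S level_less by (auto simp: admissible_def agree_on_def)
  qed (use cV in auto)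
  also have "16 ^ ?D * bound_const ?D * \<nu> ^ (2 * ?D - 1 - card ({} :: nat set)) * real (card {..<M}) * real M ^ (2 * ?D - 2)
      = ?z"
  proof -
    have "2 * ?D - 1 - card ({} :: nat set) = 2 * card V - 3" by simp
    moreover have "real (card {..<M}) * real M ^ (2 * ?D - 2) = real M ^ (2 * card V - 3)"
    proof -
      have "2 * card V - 3 = Suc (2 * ?D - 2)" using V by simp
      then show ?thesis by (simp only: power_Suc card_lessThan)
    qed
    ultimately show ?thesis by (simp only: mult.assoc)
  qed
  also have "\<dots> = (sqrt ?z)\<^sup>2"
    using bound_const_nonneg by simp
  finally have "bd (4 * \<mu>) (\<lambda>p. (\<Sum>\<pi>\<in>?P. ff \<pi> p)\<^sup>2)
      ((sqrt ?z)\<^sup>2)"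
    by (simp add: sq_fun_empty[abs_def])
  then have "bd (2 * (4 * \<mu>)) (\<lambda>p. \<Sum>\<pi>\<in>?P. ff \<pi> p)
      (sqrt ?z)"
    using bound_const_nonneg by (subst (asm) bd_sq) auto
  then show ?thesis by (simp add: distinct_pairs_def ff_def case_prod_unfold)
qed

end

section \<open>Transfer to the unit cube\<close>

definition dyadic_cell :: "nat \<Rightarrow> nat \<Rightarrow> real set" where
  "dyadic_cell t i = {real i / 2 ^ t..<(real i + 1) / 2 ^ t}"

lemma dyadic_intervals_of_level:
  "{I. dyadic_interval I \<and> I \<subseteq> {0..1} \<and> measure lborel I = 1 / 2 ^ t} \<subseteq> dyadic_cell t ` {..<2 ^ t}"
proof
  fix I assume "I \<in> {I. dyadic_interval I \<and> I \<subseteq> {0..1} \<and> measure lborel I = 1 / 2 ^ t}"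
  then have I: "dyadic_interval I" "I \<subseteq> {0..1}" "measure lborel I = 1 / 2 ^ t" by auto
  obtain j k :: int where jk: "I = {of_int j * 2 powi k ..< (of_int j + 1) * 2 powi k}"
    using I(1) by (auto simp: dyadic_interval_def)
  have pos: "(0::real) < 2 powi k" by simp
  have "measure lborel I = 2 powi k"
    unfolding jk using pos by (simp add: measure_def algebra_simps)
  with I(3) have k: "2 powi k = (1 / 2 ^ t :: real)" by simp
  have Ieq: "I = {of_int j / 2 ^ t..<(of_int j + 1) / 2 ^ t}" by (simp add: jk k)
  \<comment> \<open>The left end alone would not exclude \<open>j = 2 ^ t\<close>, and the right end
    is not in \<open>I\<close>; hence the midpoint.\<close>
  have "of_int j / 2 ^ t \<in> I" "(of_int j + 1 / 2) / 2 ^ t \<in> I"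
    unfolding Ieq by (auto simp: divide_strict_right_mono divide_right_mono)
  with I(2) have "0 \<le> of_int j / (2 ^ t :: real)" "(of_int j + 1 / 2) / (2 ^ t :: real) \<le> 1" by auto
  moreover have "\<not> (2::real) ^ t \<le> 0" by (simp add: not_le)
  ultimately have j0: "0 \<le> j" and "real_of_int j + 1 / 2 \<le> 2 ^ t" by (auto simp: zero_le_divide_iff)
  then have "real_of_int j < 2 ^ t" by linarith
  then have "j < 2 ^ t" by (metis of_int_less_iff of_int_numeral of_int_power)
  then have "nat j < 2 ^ t" using j0 by (simp add: nat_less_iff)
  moreover have "I = dyadic_cell t (nat j)" using j0 by (simp add: Ieq dyadic_cell_def)
  ultimately show "I \<in> dyadic_cell t ` {..<2 ^ t}" by blast
qed

text \<open>In the integer \<open>nat \<lfloor>2 ^ Suc t * y\<rfloor>\<close> the last binary digit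
  selects the half and the others the cell. For negative \<open>y\<close> the conversion
  \<open>nat\<close> would give 0, which belongs to the cell at the origin.\<close>

lemma haar_dyadic_cell:
  assumes y: "0 \<le> y"
  shows "haar (dyadic_cell t i) y
    = (if nat \<lfloor>2 ^ Suc t * y\<rfloor> = 2 * i then -1 else if nat \<lfloor>2 ^ Suc t * y\<rfloor> = 2 * i + 1 then 1 else 0)"
proof -
  have lt: "real i / 2 ^ t < (real i + 1) / 2 ^ t" by (simp add: divide_strict_right_mono)
  have inf: "Inf (dyadic_cell t i) = real i / 2 ^ t" "Sup (dyadic_cell t i) = (real i + 1) / 2 ^ t"
    unfolding dyadic_cell_def using lt by simp_all
  have mid: "(Inf (dyadic_cell t i) + Sup (dyadic_cell t i)) / 2 = (2 * real i + 1) / 2 ^ Suc t"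
    unfolding inf by (simp add: field_simps)
  have fl: "nat \<lfloor>2 ^ Suc t * y\<rfloor> = q \<longleftrightarrow> real q \<le> 2 ^ Suc t * y \<and> 2 ^ Suc t * y < real q + 1" for q
  proof -
    have "0 \<le> \<lfloor>2 ^ Suc t * y\<rfloor>" using y by simp
    then have "nat \<lfloor>2 ^ Suc t * y\<rfloor> = q \<longleftrightarrow> \<lfloor>2 ^ Suc t * y\<rfloor> = int q" by auto
    then show ?thesis by (simp add: floor_eq_iff del: power_Suc)
  qed
  have p: "(0::real) < 2 ^ t" "(0::real) < 2 ^ Suc t" by simp_all
  have "y \<in> left_half (dyadic_cell t i) \<longleftrightarrow> nat \<lfloor>2 ^ Suc t * y\<rfloor> = 2 * i"
    unfolding fl left_half_def mid mem_Collect_eq dyadic_cell_def using p by (auto simp: field_simps)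
  moreover have "y \<in> right_half (dyadic_cell t i) \<longleftrightarrow> nat \<lfloor>2 ^ Suc t * y\<rfloor> = 2 * i + 1"
    unfolding fl right_half_def mid mem_Collect_eq dyadic_cell_def using p by (auto simp: field_simps)
  ultimately show ?thesis by (auto simp: haar_def indicator_def)
qed

lemma dyadic_rects_side:
  assumes "R \<in> dyadic_rects d r" "j \<in> {1..d}"
  obtains i where "i < 2 ^ r j" "R j = dyadic_cell (r j) i"
proof -
  have "R j \<in> {I. dyadic_interval I \<and> I \<subseteq> {0..1} \<and> measure lborel I = 1 / 2 ^ r j}"
    using assms unfolding dyadic_rects_def by (rule PiE_mem)
  then have "R j \<in> dyadic_cell (r j) ` {..<2 ^ r j}" using dyadic_intervals_of_level by blast
  then show ?thesis using that by blast
qed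

lemma haar_side_cong:
  assumes "R \<in> dyadic_rects d r" "j \<in> {1..d}" "0 \<le> x" "0 \<le> y"
    "nat \<lfloor>2 ^ Suc (r j) * x\<rfloor> = nat \<lfloor>2 ^ Suc (r j) * y\<rfloor>"
  shows "haar (R j) x = haar (R j) y"
proof -
  obtain i where "R j = dyadic_cell (r j) i" using dyadic_rects_side[OF assms(1,2)] .
  then show ?thesis using haar_dyadic_cell[OF assms(3)] haar_dyadic_cell[OF assms(4)] assms(5) by simp
qed

lemma r_function_cong:
  assumes "\<And>j. j \<in> {1..d} \<Longrightarrow> 0 \<le> x j" "\<And>j. j \<in> {1..d} \<Longrightarrow> 0 \<le> y j"
    "\<And>j. j \<in> {1..d} \<Longrightarrow> nat \<lfloor>2 ^ Suc (r j) * x j\<rfloor> = nat \<lfloor>2 ^ Suc (r j) * y j\<rfloor>"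
  shows "r_function d \<alpha> r x = r_function d \<alpha> r y"
  unfolding r_function_def haar_rect_def
proof (intro sum.cong refl arg_cong2[where f="(*)"] prod.cong)
  fix R j assume "R \<in> dyadic_rects d r" "j \<in> {1..d}"
  then show "haar (R j) (x j) = haar (R j) (y j)" using assms by (intro haar_side_cong) auto
qed

text \<open>The last two assumptions say that the last binary digit of the integer is toggled. This
  exchanges the two halves of one cell in coordinate \<open>l\<close>, so every
  \<open>haar_rect\<close> changes its sign or stays 0.\<close>

lemma r_function_flip:
  assumes "l \<in> {1..d}" and "\<And>j. j \<in> {1..d} \<Longrightarrow> 0 \<le> x j" "\<And>j. j \<in> {1..d} \<Longrightarrow> 0 \<le> y j"
    "\<And>j. j \<in> {1..d} - {l} \<Longrightarrow> x j = y j"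
    "even (nat \<lfloor>2 ^ Suc (r l) * x l\<rfloor>) \<Longrightarrow> nat \<lfloor>2 ^ Suc (r l) * y l\<rfloor> = nat \<lfloor>2 ^ Suc (r l) * x l\<rfloor> + 1"
    "odd (nat \<lfloor>2 ^ Suc (r l) * x l\<rfloor>) \<Longrightarrow> nat \<lfloor>2 ^ Suc (r l) * x l\<rfloor> = nat \<lfloor>2 ^ Suc (r l) * y l\<rfloor> + 1"
  shows "r_function d \<alpha> r y = - r_function d \<alpha> r x"
proof -
  have "haar_rect d R y = - haar_rect d R x" if R: "R \<in> dyadic_rects d r" for R
  proof -
    obtain i where i: "R l = dyadic_cell (r l) i" using dyadic_rects_side[OF R assms(1)] .
    let ?qx = "nat \<lfloor>2 ^ Suc (r l) * x l\<rfloor>" and ?qy = "nat \<lfloor>2 ^ Suc (r l) * y l\<rfloor>"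
    have "haar (R l) (y l) = - haar (R l) (x l)"
      unfolding i haar_dyadic_cell[OF assms(2)[OF assms(1)]] haar_dyadic_cell[OF assms(3)[OF assms(1)]]
    proof (cases "even ?qx")
      case True
      then obtain m where "?qx = 2 * m" by (elim evenE)
      moreover from this have "?qy = 2 * m + 1" using assms(5) True by simp
      ultimately show "(if ?qy = 2 * i then -1 else if ?qy = 2 * i + 1 then 1 else 0)
          = - (if ?qx = 2 * i then -1 else if ?qx = 2 * i + 1 then 1 else 0 :: real)" by (simp; presburger)
    next
      case False
      then obtain m where "?qx = 2 * m + 1" by (elim oddE)
      moreover from this have "?qy = 2 * m" using assms(6) False by simp
      ultimately show "(if ?qy = 2 * i then -1 else if ?qy = 2 * i + 1 then 1 else 0)
          = - (if ?qx = 2 * i then -1 else if ?qx = 2 * i + 1 then 1 else 0 :: real)" by (simp; presburger)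
    qed
    moreover have "(\<Prod>j\<in>{1..d} - {l}. haar (R j) (y j)) = (\<Prod>j\<in>{1..d} - {l}. haar (R j) (x j))"
      using assms(4) by (intro prod.cong) auto
    moreover have "haar_rect d R z = haar (R l) (z l) * (\<Prod>j\<in>{1..d} - {l}. haar (R j) (z j))" for z
      unfolding haar_rect_def using assms(1) by (intro prod.remove) auto
    ultimately show ?thesis by simp
  qed
  then show ?thesis by (simp add: r_function_def sum_negf)
qed

text \<open>Rectangles of one shape are disjoint, so only \<open>R0\<close>, the one around
  \<open>x\<close>, can contribute. It does not occur in the sum when \<open>x\<close> lies outside
  the half-open cube.\<close>

lemma r_function_bounded:
  assumes "\<And>j. j \<in> {1..d} \<Longrightarrow> 0 \<le> x j"
  shows "\<bar>r_function d \<alpha> r x\<bar> \<le> 1"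
proof -
  define R0 where "R0 = (\<lambda>j\<in>{1..d}. dyadic_cell (r j) (nat \<lfloor>2 ^ Suc (r j) * x j\<rfloor> div 2))"
  let ?t = "\<lambda>R. sgn_pm (\<alpha> R) * haar_rect d R x"
  have z: "haar_rect d R x = 0" if R: "R \<in> dyadic_rects d r" "R \<noteq> R0" for R
  proof -
    have "\<exists>j\<in>{1..d}. R j \<noteq> R0 j"
    proof (rule ccontr)
      assume "\<not> ?thesis"
      moreover have "R \<in> extensional {1..d}" "R0 \<in> extensional {1..d}"
        using R(1) by (auto simp: dyadic_rects_def R0_def PiE_def)
      ultimately have "R = R0" by (intro extensionalityI) auto
      with R(2) show False ..
    qed
    then obtain j where j: "j \<in> {1..d}" "R j \<noteq> R0 j" by blast
    obtain i where i: "R j = dyadic_cell (r j) i" using dyadic_rects_side[OF R(1) j(1)] .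
    have "i \<noteq> nat \<lfloor>2 ^ Suc (r j) * x j\<rfloor> div 2" using j i by (auto simp: R0_def)
    then have "haar (R j) (x j) = 0"
      unfolding i haar_dyadic_cell[OF assms[OF j(1)]] by auto
    then show ?thesis unfolding haar_rect_def using j(1) by (intro prod_zero) auto
  qed
  have "\<bar>haar_rect d R x\<bar> \<le> 1" for R
    unfolding haar_rect_def abs_prod
    by (intro prod_le_1) (auto simp: haar_def left_half_def right_half_def indicator_def)
  then have le: "\<bar>?t R\<bar> \<le> 1" for R by (simp add: abs_mult sgn_pm_def)
  have "r_function d \<alpha> r x = (\<Sum>R\<in>dyadic_rects d r \<inter> {R0}. ?t R)"
    unfolding r_function_def using z finite_dyadic_rects by (intro sum.mono_neutral_right) auto
  also have "\<bar>\<dots>\<bar> \<le> 1"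
  proof (cases "R0 \<in> dyadic_rects d r")
    case True
    then have "dyadic_rects d r \<inter> {R0} = {R0}" by blast
    then show ?thesis using le[of R0] by simp
  qed simp
  finally show ?thesis .
qed

text \<open>Dyadic intervals are half-open, so none inside \<open>{0..1}\<close> contains 1. This
  settles the upper faces of the closed cube without an argument on null sets.\<close>

lemma r_function_at_one:
  assumes "l \<in> {1..d}" "x l = 1"
  shows "r_function d \<alpha> r x = 0"
proof -
  have "haar_rect d R x = 0" if R: "R \<in> dyadic_rects d r" for R
  proof -
    obtain i where i: "i < 2 ^ r l" "R l = dyadic_cell (r l) i" using dyadic_rects_side[OF R assms(1)] .
    have "\<lfloor>2 ^ Suc (r l) * (1::real)\<rfloor> = 2 ^ Suc (r l)"
    proof -
      have "2 ^ Suc (r l) * (1::real) = real_of_int (2 ^ Suc (r l))" by simp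
      then show ?thesis by (simp only: floor_of_int)
    qed
    then have "nat \<lfloor>2 ^ Suc (r l) * (1::real)\<rfloor> = 2 ^ Suc (r l)"
      by (simp only: nat_power_eq) (simp add: nat_mult_distrib nat_power_eq)
    moreover have "2 * i + 1 < 2 ^ Suc (r l)" using i(1) by simp
    ultimately have "haar (R l) (x l) = 0"
      unfolding i(2) assms(2) using haar_dyadic_cell[of 1 "r l" i] by simp
    then show ?thesis unfolding haar_rect_def using assms(1) by (intro prod_zero) auto
  qed
  then show ?thesis by (simp add: r_function_def)
qed

section \<open>The grid of points with \<open>n + 1\<close> binary digits in each coordinate\<close>

definition grid :: "nat \<Rightarrow> nat \<Rightarrow> (nat \<Rightarrow> nat) set" where
  "grid d n = {1..d} \<rightarrow>\<^sub>E {..<2 ^ Suc n}"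

text \<open>Bit \<open>n - b\<close> of a coordinate is the binary digit from which a Haar function
  of level \<open>b\<close> takes its sign. There is no such digit for \<open>b > n\<close>, and
  there the identity keeps the map a bijection.\<close>

definition grid_flip :: "nat \<Rightarrow> nat \<Rightarrow> nat \<Rightarrow> nat \<Rightarrow> (nat \<Rightarrow> nat) \<Rightarrow> nat \<Rightarrow> nat" where
  "grid_flip d n l b k = (if l \<in> {1..d} \<and> b \<le> n then k(l := flip_bit (n - b) (k l)) else k)"

definition grid_point :: "nat \<Rightarrow> nat \<Rightarrow> (nat \<Rightarrow> nat) \<Rightarrow> nat \<Rightarrow> real" where
  "grid_point d n k = (\<lambda>j\<in>{1..d}. real (k j) / 2 ^ Suc n)"

lemma finite_grid: "finite (grid d n)"
  by (simp add: grid_def finite_PiE)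

lemma card_grid: "card (grid d n) = (2 ^ Suc n) ^ d"
  by (simp add: grid_def card_PiE)

lemma flip_bit_flip_bit: "flip_bit m (flip_bit m (a::nat)) = a"
  by (rule bit_eqI) (auto simp: bit_flip_bit_iff)

lemma flip_bit_less: "a < 2 ^ N \<Longrightarrow> m < N \<Longrightarrow> flip_bit m (a::nat) < 2 ^ N"
  by (metis not_le take_bit_flip_bit_eq take_bit_nat_eq_self_iff)

lemma grid_flip_in: "k \<in> grid d n \<Longrightarrow> grid_flip d n l b k \<in> grid d n"
  using flip_bit_less[of _ "Suc n" "n - b"]
  by (auto simp: grid_flip_def grid_def PiE_iff extensional_def split: if_splits simp del: power_Suc)

lemma grid_flip_space: "flip_space (grid d n) (grid_flip d n)"
proof
  show "finite (grid d n)" by (rule finite_grid)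
  show "grid d n \<noteq> {}" by (simp add: grid_def PiE_eq_empty_iff lessThan_empty_iff)
  show "bij_betw (grid_flip d n l b) (grid d n) (grid d n)" for l b
    by (rule bij_betw_byWitness[where f'="grid_flip d n l b"])
      (auto intro: grid_flip_in, auto simp: grid_flip_def flip_bit_flip_bit)
qed

lemma floor_rescale:
  assumes "s \<le> N" "0 \<le> (y::real)"
  shows "nat \<lfloor>2 ^ s * y\<rfloor> = nat \<lfloor>2 ^ N * y\<rfloor> div 2 ^ (N - s)"
proof -
  have "(2::real) ^ N = 2 ^ s * 2 ^ (N - s)" using assms(1) by (simp flip: power_add)
  then have "2 ^ s * y = (2 ^ N * y) / real_of_int (2 ^ (N - s))" by simp
  also have "\<lfloor>(2 ^ N * y) / real_of_int (2 ^ (N - s))\<rfloor> = \<lfloor>2 ^ N * y\<rfloor> div 2 ^ (N - s)"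
    by (rule floor_divide_real_eq_div) simp
  finally have "\<lfloor>2 ^ s * y\<rfloor> = \<lfloor>2 ^ N * y\<rfloor> div 2 ^ (N - s)" .
  moreover have "0 \<le> \<lfloor>2 ^ N * y\<rfloor>" using assms(2) by simp
  ultimately show ?thesis by (simp add: nat_div_distrib nat_power_eq)
qed

lemma floor_grid_point:
  assumes "j \<in> {1..d}" "t \<le> n"
  shows "nat \<lfloor>2 ^ Suc t * grid_point d n k j\<rfloor> = k j div 2 ^ (n - t)"
proof -
  have "2 ^ Suc n * grid_point d n k j = real (k j)"
    using assms(1) by (simp add: grid_point_def del: power_Suc)
  moreover have "nat \<lfloor>2 ^ Suc t * grid_point d n k j\<rfloor> = nat \<lfloor>2 ^ Suc n * grid_point d n k j\<rfloor> div 2 ^ (Suc n - Suc t)"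
    using assms by (intro floor_rescale) (auto simp: grid_point_def)
  ultimately show ?thesis by (simp del: power_Suc)
qed

lemma grid_point_nonneg: "j \<in> {1..d} \<Longrightarrow> 0 \<le> grid_point d n k j"
  by (simp add: grid_point_def)

lemma flip_bit_div_high: "e' < e \<Longrightarrow> flip_bit e' (a::nat) div 2 ^ e = a div 2 ^ e"
  unfolding drop_bit_eq_div[symmetric]
  by (rule bit_eqI) (auto simp: bit_drop_bit_eq bit_flip_bit_iff)

lemma flip_bit_div_same:
  "even (a div 2 ^ e) \<Longrightarrow> flip_bit e (a::nat) div 2 ^ e = a div 2 ^ e + 1"
  "odd (a div 2 ^ e) \<Longrightarrow> a div 2 ^ e = flip_bit e (a::nat) div 2 ^ e + 1"
proof -
  have eq: "flip_bit e a div 2 ^ e = flip_bit 0 (a div 2 ^ e)"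
    unfolding drop_bit_eq_div[symmetric]
    by (rule bit_eqI) (auto simp: bit_drop_bit_eq bit_flip_bit_iff)
  have fb: "flip_bit 0 q = (if even q then q + 1 else q - 1)" for q :: nat
    by (auto simp: flip_bit_eq_if set_bit_0 unset_bit_0 bit_0 elim!: evenE oddE)
  show "even (a div 2 ^ e) \<Longrightarrow> flip_bit e a div 2 ^ e = a div 2 ^ e + 1" by (simp add: eq fb)
  show "odd (a div 2 ^ e) \<Longrightarrow> a div 2 ^ e = flip_bit e a div 2 ^ e + 1"
    by (simp add: eq fb odd_pos)
qed

lemma hyperbolic_level_le: "r \<in> hyperbolic_vectors d n \<Longrightarrow> j \<in> {1..d} \<Longrightarrow> r j \<le> n"
  using member_le_sum[of j "{1..d}" r] by (auto simp: hyperbolic_vectors_def)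

lemma hyperbolic_ext:
  assumes "r \<in> hyperbolic_vectors d n" "s \<in> hyperbolic_vectors d n" "\<And>j. j \<in> {1..d} \<Longrightarrow> r j = s j"
  shows "r = s"
  using assms by (intro extensionalityI[of r "{1..d}" s]) (auto simp: hyperbolic_vectors_def PiE_def)

lemma grid_haar_family:
  assumes "1 \<le> \<mu>"
  shows "haar_family (grid d n) (grid_flip d n) {1..d} (hyperbolic_vectors d n) (Suc n) \<mu>
    (\<lambda>r k. r_function d \<alpha> r (grid_point d n k))"
proof -
  interpret flip_space "grid d n" "grid_flip d n" by (rule grid_flip_space)
  show ?thesis
  proof
    show "finite {1..d}" "finite (hyperbolic_vectors d n)" "1 \<le> Suc n" "1 \<le> \<mu>"
      using assms finite_hyperbolic_vectors by auto
    show "r l < Suc n" if "r \<in> hyperbolic_vectors d n" "l \<in> {1..d}" for r l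
      using hyperbolic_level_le[OF that] by simp
    show "r = s" if r: "r \<in> hyperbolic_vectors d n" and s: "s \<in> hyperbolic_vectors d n"
      and l: "l \<in> {1..d}" and eq: "\<And>j. j \<in> {1..d} - {l} \<Longrightarrow> r j = s j" for r s l
    proof (rule hyperbolic_ext[OF r s])
      have "r l + (\<Sum>j\<in>{1..d} - {l}. r j) = s l + (\<Sum>j\<in>{1..d} - {l}. s j)"
        using r s l by (simp add: hyperbolic_vectors_def sum.remove[symmetric])
      moreover have "(\<Sum>j\<in>{1..d} - {l}. r j) = (\<Sum>j\<in>{1..d} - {l}. s j)"
        using eq by (intro sum.cong) auto
      ultimately have "r l = s l" by simp
      then show "r j = s j" if "j \<in> {1..d}" for j using eq that by (cases "j = l") auto
    qed
    show "\<bar>r_function d \<alpha> r (grid_point d n k)\<bar> \<le> 1" for r k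
      by (rule r_function_bounded) (rule grid_point_nonneg)
    show "haar_at l (r l) (\<lambda>k. r_function d \<alpha> r (grid_point d n k))"
      if r: "r \<in> hyperbolic_vectors d n" and l: "l \<in> {1..d}" for r l
      unfolding haar_at_def
    proof (intro ballI conjI allI impI)
      fix k
      have rl: "r j \<le> n" if "j \<in> {1..d}" for j using hyperbolic_level_le[OF r that] .
      have fl: "grid_flip d n l (r l) k = k(l := flip_bit (n - r l) (k l))"
        using l rl by (simp add: grid_flip_def)
      show "r_function d \<alpha> r (grid_point d n (grid_flip d n l (r l) k)) = - r_function d \<alpha> r (grid_point d n k)"
      proof (rule r_function_flip[OF l])
        show "grid_point d n k j = grid_point d n (grid_flip d n l (r l) k) j" if "j \<in> {1..d} - {l}" for j
          using that by (simp add: fl grid_point_def)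
        show "nat \<lfloor>2 ^ Suc (r l) * grid_point d n (grid_flip d n l (r l) k) l\<rfloor>
            = nat \<lfloor>2 ^ Suc (r l) * grid_point d n k l\<rfloor> + 1"
          if "even (nat \<lfloor>2 ^ Suc (r l) * grid_point d n k l\<rfloor>)"
          using that unfolding floor_grid_point[OF l rl[OF l]] fl fun_upd_same by (rule flip_bit_div_same(1))
        show "nat \<lfloor>2 ^ Suc (r l) * grid_point d n k l\<rfloor>
            = nat \<lfloor>2 ^ Suc (r l) * grid_point d n (grid_flip d n l (r l) k) l\<rfloor> + 1"
          if "odd (nat \<lfloor>2 ^ Suc (r l) * grid_point d n k l\<rfloor>)"
          using that unfolding floor_grid_point[OF l rl[OF l]] fl fun_upd_same by (rule flip_bit_div_same(2))
      qed (auto intro: grid_point_nonneg)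
      fix b assume b: "r l < b"
      show "r_function d \<alpha> r (grid_point d n (grid_flip d n l b k)) = r_function d \<alpha> r (grid_point d n k)"
      proof (rule r_function_cong)
        fix j assume j: "j \<in> {1..d}"
        show "nat \<lfloor>2 ^ Suc (r j) * grid_point d n (grid_flip d n l b k) j\<rfloor> = nat \<lfloor>2 ^ Suc (r j) * grid_point d n k j\<rfloor>"
          unfolding floor_grid_point[OF j rl[OF j]] using b by (auto simp: grid_flip_def flip_bit_div_high)
      qed (auto intro: grid_point_nonneg)
    qed
  qed
qed

section \<open>Integrals of step functions on the cube\<close>

lemma mem_dyadic_cell: "y \<in> dyadic_cell t i \<longleftrightarrow> 0 \<le> y \<and> nat \<lfloor>2 ^ t * y\<rfloor> = i"
proof (cases "0 \<le> y")
  case True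
  then have "nat \<lfloor>2 ^ t * y\<rfloor> = i \<longleftrightarrow> \<lfloor>2 ^ t * y\<rfloor> = int i" by auto
  also have "\<dots> \<longleftrightarrow> real i \<le> 2 ^ t * y \<and> 2 ^ t * y < real i + 1" by (simp add: floor_eq_iff)
  also have "\<dots> \<longleftrightarrow> y \<in> dyadic_cell t i" by (auto simp: dyadic_cell_def field_simps)
  finally show ?thesis using True by simp
next
  case False
  have "y \<notin> dyadic_cell t i"
  proof
    assume "y \<in> dyadic_cell t i"
    then have "real i / 2 ^ t \<le> y" by (simp add: dyadic_cell_def)
    moreover have "0 \<le> real i / 2 ^ t" by simp
    ultimately show False using False by linarith
  qed
  then show ?thesis using False by simp
qed

lemma dyadic_cell_lt_1: "i < 2 ^ t \<Longrightarrow> y \<in> dyadic_cell t i \<Longrightarrow> y < 1"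
proof -
  assume i: "i < 2 ^ t" and y: "y \<in> dyadic_cell t i"
  have "real (i + 1) \<le> real (2 ^ t)" using i by (simp only: of_nat_le_iff)
  then have "(real i + 1) / 2 ^ t \<le> 1" by simp
  moreover have "y < (real i + 1) / 2 ^ t" using y by (simp add: dyadic_cell_def)
  ultimately show "y < 1" by linarith
qed

definition cell_index :: "nat \<Rightarrow> nat \<Rightarrow> (nat \<Rightarrow> real) \<Rightarrow> nat \<Rightarrow> nat" where
  "cell_index d n x = (\<lambda>j\<in>{1..d}. nat \<lfloor>2 ^ Suc n * x j\<rfloor>)"

lemma cell_index_grid:
  assumes "x \<in> {1..d} \<rightarrow>\<^sub>E {0..<1}"
  shows "cell_index d n x \<in> grid d n"
proof -
  have "nat \<lfloor>2 ^ Suc n * x j\<rfloor> < 2 ^ Suc n" if "j \<in> {1..d}" for j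
  proof -
    have "0 \<le> x j" "x j < 1" using PiE_mem[OF assms that] by auto
    then have "2 ^ Suc n * x j < 2 ^ Suc n" by simp
    then have "2 ^ Suc n * x j < real_of_int (2 ^ Suc n)" by simp
    then have "\<lfloor>2 ^ Suc n * x j\<rfloor> < 2 ^ Suc n" by (simp only: floor_less_iff)
    moreover have "0 \<le> \<lfloor>2 ^ Suc n * x j\<rfloor>" using \<open>0 \<le> x j\<close> by simp
    ultimately show ?thesis by (simp only: nat_less_iff) simp
  qed
  then show ?thesis by (simp add: grid_def cell_index_def restrict_PiE Pi_iff del: power_Suc)
qed

text \<open>At every point of the closed cube \<open>g\<close> equals a combination of indicators of
  half-open cells; on the faces \<open>x j = 1\<close> both vanish. The cells have equal volume, so
  the integral is the average over the grid.\<close>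

lemma integral_step_function:
  fixes g :: "(nat \<Rightarrow> real) \<Rightarrow> real"
  assumes step: "\<And>x. x \<in> {1..d} \<rightarrow>\<^sub>E {0..<1} \<Longrightarrow> g x = g (grid_point d n (cell_index d n x))"
    and zero: "\<And>x j. x \<in> {1..d} \<rightarrow>\<^sub>E {0..1} \<Longrightarrow> j \<in> {1..d} \<Longrightarrow> x j = 1 \<Longrightarrow> g x = 0"
  shows "(LINT x : ({1..d} \<rightarrow>\<^sub>E {0..1}) | Pi\<^sub>M {1..d} (\<lambda>_. lborel). g x)
    = (\<Sum>k\<in>grid d n. g (grid_point d n k)) / card (grid d n)"
proof -
  interpret product_sigma_finite "\<lambda>_::nat. lborel :: real measure" ..
  let ?P = "Pi\<^sub>M {1..d} (\<lambda>_. lborel :: real measure)"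
  let ?b = "\<lambda>k x. \<Prod>j\<in>{1..d}. indicator (dyadic_cell (Suc n) (k j)) (x j) :: real"
  have pw: "indicator ({1..d} \<rightarrow>\<^sub>E {0..1}) x *\<^sub>R g x = (\<Sum>k\<in>grid d n. g (grid_point d n k) * ?b k x)"
    if x: "x \<in> space ?P" for x
  proof (cases "x \<in> {1..d} \<rightarrow>\<^sub>E {0..<1}")
    case True
    let ?k = "cell_index d n x"
    have x0: "0 \<le> x j" if "j \<in> {1..d}" for j using PiE_mem[OF True that] by simp
    have "x \<in> {1..d} \<rightarrow>\<^sub>E {0..1}" using True by (auto simp: PiE_iff less_imp_le)
    moreover have b: "?b k x = (if k = ?k then 1 else 0)" if k: "k \<in> grid d n" for k
    proof (cases "k = ?k")
      case True
      have "?b k x = (\<Prod>j\<in>{1..d}. 1)"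
        unfolding True using x0
        by (intro prod.cong refl) (simp add: indicator_def mem_dyadic_cell cell_index_def del: power_Suc)
      then show ?thesis using True by simp
    next
      case False
      have "\<exists>j\<in>{1..d}. k j \<noteq> ?k j"
      proof (rule ccontr)
        assume "\<not> ?thesis"
        moreover have "k \<in> extensional {1..d}" "?k \<in> extensional {1..d}"
          using k by (auto simp: grid_def PiE_def cell_index_def)
        ultimately have "k = ?k" by (intro extensionalityI) auto
        with False show False ..
      qed
      then obtain j where j: "j \<in> {1..d}" "k j \<noteq> ?k j" by blast
      then have "x j \<notin> dyadic_cell (Suc n) (k j)"
        by (auto simp: mem_dyadic_cell cell_index_def simp del: power_Suc)
      then have "?b k x = 0" using j(1) by (intro prod_zero bexI[of _ j]) (auto simp: indicator_def)
      then show ?thesis using False by simp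
    qed
    moreover have "(\<Sum>k\<in>grid d n. g (grid_point d n k) * ?b k x)
        = (\<Sum>k\<in>grid d n. if k = ?k then g (grid_point d n k) else 0)"
    proof (rule sum.cong[OF refl])
      fix k assume "k \<in> grid d n"
      then show "g (grid_point d n k) * ?b k x = (if k = ?k then g (grid_point d n k) else 0)"
        by (subst b) auto
    qed
    moreover have "\<dots> = g (grid_point d n ?k)"
      using cell_index_grid[OF True, of n] finite_grid[of d n] by simp
    ultimately show ?thesis using step[OF True] by simp
  next
    case False
    have "x \<in> extensional {1..d}" using x by (simp add: space_PiM PiE_def)
    then obtain j where j: "j \<in> {1..d}" "x j \<notin> {0..<1}" using False by (auto simp: PiE_iff)
    have b: "?b k x = 0" if k: "k \<in> grid d n" for k
    proof -
      have "k j < 2 ^ Suc n" using k j(1) by (auto simp: grid_def simp del: power_Suc)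
      then have "x j \<notin> dyadic_cell (Suc n) (k j)"
        using dyadic_cell_lt_1[of "k j" "Suc n" "x j"] j(2) mem_dyadic_cell[of "x j" "Suc n" "k j"] by auto
      then show ?thesis using j(1) by (intro prod_zero bexI[of _ j]) (auto simp: indicator_def)
    qed
    have "indicator ({1..d} \<rightarrow>\<^sub>E {0..1}) x *\<^sub>R g x = 0"
    proof (cases "x \<in> {1..d} \<rightarrow>\<^sub>E {0..1}")
      case True
      then have "x j = 1" using j PiE_mem[OF True j(1)] by auto
      then show ?thesis using zero[OF True j(1)] by simp
    qed simp
    moreover have "(\<Sum>k\<in>grid d n. g (grid_point d n k) * ?b k x) = 0"
    proof (rule sum.neutral, rule ballI)
      fix k assume "k \<in> grid d n"
      then show "g (grid_point d n k) * ?b k x = 0" by (subst b) auto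
    qed
    ultimately show ?thesis by simp
  qed
  have int1: "integrable lborel (indicator (dyadic_cell (Suc n) i) :: real \<Rightarrow> real)" for i
    unfolding dyadic_cell_def by (intro integrable_real_indicator) (simp_all add: divide_right_mono)
  have meas: "measure lborel (dyadic_cell (Suc n) i) = 1 / 2 ^ Suc n" for i
    by (simp add: dyadic_cell_def divide_right_mono add_divide_distrib)
  have int: "integrable ?P (?b k)" for k :: "nat \<Rightarrow> nat"
    by (rule product_integrable_prod) (use int1 in auto)
  have val: "integral\<^sup>L ?P (?b k) = 1 / card (grid d n)" for k :: "nat \<Rightarrow> nat"
  proof -
    have "integral\<^sup>L ?P (?b k) = (\<Prod>j\<in>{1..d}. integral\<^sup>L lborel (indicator (dyadic_cell (Suc n) (k j))))"
      by (rule product_integral_prod) (use int1 in auto)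
    also have "\<dots> = (\<Prod>j\<in>{1..d}. 1 / 2 ^ Suc n)"
      using meas by (intro prod.cong refl) simp
    finally show ?thesis by (simp add: card_grid power_one_over del: power_Suc)
  qed
  have "(LINT x : ({1..d} \<rightarrow>\<^sub>E {0..1}) | ?P. g x) = (LINT x | ?P. (\<Sum>k\<in>grid d n. g (grid_point d n k) * ?b k x))"
    unfolding set_lebesgue_integral_def using pw by (intro Bochner_Integration.integral_cong) auto
  also have "\<dots> = (\<Sum>k\<in>grid d n. g (grid_point d n k) * integral\<^sup>L ?P (?b k))"
    using int by (subst Bochner_Integration.integral_sum) auto
  also have "\<dots> = (\<Sum>k\<in>grid d n. g (grid_point d n k)) / card (grid d n)"
    unfolding val by (simp add: sum_divide_distrib)
  finally show ?thesis .
qed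

lemma coincidence_sum_step:
  assumes x: "x \<in> {1..d} \<rightarrow>\<^sub>E {0..<1}"
  shows "coincidence_sum d n \<alpha> I t1 t2 k x = coincidence_sum d n \<alpha> I t1 t2 k (grid_point d n (cell_index d n x))"
proof -
  have eq: "r_function d \<alpha> r x = r_function d \<alpha> r (grid_point d n (cell_index d n x))"
    if r: "r \<in> hyperbolic_vectors d n" for r
  proof (rule r_function_cong)
    fix j assume j: "j \<in> {1..d}"
    have x0: "0 \<le> x j" using PiE_mem[OF x j] by simp
    have rj: "r j \<le> n" using hyperbolic_level_le[OF r j] .
    then have "nat \<lfloor>2 ^ Suc (r j) * x j\<rfloor> = nat \<lfloor>2 ^ Suc n * x j\<rfloor> div 2 ^ (Suc n - Suc (r j))"
      using x0 by (intro floor_rescale) auto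
    also have "\<dots> = nat \<lfloor>2 ^ Suc (r j) * grid_point d n (cell_index d n x) j\<rfloor>"
      unfolding floor_grid_point[OF j rj] using j by (simp add: cell_index_def del: power_Suc)
    finally show "nat \<lfloor>2 ^ Suc (r j) * x j\<rfloor> = nat \<lfloor>2 ^ Suc (r j) * grid_point d n (cell_index d n x) j\<rfloor>" .
  qed (use PiE_mem[OF x] in \<open>auto intro: grid_point_nonneg\<close>)
  show ?thesis
    unfolding coincidence_sum_def
    by (intro sum.cong refl) (auto simp: block_vectors_def intro!: arg_cong2[where f="(*)"] eq)
qed

lemma coincidence_sum_at_one:
  assumes "j \<in> {1..d}" "x j = 1"
  shows "coincidence_sum d n \<alpha> I t1 t2 k x = 0"
  unfolding coincidence_sum_def using r_function_at_one[where l = j and x = x, OF assms] by (intro sum.neutral) auto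

text \<open>A substitute for comparing norms of different orders: with
  \<open>t = \<bar>y\<bar> / z\<close> the inequality \<open>t powr p \<le> 1 + t ^ q\<close> costs
  no more than a factor \<open>2 powr (1 / p)\<close>, which is at most 2.\<close>

lemma (in flip_space) powr_norm_le:
  assumes F: "bd q F z" and z: "0 < z" and p: "1 \<le> p" "p \<le> real q"
  shows "ex (\<lambda>\<xi>. \<bar>F \<xi>\<bar> powr p) powr (1 / p) \<le> 2 * z"
proof -
  have pw: "\<bar>y\<bar> powr p \<le> z powr p * (1 + \<bar>y\<bar> ^ q / z ^ q)" for y
  proof -
    define t where "t = \<bar>y\<bar> / z"
    have t0: "0 \<le> t" using z by (simp add: t_def)
    have "t powr p \<le> 1 + t ^ q"
    proof (cases "t \<le> 1")
      case True
      then have "t powr p \<le> 1" using t0 p by (intro powr_le1) auto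
      then show ?thesis using t0 by (simp add: add_increasing2)
    next
      case False
      then have "t powr p \<le> t powr real q" using p by (intro powr_mono) auto
      then show ?thesis using False by (simp add: powr_realpow)
    qed
    moreover have "\<bar>y\<bar> = z * t" using z by (simp add: t_def)
    ultimately show ?thesis using z t0 by (simp add: powr_mult power_mult_distrib)
  qed
  have "ex (\<lambda>\<xi>. \<bar>F \<xi>\<bar> powr p) \<le> ex (\<lambda>\<xi>. z powr p * (1 + \<bar>F \<xi>\<bar> ^ q / z ^ q))"
    by (intro ex_mono pw)
  also have "\<dots> = z powr p * (ex (\<lambda>_. 1) + ex (\<lambda>\<xi>. (1 / z ^ q) * \<bar>F \<xi>\<bar> ^ q))"
    by (subst ex_cmult, subst ex_add) simp
  also have "\<dots> = z powr p * (1 + ex (\<lambda>\<xi>. \<bar>F \<xi>\<bar> ^ q) / z ^ q)"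
    by (subst ex_cmult) (simp add: ex_const)
  also have "\<dots> \<le> z powr p * 2"
    using F z by (intro mult_left_mono) (auto simp: bd_def)
  also have "\<dots> \<le> z powr p * 2 powr p"
    using p powr_mono[of 1 p 2] by (intro mult_left_mono) auto
  also have "\<dots> = (2 * z) powr p" using z by (simp add: powr_mult)
  finally have "ex (\<lambda>\<xi>. \<bar>F \<xi>\<bar> powr p) powr (1 / p) \<le> ((2 * z) powr p) powr (1 / p)"
    using p by (intro powr_mono2 ex_nonneg) auto
  also have "\<dots> = 2 * z" using z p by (simp add: powr_powr)
  finally show ?thesis .
qed

lemma coincidence_sum_norm:
  assumes d: "2 \<le> d" and n: "1 \<le> n" and p: "2 \<le> p" and k: "k \<in> {1..d}"
  shows "Lp_norm_cube d p (coincidence_sum d n \<alpha> I t1 t2 k)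
    \<le> 2 * sqrt (16 ^ (d - 1) * bound_const (d - 1) * 2560 ^ (2 * d - 3)) * (p * real n) powr (real d - 3 / 2)"
proof -
  \<comment> \<open>The order of the moments in \<open>coincidence_bd\<close> is
    \<open>8 * \<mu>\<close>; this is the least multiple of 8 not below \<open>p\<close>.\<close>
  define \<mu> where "\<mu> = nat \<lceil>p / 8\<rceil>"
  have k1: "1 \<le> \<mu>" using p unfolding \<mu>_def by linarith
  have kp: "p / 8 \<le> real \<mu>" "real \<mu> \<le> p / 8 + 1" using p unfolding \<mu>_def by linarith+
  define f where "f r k = r_function d \<alpha> r (grid_point d n k)" for r k
  interpret haar_family "grid d n" "grid_flip d n" "{1..d}" "hyperbolic_vectors d n" "Suc n" \<mu> f
    unfolding f_def[abs_def] by (rule grid_haar_family[OF k1])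
  define F where "F w = coincidence_sum d n \<alpha> I t1 t2 k (grid_point d n w)" for w
  define z where "z = sqrt (16 ^ (d - 1) * bound_const (d - 1) * (256 * real \<mu>) ^ (2 * d - 3) * real (Suc n) ^ (2 * d - 3))"
  let ?C = "16 ^ (d - 1) * bound_const (d - 1) * 2560 ^ (2 * d - 3)"
  let ?N = "{(r, s). r \<in> block_vectors d n I t1 \<and> s \<in> block_vectors d n I t2 \<and> r k = s k \<and> (\<exists>l\<in>{1..d} - {k}. r l \<noteq> s l)}"
  have sets: "?N
      = {(r, s). r \<in> block_vectors d n I t1 \<and> s \<in> block_vectors d n I t2 \<and> r \<noteq> s \<and> r k = s k}"
  proof -
    have "(\<exists>l\<in>{1..d} - {k}. r l \<noteq> s l) \<longleftrightarrow> r \<noteq> s"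
      if "r \<in> block_vectors d n I t1" "s \<in> block_vectors d n I t2" "r k = s k" for r s
    proof
      assume "r \<noteq> s"
      moreover have "r \<in> hyperbolic_vectors d n" "s \<in> hyperbolic_vectors d n"
        using that by (auto simp: block_vectors_def)
      ultimately obtain l where "l \<in> {1..d}" "r l \<noteq> s l"
        using hyperbolic_ext[of r d n s] by blast
      with that(3) show "\<exists>l\<in>{1..d} - {k}. r l \<noteq> s l" by (intro bexI[of _ l]) auto
    qed auto
    then show ?thesis by blast
  qed
  have "bd (8 * \<mu>) (\<lambda>w. \<Sum>(r, s)\<in>?N.
      f r w * f s w) z"
    using coincidence_bd[of k "block_vectors d n I t1" "block_vectors d n I t2"] k d
    by (auto simp: z_def block_vectors_def)
  then have bdF: "bd (8 * \<mu>) F z"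
    unfolding sets by (simp add: F_def[abs_def] coincidence_sum_def f_def)
  have z0: "0 < z" using k1 bound_const_pos by (simp add: z_def)
  have "Lp_norm_cube d p (coincidence_sum d n \<alpha> I t1 t2 k) = ex (\<lambda>w. \<bar>F w\<bar> powr p) powr (1 / p)"
  proof -
    have "(LINT x : ({1..d} \<rightarrow>\<^sub>E {0..1}) | Pi\<^sub>M {1..d} (\<lambda>_. lborel). \<bar>coincidence_sum d n \<alpha> I t1 t2 k x\<bar> powr p)
        = (\<Sum>w\<in>grid d n. \<bar>coincidence_sum d n \<alpha> I t1 t2 k (grid_point d n w)\<bar> powr p) / card (grid d n)"
      by (rule integral_step_function) (simp_all add: coincidence_sum_step[symmetric] coincidence_sum_at_one)
    then show ?thesis by (simp add: Lp_norm_cube_def ex_def F_def)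
  qed
  also have "\<dots> \<le> 2 * z" using kp p by (intro powr_norm_le[OF bdF z0]) auto
  also have "z \<le> sqrt ?C * (p * real n) powr (real d - 3 / 2)"
  proof -
    \<comment> \<open>A generous estimate, as \<open>256 * \<mu> \<le> 32 * p + 256\<close> and
      \<open>p \<ge> 2\<close>. With the factor 2 from \<open>Suc n \<le> 2 * n\<close> it yields
      the constant 2560.\<close>
    have a: "256 * real \<mu> \<le> 1280 * p" using kp(2) p by linarith
    have b: "real (Suc n) \<le> 2 * real n" using n by simp
    have "(256 * real \<mu>) ^ (2 * d - 3) * real (Suc n) ^ (2 * d - 3) \<le> (1280 * p) ^ (2 * d - 3) * (2 * real n) ^ (2 * d - 3)"
      using p by (intro mult_mono power_mono[OF a] power_mono[OF b]) auto
    also have "\<dots> = 2560 ^ (2 * d - 3) * (p * real n) ^ (2 * d - 3)"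
    proof -
      have "1280 * p * (2 * real n) = 2560 * (p * real n)" by simp
      then show ?thesis by (simp only: power_mult_distrib[symmetric])
    qed
    finally have "(16 ^ (d - 1) * bound_const (d - 1)) * ((256 * real \<mu>) ^ (2 * d - 3) * real (Suc n) ^ (2 * d - 3))
        \<le> (16 ^ (d - 1) * bound_const (d - 1)) * (2560 ^ (2 * d - 3) * (p * real n) ^ (2 * d - 3))"
      using bound_const_nonneg by (intro mult_left_mono) auto
    then have "z \<le> sqrt (?C * (p * real n) ^ (2 * d - 3))"
      unfolding z_def by (intro real_sqrt_le_mono) (simp only: mult.assoc)
    also have "\<dots> = sqrt ?C * sqrt ((p * real n) ^ (2 * d - 3))"
      by (rule real_sqrt_mult)
    also have "sqrt ((p * real n) ^ (2 * d - 3)) = (p * real n) powr (real d - 3 / 2)"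
    proof -
      have pn: "0 < p * real n" using p n by simp
      then have "sqrt ((p * real n) ^ (2 * d - 3)) = ((p * real n) powr real (2 * d - 3)) powr (1 / 2)"
        by (simp add: powr_half_sqrt powr_realpow)
      also have "\<dots> = (p * real n) powr (real d - 3 / 2)"
        using d by (simp add: powr_powr of_nat_diff field_simps)
      finally show ?thesis .
    qed
    finally show ?thesis .
  qed
  finally show ?thesis by simp
qed

theorem mainTheorem6:
  fixes d :: nat
  assumes "3 \<le> d"
  shows "\<exists>C::real. C > 0 \<and>
    (\<forall>(n::nat) (p::real) (\<epsilon>::real) (a::real) (q::nat) (I :: nat \<Rightarrow> nat set)
       (\<alpha> :: (nat \<Rightarrow> real set) \<Rightarrow> real).
       2 \<le> p \<longrightarrow> 0 < \<epsilon> \<longrightarrow> \<epsilon> < 1 \<longrightarrow> 0 < a \<longrightarrow>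
       q = num_blocks a \<epsilon> n \<longrightarrow> 1 \<le> q \<longrightarrow> equal_division n q I \<longrightarrow>
       (SUP (k, t\<^sub>1, t\<^sub>2) \<in> {1..d} \<times> {1..q} \<times> {1..q}.
          Lp_norm_cube d p (coincidence_sum d n \<alpha> I t\<^sub>1 t\<^sub>2 k))
         \<le> C * p powr (real d - 1 / 2) * real n powr (real d - 3 / 2))"
proof -
  define C where "C = 2 * sqrt (16 ^ (d - 1) * bound_const (d - 1) * 2560 ^ (2 * d - 3))"
  have C0: "0 < C" using bound_const_pos[of "d - 1"] by (simp add: C_def)
  have "(SUP (k, t1, t2) \<in> {1..d} \<times> {1..q} \<times> {1..q}. Lp_norm_cube d p (coincidence_sum d n \<alpha> I t1 t2 k))
      \<le> C * p powr (real d - 1 / 2) * real n powr (real d - 3 / 2)"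
    if p: "2 \<le> p" and q: "q = num_blocks a \<epsilon> n" "1 \<le> q"
    for n q :: nat and p \<epsilon> a :: real and I :: "nat \<Rightarrow> nat set" and \<alpha> :: "(nat \<Rightarrow> real set) \<Rightarrow> real"
  proof (rule cSUP_least)
    \<comment> \<open>For \<open>n = 0\<close> the number of blocks is 0 because
      \<open>0 powr \<epsilon> = 0\<close>.\<close>
    have n: "1 \<le> n"
    proof (rule ccontr)
      assume "\<not> 1 \<le> n"
      then have "n = 0" by simp
      then show False using q by (simp add: num_blocks_def)
    qed
    show "{1..d} \<times> {1..q} \<times> {1..q} \<noteq> {}" using assms q(2) by auto
    fix w assume w: "w \<in> {1..d} \<times> {1..q} \<times> {1..q}"
    obtain k t1 t2 where [simp]: "w = (k, t1, t2)" by (cases w)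
    have "Lp_norm_cube d p (coincidence_sum d n \<alpha> I t1 t2 k) \<le> C * (p * real n) powr (real d - 3 / 2)"
      unfolding C_def using w assms by (intro coincidence_sum_norm n p) auto
    also have "\<dots> = C * p powr (real d - 3 / 2) * real n powr (real d - 3 / 2)"
      using p by (simp add: powr_mult)
    \<comment> \<open>The argument yields the power \<open>d - 3 / 2\<close> of \<open>p\<close>,
      which is smaller than the stated one since \<open>p \<ge> 1\<close>.\<close>
    also have "\<dots> \<le> C * p powr (real d - 1 / 2) * real n powr (real d - 3 / 2)"
      using p C0 by (intro mult_right_mono mult_left_mono powr_mono) auto
    finally show "(case w of (k, t1, t2) \<Rightarrow> Lp_norm_cube d p (coincidence_sum d n \<alpha> I t1 t2 k))
        \<le> C * p powr (real d - 1 / 2) * real n powr (real d - 3 / 2)" by simp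
  qed
  with C0 show ?thesis by blast
qed

end
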